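(* For all integers $n\ge 10$, \[ T(n,6)=8n^2+2n+6, \] that is, the minimal internal interface equals $n^2+n+3$. Moreover the optimal partitions are exactly: one block $(n-1)\times n\times n$, one slab $1\times(n-1)\times n$, and a column $1\times 1\times n$ cut into four sticks $1\times 1\times \ell_i$ with distinct lengths $\ell_1+\ell_2+\ell_3+\ell_4=n$. In particular the number of optimal partitions, up to symmetry, equals the number of partitions of $n$ into four distinct parts. For $5\le n\le 9$ one has $T(n,6)=8n^2+2n+12$, and $T(3,6)=100$, $T(4,6)=148$.
   Context: For positive integers $n,k$, consider partitions of the cube $[0,n]^3$ into $k$ axis-aligned boxes $x_j\times y_j\times z_j$ with integer sides whose sorted dimension triples (equivalently, dimension multisets) are pairwise distinct. $T(n,k)$ is the minimum, over all such partitions, of the total surface area $\sum_{j=1}^k 2(x_jy_j+y_jz_j+z_jx_j)$. The internal interface $I$ of a partition is the total area of the internal interfaces between pieces, so that the total surface area equals $6n^2+2I$; the minimal internal interface is the minimum of $I$ over the partitions admitted in the definition of $T(n,6)$. A partition is optimal if it attains $T(n,6)$. The lengths $\ell_i$ are positive integers.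
   Formalization: "Up to symmetry" is taken as up to symmetries of the cube together with reordering the four sticks in the column; with cube symmetries alone each partition of n into four distinct parts would give 12 classes (e.g. 12 instead of 1 for n = 10). *)

theory Defs
  imports "HOL-Analysis.Analysis"
begin

definition cube :: "nat \<Rightarrow> (real ^ 3) set" where
  "cube n = cbox 0 (vec (real n))"

definition side :: "(real ^ 3) set \<Rightarrow> 3 \<Rightarrow> real" where
  "side K i = measure lborel ((\<lambda>x. x $ i) ` K)"

definition dims :: "(real ^ 3) set \<Rightarrow> real multiset" where
  "dims K = {# side K 1, side K 2, side K 3 #}"

(* No integrality of the positions of the pieces is required, only of their sides.
   division_of admits degenerate boxes, hence the positivity condition. *)
definition admissible :: "nat \<Rightarrow> nat \<Rightarrow> (real ^ 3) set set \<Rightarrow> bool" where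
  "admissible n k P \<longleftrightarrow>
     P division_of cube n \<and> card P = k \<and>
     (\<forall>K\<in>P. \<forall>i. side K i \<in> \<nat> \<and> side K i > 0) \<and>
     inj_on dims P"

definition surface_area :: "(real ^ 3) set \<Rightarrow> real" where
  "surface_area K = 2 * (side K 1 * side K 2 + side K 2 * side K 3 + side K 3 * side K 1)"

definition total_surface :: "(real ^ 3) set set \<Rightarrow> real" where
  "total_surface P = (\<Sum>K\<in>P. surface_area K)"

definition T :: "nat \<Rightarrow> nat \<Rightarrow> real" where
  "T n k = (LEAST s. \<exists>P. admissible n k P \<and> s = total_surface P)"

(* Area of a box F with at least one vanishing side: at most one of the three products
   is nonzero. Contacts along an edge, at a corner, or empty ones get area 0. *)
definition flat_area :: "(real ^ 3) set \<Rightarrow> real" where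
  "flat_area F = side F 1 * side F 2 + side F 2 * side F 3 + side F 3 * side F 1"

(* Every unordered pair D = {K, L} of distinct pieces contributes the area of K \<inter> L. *)
definition internal_interface :: "(real ^ 3) set set \<Rightarrow> real" where
  "internal_interface P = (\<Sum>D\<in>{D. D \<subseteq> P \<and> card D = 2}. flat_area (\<Inter>D))"

definition min_interface :: "nat \<Rightarrow> nat \<Rightarrow> real" where
  "min_interface n k = (LEAST s. \<exists>P. admissible n k P \<and> s = internal_interface P)"

definition optimal :: "nat \<Rightarrow> (real ^ 3) set set \<Rightarrow> bool" where
  "optimal n P \<longleftrightarrow> admissible n 6 P \<and> total_surface P = T n 6"

definition four_distinct_parts :: "nat \<Rightarrow> nat set set" where
  "four_distinct_parts n = {L. finite L \<and> card L = 4 \<and> 0 \<notin> L \<and> \<Sum>L = n}"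

(* C cuts the box cbox a b, of dimensions 1 x 1 x n, into the sticks 1 x 1 x l with l in L. *)
definition cut_column :: "nat \<Rightarrow> nat set \<Rightarrow> (real ^ 3) set set \<Rightarrow> bool" where
  "cut_column n L C \<longleftrightarrow>
     (\<exists>a b. C division_of cbox a b \<and> dims (cbox a b) = {# 1, 1, real n #}) \<and>
     bij_betw dims C ((\<lambda>l. {# 1, 1, real l #}) ` L)"

definition block_slab_sticks :: "nat \<Rightarrow> (real ^ 3) set set \<Rightarrow> bool" where
  "block_slab_sticks n P \<longleftrightarrow>
     P division_of cube n \<and>
     (\<exists>B S C. \<exists>L\<in>four_distinct_parts n.
        P = {B, S} \<union> C \<and>
        dims B = {# real n - 1, real n, real n #} \<and>
        dims S = {# 1, real n - 1, real n #} \<and>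
        cut_column n L C)"

definition cube_symmetry :: "nat \<Rightarrow> (real ^ 3 \<Rightarrow> real ^ 3) \<Rightarrow> bool" where
  "cube_symmetry n g \<longleftrightarrow> (\<forall>x y. dist (g x) (g y) = dist x y) \<and> g ` cube n = cube n"

(* C and D cut the same 1 x 1 x n column into sticks of the same lengths, possibly
   arranged in a different order. *)
definition reordered_column ::
    "nat \<Rightarrow> (real ^ 3) set set \<Rightarrow> (real ^ 3) set set \<Rightarrow> bool" where
  "reordered_column n C D \<longleftrightarrow>
     (\<exists>a b. dims (cbox a b) = {# 1, 1, real n #} \<and>
        C division_of cbox a b \<and> D division_of cbox a b) \<and>
     image_mset dims (mset_set C) = image_mset dims (mset_set D)"

(* Equality up to the symmetries of the cube and the order of the sticks in a column.
   The order has to be disregarded: the 24 orders of four sticks of distinct lengths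
   form 12 classes under the symmetries of the cube, all given by the same partition
   of n into distinct parts. *)
definition same_up_to_symmetry ::
    "nat \<Rightarrow> (real ^ 3) set set \<Rightarrow> (real ^ 3) set set \<Rightarrow> bool" where
  "same_up_to_symmetry n P Q \<longleftrightarrow>
     (\<exists>g C D. cube_symmetry n g \<and>
        C \<subseteq> (`) g ` P \<and> D \<subseteq> Q \<and> (`) g ` P - C = Q - D \<and>
        reordered_column n C D)"

definition symmetry_classes :: "nat \<Rightarrow> (real ^ 3) set set set set" where
  "symmetry_classes n =
     {P. optimal n P} //
       {(P, Q). optimal n P \<and> optimal n Q \<and> same_up_to_symmetry n P Q}"

end

theory Submission
  imports Defs
begin

text \<open>For a dissection of a box \<open>D\<close> call the sum of \<open>xy + yz + zx\<close> over the pieces minus the same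
  expression for \<open>D\<close> its cost. For a cube this is the internal interface (\<open>interface_eq_cost\<close>), and
  the total surface is \<open>6n\<^sup>2\<close> plus twice the cost, so everything is about bounding the cost from below.

  The cost is a sum of three excesses, one for each direction \<open>i\<close>: the total area of the projections
  of the pieces along \<open>i\<close> minus the area of the projection of \<open>D\<close>. The pieces touching a face of \<open>D\<close>
  tile it (\<open>face_lower\<close>, \<open>face_upper\<close>), so the excess is the area of the pieces not touching
  the lower face, and likewise for the upper face. Call a piece a plate if it extends through \<open>D\<close> in
  two directions, and an end plate if it moreover touches a face of \<open>D\<close> in the third. There are three
  possibilities (\<open>tiling_cases\<close>).

  \<^item> An end plate can be cut off. It contributes the area of its large face, and what remains is a
    dissection of a smaller box into one piece less.
  \<^item> There is no plate. A part of the projection along \<open>i\<close> that is not covered by pieces extending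
    through \<open>D\<close> along \<open>i\<close> is covered at least twice. As no piece extends through \<open>D\<close> in two
    directions, the volumes of the pieces that extend through it in some direction add up to at most
    the volume of \<open>D\<close>. If all sides of \<open>D\<close> are at least \<open>d\<close>, this gives a cost of at least the sum of
    the three face areas of \<open>D\<close> minus \<open>vol D / d\<close>.
  \<^item> There are plates, but no end plates. Then there are at least five pieces, and the cost exceeds
    twice the area of a face of \<open>D\<close>.

  In the cube with \<open>n \<ge> 4\<close> and six pieces the last two cases cost at least \<open>2n\<^sup>2\<close>. The first case leads to
  a box \<open>n \<times> n \<times> m\<close> with five pieces, then to \<open>n \<times> p \<times> 1\<close> with four. Iterating
  (\<open>cost_two_thickness_two\<close> up to \<open>cost_six\<close>), the cost is at least \<open>n\<^sup>2 + n + 6\<close>, unless the two plates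
  cut off leave a column \<open>1 \<times> 1 \<times> n\<close>. That the dimensions of the pieces are distinct enters
  through small cases, where few small rectangles are available. A column cut into four sticks of
  distinct lengths costs \<open>n\<^sup>2 + n + 3\<close> in total and requires \<open>n \<ge> 1 + 2 + 3 + 4\<close>. For \<open>n = 3\<close> the volumes of the
  pieces alone decide.

  Two optimal dissections with the same stick lengths differ by a signed permutation of the
  coordinates and the order of the sticks. Conversely, isometries preserve the volumes of the pieces,
  and these determine the stick lengths (\<open>symmetric_iff_stick_lengths\<close>).\<close>

section \<open>Boxes and their sides\<close>

text \<open>The lower and upper corners of a nonempty box.\<close>

abbreviation lo :: "(real ^ 3) set \<Rightarrow> real ^ 3" where "lo \<equiv> interval_lowerbound"
abbreviation hi :: "(real ^ 3) set \<Rightarrow> real ^ 3" where "hi \<equiv> interval_upperbound"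

text \<open>The area of the projection of \<open>K\<close> along the \<open>i\<close>-th axis.\<close>

definition area :: "3 \<Rightarrow> (real ^ 3) set \<Rightarrow> real" where
  "area i K = (\<Prod>j\<in>UNIV - {i}. side K j)"

text \<open>The three axes in some order. Most arguments are about one distinguished direction; naming the
  axes \<open>i\<close>, \<open>j\<close>, \<open>k\<close> avoids a case distinction between the three coordinates.\<close>

definition axes :: "3 \<Rightarrow> 3 \<Rightarrow> 3 \<Rightarrow> bool" where
  "axes i j k \<longleftrightarrow> i \<noteq> j \<and> j \<noteq> k \<and> k \<noteq> i"

lemma three_neq: "(1::3) \<noteq> 2" "(2::3) \<noteq> 3" "(3::3) \<noteq> 1" "(2::3) \<noteq> 1" "(3::3) \<noteq> 2" "(1::3) \<noteq> 3"
  by simp_all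

lemma axes_cases:
  assumes "axes i j k"
  obtains "i = 1" "j = 2" "k = 3" | "i = 1" "j = 3" "k = 2" | "i = 2" "j = 1" "k = 3"
    | "i = 2" "j = 3" "k = 1" | "i = 3" "j = 1" "k = 2" | "i = 3" "j = 2" "k = 1"
  using assms exhaust_3[of i] exhaust_3[of j] exhaust_3[of k] unfolding axes_def by metis

lemma axes_exists: "\<exists>j k. axes i j k"
  using exhaust_3[of i] three_neq unfolding axes_def by metis

lemma axes_third: "i \<noteq> j \<Longrightarrow> \<exists>k. axes i j k"
  using exhaust_3[of i] exhaust_3[of j] three_neq unfolding axes_def by metis

lemma axes_UNIV: "axes i j k \<Longrightarrow> (UNIV :: 3 set) = {i, j, k}"
  by (erule axes_cases) (auto simp: UNIV_3)

lemma axes_diff: "axes i j k \<Longrightarrow> UNIV - {i} = {j, k}"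
  using axes_UNIV[of i j k] unfolding axes_def by auto

lemma axes_other: "axes i j k \<Longrightarrow> l \<noteq> i \<longleftrightarrow> l = j \<or> l = k"
  using axes_UNIV[of i j k] unfolding axes_def by auto

lemma area_axes: "axes i j k \<Longrightarrow> area i K = side K j * side K k"
  unfolding area_def by (subst axes_diff) (auto simp: axes_def)

lemma flat_area_axes:
  "axes i j k \<Longrightarrow> flat_area K = side K i * side K j + side K j * side K k + side K k * side K i"
  by (erule axes_cases) (auto simp: flat_area_def)

lemma dims_axes: "axes i j k \<Longrightarrow> dims K = {# side K i, side K j, side K k #}"
  by (erule axes_cases) (auto simp: dims_def)

lemma prod_axes: "axes i j k \<Longrightarrow> (\<Prod>l\<in>UNIV. f l) = f i * f j * (f k :: 'a :: comm_monoid_mult)"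
  by (simp add: axes_UNIV) (auto simp: axes_def mult_ac)

lemma sum_axes: "axes i j k \<Longrightarrow> (\<Sum>l\<in>UNIV. f l) = f i + f j + (f k :: 'a :: comm_monoid_add)"
  by (simp add: axes_UNIV) (auto simp: axes_def add_ac)

lemma axes_123: "axes 1 2 3" by (simp add: axes_def)

lemma flat_area_sum: "flat_area K = (\<Sum>i\<in>UNIV. area i K)"
  unfolding sum_axes[OF axes_123]
  using area_axes[of 1 2 3 K] area_axes[of 2 3 1 K] area_axes[of 3 1 2 K]
  by (simp add: axes_def flat_area_def)

lemma cbox_ne_cart: "cbox a (b :: real ^ 'n) \<noteq> {} \<longleftrightarrow> (\<forall>i. a $ i \<le> b $ i)"
  by (simp add: interval_ne_empty_cart)

lemma image_component_cbox:
  assumes "cbox a (b :: real ^ 'n) \<noteq> {}"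
  shows "(\<lambda>x. x $ i) ` cbox a b = {a $ i .. b $ i}"
proof -
  have ab: "\<And>j. a $ j \<le> b $ j" using assms cbox_ne_cart by blast
  have "t \<in> (\<lambda>x. x $ i) ` cbox a b" if "t \<in> {a $ i .. b $ i}" for t
    by (rule image_eqI[where x = "\<chi> j. if j = i then t else a $ j"])
      (use that ab in \<open>auto simp: mem_box_cart\<close>)
  then show ?thesis by (auto simp: mem_box_cart)
qed

lemma side_cbox: "cbox a b \<noteq> {} \<Longrightarrow> side (cbox a b) i = b $ i - a $ i"
  unfolding side_def by (subst image_component_cbox) (auto simp: cbox_ne_cart)

lemma side_empty [simp]: "side {} i = 0"
  unfolding side_def by simp

lemma lo_cbox: "cbox a b \<noteq> {} \<Longrightarrow> lo (cbox a b) = a"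
  and hi_cbox: "cbox a b \<noteq> {} \<Longrightarrow> hi (cbox a b) = b"
  by (simp_all add: box_ne_empty)

lemma content_cbox_prod: "measure lborel (cbox p q) = (\<Prod>j\<in>UNIV. max 0 (q $ j - p $ j))"
  for p q :: "real ^ 3"
proof (cases "cbox p q = {}")
  case True
  then obtain i where "q $ i < p $ i" by (auto simp: interval_eq_empty_cart)
  then have "max 0 (q $ i - p $ i) = 0" by simp
  then have "(\<Prod>j\<in>UNIV. max 0 (q $ j - p $ j)) = 0" by (meson UNIV_I finite prod_zero)
  with True show ?thesis by simp
next
  case False
  then have "\<And>j. p $ j \<le> q $ j" by (simp add: cbox_ne_cart)
  then show ?thesis using False by (simp add: content_cbox_cart)
qed

section \<open>Sections of a division\<close>

text \<open>A box inside a divided box receives its volume from the pieces of the division.\<close>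

lemma content_inter_division:
  fixes a b u v :: "'a :: euclidean_space"
  assumes P: "P division_of cbox a b" and sub: "cbox u v \<subseteq> cbox a b"
  shows "(\<Sum>L\<in>P. measure lborel (cbox u v \<inter> L)) = measure lborel (cbox u v)"
proof -
  let ?N = "{L\<in>P. cbox u v \<inter> L \<noteq> {}}"
  have fin: "finite P" using P by blast
  have "{cbox u v \<inter> L | L. L \<in> P \<and> cbox u v \<inter> L \<noteq> {}} = (\<lambda>L. cbox u v \<inter> L) ` ?N" by auto
  then have "measure lborel (cbox u v) = sum (\<lambda>K. measure lborel K) ((\<lambda>L. cbox u v \<inter> L) ` ?N)"
    using additive_content_division[OF division_inter_1[OF P sub]] by simp
  also have "\<dots> = (\<Sum>L\<in>?N. measure lborel (cbox u v \<inter> L))"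
  proof (subst sum.reindex_nontrivial)
    fix K L assume K: "K \<in> ?N" "L \<in> ?N" "K \<noteq> L" "cbox u v \<inter> K = cbox u v \<inter> L"
    then have "cbox u v \<inter> K \<subseteq> K \<inter> L" by auto
    moreover obtain c d where cd: "cbox u v \<inter> K = cbox c d"
      using K P by (metis (no_types, lifting) Int_interval division_ofD(4) mem_Collect_eq)
    moreover have "interior (K \<inter> L) = {}" using K division_ofD(5)[OF P] by auto
    ultimately have "interior (cbox c d) = {}" by (metis interior_mono subset_empty)
    then show "measure lborel (cbox u v \<inter> K) = 0" by (simp add: cd content_eq_0_interior)
  qed (use fin in auto)
  also have "\<dots> = (\<Sum>L\<in>P. measure lborel (cbox u v \<inter> L))"
    by (rule sum.mono_neutral_left) (use fin in auto)
  finally show ?thesis by simp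
qed

text \<open>The length of the intersection of the intervals \<open>[p, q]\<close> and \<open>[r, s]\<close>.\<close>

definition overlap :: "real \<Rightarrow> real \<Rightarrow> real \<Rightarrow> real \<Rightarrow> real" where
  "overlap p q r s = max 0 (min q s - max p r)"

text \<open>A dissection of the box from \<open>a\<close> to \<open>b\<close> into boxes with positive integer sides. The corners of the
  pieces are not required to be integral.\<close>

locale tiled =
  fixes P :: "(real ^ 3) set set" and a b :: "real ^ 3"
  assumes div: "P division_of cbox a b"
    and side_pos: "K \<in> P \<Longrightarrow> side K i > 0"
    and side_Nats: "K \<in> P \<Longrightarrow> side K i \<in> \<nat>"
begin

lemma fin: "finite P" using div by blast

lemma piece:
  assumes "K \<in> P"
  shows "K = cbox (lo K) (hi K)" "lo K $ i < hi K $ i" "a $ i \<le> lo K $ i" "hi K $ i \<le> b $ i"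
    "side K i = hi K $ i - lo K $ i"
proof -
  obtain c d where cd: "K = cbox c d" "K \<noteq> {}" "K \<subseteq> cbox a b"
    using div assms by (metis division_ofD(2,3,4))
  then have lh: "lo K = c" "hi K = d" using lo_cbox hi_cbox by metis+
  show 1: "K = cbox (lo K) (hi K)" using cd lh by simp
  have sd: "side K i = hi K $ i - lo K $ i" using side_cbox[of c d i] cd lh by simp
  then show "side K i = hi K $ i - lo K $ i" .
  show "lo K $ i < hi K $ i" using sd side_pos[OF assms, of i] by simp
  have "\<And>j. c $ j \<le> d $ j" using cd cbox_ne_cart by blast
  then have "c \<in> cbox c d" "d \<in> cbox c d" by (auto simp: mem_box_cart)
  then have "c \<in> cbox a b" "d \<in> cbox a b" using cd by blast+
  then show "a $ i \<le> lo K $ i" "hi K $ i \<le> b $ i" using lh by (auto simp: mem_box_cart)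
qed

lemma content_inter_piece:
  assumes "L \<in> P"
  shows "measure lborel (cbox p q \<inter> L) = (\<Prod>j\<in>UNIV. overlap (p $ j) (q $ j) (lo L $ j) (hi L $ j))"
proof -
  have "cbox p q \<inter> L = cbox (\<chi> i. max (p $ i) (lo L $ i)) (\<chi> i. min (q $ i) (hi L $ i))"
    by (subst piece(1)[OF assms]) (auto simp: mem_box_cart)
  then show ?thesis by (simp add: content_cbox_prod overlap_def)
qed

text \<open>The pieces that meet a plane \<open>x\<^sub>i = t\<close>, and continue above it, tile every rectangle in that plane.
  The proof applies volumes to a slab above the plane that is too thin for a piece to begin or to
  end inside it.\<close>

lemma section_sum:
  assumes uv: "\<And>j. a $ j \<le> u $ j" "\<And>j. u $ j \<le> v $ j" "\<And>j. v $ j \<le> b $ j"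
    and t: "a $ i \<le> t" "t < b $ i"
  shows "(\<Sum>L | L \<in> P \<and> lo L $ i \<le> t \<and> t < hi L $ i.
            \<Prod>j\<in>UNIV - {i}. overlap (u $ j) (v $ j) (lo L $ j) (hi L $ j))
         = (\<Prod>j\<in>UNIV - {i}. v $ j - u $ j)"
proof -
  \<comment> \<open>the next coordinate above \<open>t\<close> at which a piece begins or ends\<close>
  let ?X = "{x. (x = b $ i \<or> (\<exists>L\<in>P. x = lo L $ i \<or> x = hi L $ i)) \<and> t < x}"
  have "finite (insert (b $ i) ((\<lambda>L. lo L $ i) ` P \<union> (\<lambda>L. hi L $ i) ` P))" using fin by simp
  then have fX: "finite ?X" by (rule rev_finite_subset) auto
  have bX: "b $ i \<in> ?X" using t by simp
  define t' where "t' = Min ?X"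
  have t'X: "t' \<in> ?X" unfolding t'_def using Min_in[OF fX] bX by blast
  then have tt': "t < t'" by simp
  have t'_le: "x \<in> ?X \<Longrightarrow> t' \<le> x" for x unfolding t'_def using fX by (rule Min_le)
  have t'b: "t' \<le> b $ i" using t'_le[OF bX] .
  define p q where "p = (\<chi> j. if j = i then t else u $ j)" and "q = (\<chi> j. if j = i then t' else v $ j)"
  let ?A = "\<lambda>L. \<Prod>j\<in>UNIV - {i}. overlap (u $ j) (v $ j) (lo L $ j) (hi L $ j)"
  have sub: "cbox p q \<subseteq> cbox a b"
  proof
    fix x assume "x \<in> cbox p q"
    then have x: "p $ j \<le> x $ j" "x $ j \<le> q $ j" for j by (auto simp: mem_box_cart)
    have "a $ j \<le> x $ j \<and> x $ j \<le> b $ j" for j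
      using x[of j] uv(1)[of j] uv(3)[of j] t t'b unfolding p_def q_def by (cases "j = i") auto
    then show "x \<in> cbox a b" by (simp add: mem_box_cart)
  qed
  have ovi: "overlap t t' (lo L $ i) (hi L $ i) = (if lo L $ i \<le> t \<and> t < hi L $ i then t' - t else 0)"
    if "L \<in> P" for L
  proof -
    have "lo L $ i \<le> t \<or> t' \<le> lo L $ i" "hi L $ i \<le> t \<or> t' \<le> hi L $ i"
      using t'_le[of "lo L $ i"] t'_le[of "hi L $ i"] that by force+
    then show ?thesis using piece(2)[OF that, of i] tt' unfolding overlap_def by (auto simp: max_def min_def)
  qed
  have "measure lborel (cbox p q \<inter> L) = (if lo L $ i \<le> t \<and> t < hi L $ i then (t' - t) * ?A L else 0)"
    if "L \<in> P" for L
  proof -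
    have "measure lborel (cbox p q \<inter> L) =
      overlap t t' (lo L $ i) (hi L $ i) * (\<Prod>j\<in>UNIV - {i}. overlap (p $ j) (q $ j) (lo L $ j) (hi L $ j))"
      unfolding content_inter_piece[OF that] by (subst prod.remove[of _ i]) (auto simp: p_def q_def)
    also have "(\<Prod>j\<in>UNIV - {i}. overlap (p $ j) (q $ j) (lo L $ j) (hi L $ j)) = ?A L"
      by (rule prod.cong) (auto simp: p_def q_def)
    finally show ?thesis using ovi[OF that] by simp
  qed
  then have "measure lborel (cbox p q) = (\<Sum>L\<in>P. if lo L $ i \<le> t \<and> t < hi L $ i then (t' - t) * ?A L else 0)"
    using content_inter_division[OF div sub] by simp
  also have "\<dots> = (t' - t) * (\<Sum>L | L \<in> P \<and> lo L $ i \<le> t \<and> t < hi L $ i. ?A L)"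
    using fin by (simp add: sum.inter_filter[symmetric] sum_distrib_left)
  finally have 1: "measure lborel (cbox p q) = (t' - t) * (\<Sum>L | L \<in> P \<and> lo L $ i \<le> t \<and> t < hi L $ i. ?A L)" .
  have "measure lborel (cbox p q) = (t' - t) * (\<Prod>j\<in>UNIV - {i}. max 0 (q $ j - p $ j))"
    unfolding content_cbox_prod by (subst prod.remove[of _ i]) (use tt' in \<open>auto simp: p_def q_def\<close>)
  also have "(\<Prod>j\<in>UNIV - {i}. max 0 (q $ j - p $ j)) = (\<Prod>j\<in>UNIV - {i}. v $ j - u $ j)"
    by (rule prod.cong) (use uv in \<open>auto simp: p_def q_def\<close>)
  finally show ?thesis using 1 tt' by simp
qed

end

section \<open>Lower bounds for the cost of a dissection\<close>

text \<open>The cost of a dissection \<open>P\<close> of \<open>D\<close>: half of the total surface of the pieces minus half of the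
  surface of \<open>D\<close>. Here \<open>flat_area\<close> is half the surface of a box.\<close>

definition cost :: "(real ^ 3) set \<Rightarrow> (real ^ 3) set set \<Rightarrow> real" where
  "cost D P = (\<Sum>K\<in>P. flat_area K) - flat_area D"

text \<open>The volume of a box, as a product of its sides.\<close>

definition vol :: "(real ^ 3) set \<Rightarrow> real" where
  "vol K = (\<Prod>i\<in>UNIV. side K i)"

lemma axes_all: "axes i j k \<Longrightarrow> Q j \<Longrightarrow> Q k \<Longrightarrow> l \<noteq> i \<Longrightarrow> Q l"
  using axes_other[of i j k l] by auto

lemma vol_area: "vol K = side K i * area i K"
  unfolding vol_def area_def by (rule prod.remove) auto

lemma Nats_pos_ge1: "x \<in> \<nat> \<Longrightarrow> x > 0 \<Longrightarrow> x \<ge> (1 :: real)"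
  by (auto elim!: Nats_cases)

lemma overlap_sub: "p \<le> r \<Longrightarrow> s \<le> q \<Longrightarrow> r \<le> s \<Longrightarrow> overlap p q r s = s - r"
  unfolding overlap_def by (auto simp: max_def min_def)

context tiled
begin

text \<open>The contribution of the direction \<open>i\<close> to the cost: the projections of the pieces along \<open>i\<close> cover
  the projection of the whole box, and the excess measures by how much they overlap.\<close>

definition excess :: "3 \<Rightarrow> real" where
  "excess i = (\<Sum>K\<in>P. area i K) - area i (cbox a b)"

text \<open>\<open>K\<close> extends through the whole box in direction \<open>i\<close>.\<close>

definition full :: "3 \<Rightarrow> (real ^ 3) set \<Rightarrow> bool" where
  "full i K \<longleftrightarrow> lo K $ i = a $ i \<and> hi K $ i = b $ i"

lemma side_ge1: "K \<in> P \<Longrightarrow> side K i \<ge> 1"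
  using Nats_pos_ge1 side_Nats side_pos by blast

lemma area_ge1: "K \<in> P \<Longrightarrow> area i K \<ge> 1"
  unfolding area_def using side_ge1 by (intro prod_ge_1) auto

lemma ab_less: "P \<noteq> {} \<Longrightarrow> a $ i < b $ i"
  using piece(2,3,4)[of _ i] by fastforce

lemma whole_ne: "P \<noteq> {} \<Longrightarrow> cbox a b \<noteq> {}"
  using ab_less cbox_ne_cart less_imp_le by metis

lemma side_whole: "P \<noteq> {} \<Longrightarrow> side (cbox a b) i = b $ i - a $ i"
  using side_cbox whole_ne by blast

lemma side_le_whole: "K \<in> P \<Longrightarrow> side K i \<le> side (cbox a b) i"
  using piece(3,4,5)[of K i] side_whole[of i] by fastforce

lemma full_iff: "K \<in> P \<Longrightarrow> full i K \<longleftrightarrow> side K i = side (cbox a b) i"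
  using piece(3,4,5)[of K i] side_whole[of i] unfolding full_def by fastforce

lemma area_whole_pos: "P \<noteq> {} \<Longrightarrow> area i (cbox a b) > 0"
  unfolding area_def using ab_less side_whole by (intro prod_pos) auto

lemma pieces_eq:
  assumes "K \<in> P" "L \<in> P" "\<And>i. max (lo K $ i) (lo L $ i) < min (hi K $ i) (hi L $ i)"
  shows "K = L"
proof (rule ccontr)
  assume ne: "K \<noteq> L"
  define x :: "real ^ 3"
    where "x = (\<chi> i. (max (lo K $ i) (lo L $ i) + min (hi K $ i) (hi L $ i)) / 2)"
  have "lo K $ i < x $ i \<and> x $ i < hi K $ i \<and> lo L $ i < x $ i \<and> x $ i < hi L $ i" for i
    using assms(3)[of i] unfolding x_def by (auto simp: max_def min_def split: if_splits)
  then have "x \<in> box (lo K) (hi K) \<and> x \<in> box (lo L) (hi L)" by (simp add: mem_box_cart)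
  then have "x \<in> interior K \<inter> interior L"
    using piece(1)[OF assms(1)] piece(1)[OF assms(2)] by (metis IntI interior_cbox)
  then show False using division_ofD(5)[OF div assms(1,2) ne] by blast
qed

lemma piece_within_full:
  assumes "K \<in> P" "L \<in> P" "full j K"
  shows "max (lo K $ j) (lo L $ j) < min (hi K $ j) (hi L $ j)"
  using assms piece(2,3,4)[of L j] unfolding full_def by auto

lemma section_whole:
  assumes "P \<noteq> {}" "a $ i \<le> t" "t < b $ i"
  shows "(\<Sum>L | L \<in> P \<and> lo L $ i \<le> t \<and> t < hi L $ i. area i L) = area i (cbox a b)"
proof -
  have "(\<Sum>L | L \<in> P \<and> lo L $ i \<le> t \<and> t < hi L $ i. area i L)
      = (\<Sum>L | L \<in> P \<and> lo L $ i \<le> t \<and> t < hi L $ i.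
            \<Prod>j\<in>UNIV - {i}. overlap (a $ j) (b $ j) (lo L $ j) (hi L $ j))"
  proof (rule sum.cong[OF refl])
    fix L assume "L \<in> {L \<in> P. lo L $ i \<le> t \<and> t < hi L $ i}"
    then have L: "L \<in> P" by simp
    have "overlap (a $ j) (b $ j) (lo L $ j) (hi L $ j) = side L j" for j
      using piece(2-5)[OF L, of j] by (simp add: overlap_sub)
    then show "area i L = (\<Prod>j\<in>UNIV - {i}. overlap (a $ j) (b $ j) (lo L $ j) (hi L $ j))"
      unfolding area_def by simp
  qed
  also have "\<dots> = (\<Prod>j\<in>UNIV - {i}. b $ j - a $ j)"
    by (rule section_sum) (use assms ab_less less_imp_le in auto)
  finally show ?thesis unfolding area_def using side_whole[OF assms(1)] by simp
qed

text \<open>The pieces touching a face of the box tile it.\<close>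

lemma face_lower:
  assumes "P \<noteq> {}"
  shows "(\<Sum>L | L \<in> P \<and> lo L $ i = a $ i. area i L) = area i (cbox a b)"
proof -
  have "{L. L \<in> P \<and> lo L $ i = a $ i} = {L. L \<in> P \<and> lo L $ i \<le> a $ i \<and> a $ i < hi L $ i}"
    using piece(2,3)[of _ i] by fastforce
  then show ?thesis using section_whole[OF assms, of i "a $ i"] ab_less[OF assms] by simp
qed

lemma face_upper:
  assumes "P \<noteq> {}"
  shows "(\<Sum>L | L \<in> P \<and> hi L $ i = b $ i. area i L) = area i (cbox a b)"
proof -
  \<comment> \<open>a section so close to the upper face that it only meets pieces touching that face\<close>
  let ?X = "{x. (x = a $ i \<or> (\<exists>L\<in>P. x = lo L $ i \<or> x = hi L $ i)) \<and> x < b $ i}"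
  have "finite (insert (a $ i) ((\<lambda>L. lo L $ i) ` P \<union> (\<lambda>L. hi L $ i) ` P))" using fin by simp
  then have fX: "finite ?X" by (rule rev_finite_subset) auto
  have aX: "a $ i \<in> ?X" using ab_less[OF assms] by simp
  define t where "t = Max ?X"
  have "t \<in> ?X" unfolding t_def using Max_in[OF fX] aX by blast
  then have tb: "t < b $ i" by simp
  have le: "x \<in> ?X \<Longrightarrow> x \<le> t" for x unfolding t_def using fX by (rule Max_ge)
  have "L \<in> P \<Longrightarrow> hi L $ i = b $ i \<longleftrightarrow> lo L $ i \<le> t \<and> t < hi L $ i" for L
    using le[of "lo L $ i"] le[of "hi L $ i"] piece(2,4)[of L i] tb by force
  then have "{L. L \<in> P \<and> hi L $ i = b $ i} = {L. L \<in> P \<and> lo L $ i \<le> t \<and> t < hi L $ i}"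
    by blast
  then show ?thesis using section_whole[OF assms, of i t] le[OF aX] tb by simp
qed

lemma sum_filter_split:
  "(\<Sum>K\<in>P. f K) = (\<Sum>K | K \<in> P \<and> Q K. f K) + (\<Sum>K | K \<in> P \<and> \<not> Q K. f K :: real)"
proof -
  have "P \<inter> {K. Q K} = {K. K \<in> P \<and> Q K}" "P - {K. Q K} = {K. K \<in> P \<and> \<not> Q K}" by auto
  then show ?thesis using sum.Int_Diff[OF fin, of f "{K. Q K}"] by simp
qed

lemma excess_lower: "P \<noteq> {} \<Longrightarrow> excess i = (\<Sum>L | L \<in> P \<and> lo L $ i \<noteq> a $ i. area i L)"
  unfolding excess_def
  using face_lower[of i] sum_filter_split[of "area i" "\<lambda>L. lo L $ i = a $ i"] by simp

lemma excess_upper: "P \<noteq> {} \<Longrightarrow> excess i = (\<Sum>L | L \<in> P \<and> hi L $ i \<noteq> b $ i. area i L)"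
  unfolding excess_def
  using face_upper[of i] sum_filter_split[of "area i" "\<lambda>L. hi L $ i = b $ i"] by simp

lemma area_nonneg: "K \<in> P \<Longrightarrow> 0 \<le> area i K"
  using area_ge1[of K i] by simp

lemma excess_nonneg: "P \<noteq> {} \<Longrightarrow> excess i \<ge> 0"
  unfolding excess_lower by (rule sum_nonneg) (use area_nonneg in auto)

lemma cost_excess: "cost (cbox a b) P = (\<Sum>i\<in>UNIV. excess i)"
  unfolding cost_def excess_def flat_area_sum sum_subtractf by (subst sum.swap) simp

lemma excess_ge_1:
  assumes "L \<in> P" "\<not> full j L"
  shows "excess j \<ge> 1"
proof -
  have ne: "P \<noteq> {}" using assms by auto
  have "area j L \<le> excess j"
  proof (cases "lo L $ j = a $ j")
    case True
    then have "hi L $ j \<noteq> b $ j" using assms by (simp add: full_def)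
    then show ?thesis unfolding excess_upper[OF ne]
      by (intro member_le_sum) (use assms fin area_nonneg in auto)
  next
    case False
    then show ?thesis unfolding excess_lower[OF ne]
      by (intro member_le_sum) (use assms fin area_nonneg in auto)
  qed
  then show ?thesis using area_ge1[OF assms(1), of j] by simp
qed

text \<open>Every piece but the one in the lower corner of the box does not touch the lower face in some
  direction, and so contributes at least 1 to the cost.\<close>

lemma cost_ge_card:
  assumes "P \<noteq> {}"
  shows "cost (cbox a b) P \<ge> real (card P) - 1"
proof -
  let ?C = "{K\<in>P. \<forall>i. lo K $ i = a $ i}"
  have eq: "K = L" if "K \<in> ?C" "L \<in> ?C" for K L
    by (rule pieces_eq) (use that piece(2)[of K] piece(2)[of L] in auto)
  have C1: "card ?C \<le> 1"
  proof (rule ccontr)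
    assume "\<not> card ?C \<le> 1"
    then have "1 < card ?C" by simp
    moreover have "finite ?C" using fin by simp
    ultimately show False using eq by (metis (no_types, lifting) card_le_Suc0_iff_eq One_nat_def not_le)
  qed
  have "(\<Sum>K\<in>P. if K \<in> ?C then 0 else 1) \<le> (\<Sum>K\<in>P. \<Sum>i\<in>UNIV. if lo K $ i \<noteq> a $ i then area i K else 0)"
  proof (rule sum_mono)
    fix K assume K: "K \<in> P"
    have nn: "0 \<le> (if lo K $ i \<noteq> a $ i then area i K else 0)" for i using area_nonneg[OF K] by simp
    show "(if K \<in> ?C then 0 else 1) \<le> (\<Sum>i\<in>UNIV. if lo K $ i \<noteq> a $ i then area i K else 0)"
    proof (cases "K \<in> ?C")
      case True then show ?thesis using nn by (simp add: sum_nonneg)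
    next
      case False
      then obtain i where i: "lo K $ i \<noteq> a $ i" using K by blast
      have "1 \<le> (if lo K $ i \<noteq> a $ i then area i K else 0)" using area_ge1[OF K] i by simp
      also have "\<dots> \<le> (\<Sum>i\<in>UNIV. if lo K $ i \<noteq> a $ i then area i K else 0)"
        by (rule member_le_sum) (use nn in auto)
      finally show ?thesis using False by simp
    qed
  qed
  also have "\<dots> = (\<Sum>i\<in>UNIV. excess i)"
    unfolding excess_lower[OF assms] by (subst sum.swap) (simp add: sum.inter_filter[OF fin])
  finally have 1: "(\<Sum>K\<in>P. if K \<in> ?C then 0 else 1) \<le> cost (cbox a b) P" by (simp add: cost_excess)
  have "(\<Sum>K\<in>P. if K \<in> ?C then 0 else (1::real)) = (\<Sum>K\<in>P - ?C. 1)"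
    by (rule sum.mono_neutral_cong_right) (use fin in auto)
  also have "\<dots> = real (card P) - real (card ?C)"
    using card_Diff_subset[of ?C P] card_mono[of P ?C] fin by (simp add: of_nat_diff)
  finally show ?thesis using 1 C1 by simp
qed

text \<open>The pieces touching the upper face tile it. Those of them that do not touch the lower face count
  towards the excess, and the others are full.\<close>

lemma excess_ge_not_full:
  assumes "P \<noteq> {}"
  shows "excess i \<ge> area i (cbox a b) - (\<Sum>K | K \<in> P \<and> full i K. area i K)"
proof -
  have "{L. L \<in> P \<and> hi L $ i = b $ i}
      = {L. L \<in> P \<and> hi L $ i = b $ i \<and> lo L $ i \<noteq> a $ i} \<union> {K. K \<in> P \<and> full i K}"
    by (auto simp: full_def)
  then have "area i (cbox a b) = (\<Sum>L\<in>{L. L \<in> P \<and> hi L $ i = b $ i \<and> lo L $ i \<noteq> a $ i} \<union> {K. K \<in> P \<and> full i K}. area i L)"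
    using face_upper[OF assms, of i] by simp
  also have "\<dots> = (\<Sum>L | L \<in> P \<and> hi L $ i = b $ i \<and> lo L $ i \<noteq> a $ i. area i L) + (\<Sum>K | K \<in> P \<and> full i K. area i K)"
    by (rule sum.union_disjoint) (use fin in \<open>auto simp: full_def\<close>)
  also have "(\<Sum>L | L \<in> P \<and> hi L $ i = b $ i \<and> lo L $ i \<noteq> a $ i. area i L) \<le> excess i"
    unfolding excess_lower[OF assms] by (rule sum_mono2) (use fin area_nonneg in auto)
  finally show ?thesis by simp
qed

lemma vol_piece: "K \<in> P \<Longrightarrow> measure lborel K = vol K"
proof -
  assume K: "K \<in> P"
  have "measure lborel (cbox (lo K) (hi K)) = vol K"
    unfolding content_cbox_prod vol_def
    by (rule prod.cong) (use piece(2,5)[OF K] in \<open>auto simp: max_def less_imp_le not_le\<close>)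
  then show ?thesis using piece(1)[OF K] by simp
qed

lemma vol_sum: assumes "P \<noteq> {}" shows "(\<Sum>K\<in>P. vol K) = vol (cbox a b)"
proof -
  have "(\<Sum>K\<in>P. vol K) = (\<Sum>K\<in>P. measure lborel K)" by (rule sum.cong) (simp_all add: vol_piece)
  also have "\<dots> = measure lborel (cbox a b)" by (rule additive_content_division[OF div])
  also have "\<dots> = vol (cbox a b)"
    unfolding content_cbox_prod vol_def
    by (rule prod.cong) (use side_whole[OF assms] ab_less[OF assms] in \<open>auto simp: max_def less_imp_le not_le\<close>)
  finally show ?thesis .
qed

lemma vol_pos: "K \<in> P \<Longrightarrow> vol K > 0"
  unfolding vol_def by (rule prod_pos) (use side_pos in auto)

text \<open>Without plates no piece is full in two directions. Multiplying the cross section of a full piece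
  by the side of the box in that direction gives its volume, and the volumes of all full pieces
  add up to at most the volume of the box.\<close>

lemma cost_no_plate:
  assumes ne: "P \<noteq> {}"
    and noplate: "\<And>K i j. K \<in> P \<Longrightarrow> i \<noteq> j \<Longrightarrow> \<not> (full i K \<and> full j K)"
    and d: "d > 0" "\<And>i. d \<le> side (cbox a b) i"
  shows "cost (cbox a b) P \<ge> flat_area (cbox a b) - vol (cbox a b) / d"
proof -
  let ?A = "\<lambda>i. \<Sum>K | K \<in> P \<and> full i K. area i K"
  have "d * (\<Sum>i\<in>UNIV. ?A i) = (\<Sum>i\<in>UNIV. \<Sum>K | K \<in> P \<and> full i K. d * area i K)"
    by (simp add: sum_distrib_left)
  also have "\<dots> \<le> (\<Sum>i\<in>UNIV. \<Sum>K | K \<in> P \<and> full i K. vol K)"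
  proof (intro sum_mono)
    fix i K assume "K \<in> {K. K \<in> P \<and> full i K}"
    then have K: "K \<in> P" "side K i = side (cbox a b) i" using full_iff by auto
    show "d * area i K \<le> vol K" unfolding vol_area[of K i] K(2)
      by (rule mult_right_mono) (use d area_nonneg K in auto)
  qed
  also have "\<dots> = (\<Sum>i\<in>UNIV. \<Sum>K\<in>P. if full i K then vol K else 0)"
    by (simp add: sum.inter_filter[OF fin])
  also have "\<dots> = (\<Sum>K\<in>P. \<Sum>i\<in>UNIV. if full i K then vol K else 0)" by (rule sum.swap)
  also have "\<dots> \<le> (\<Sum>K\<in>P. vol K)"
  proof (rule sum_mono)
    fix K assume K: "K \<in> P"
    show "(\<Sum>i\<in>UNIV. if full i K then vol K else 0) \<le> vol K"
      unfolding sum_axes[OF axes_123]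
      using noplate[OF K, of 1 2] noplate[OF K, of 2 3] noplate[OF K, of 1 3] vol_pos[OF K] by auto
  qed
  also have "\<dots> = vol (cbox a b)" by (rule vol_sum[OF ne])
  finally have "(\<Sum>i\<in>UNIV. ?A i) \<le> vol (cbox a b) / d" using d by (simp add: field_simps)
  moreover have "cost (cbox a b) P \<ge> (\<Sum>i\<in>UNIV. area i (cbox a b) - ?A i)"
    unfolding cost_excess by (rule sum_mono) (rule excess_ge_not_full[OF ne])
  ultimately show ?thesis by (simp add: sum_subtractf flat_area_sum)
qed

text \<open>Suppose that there is a plate, thin in direction \<open>i\<close>, but no end plate. Then it separates the
  pieces at the lower end from those at the upper end, and there are at least two of each since a
  single one would be an end plate. The plate and the pieces at the upper end
  count twice the area of the face, and a piece at the lower end is not full in a further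
  direction, where the excess is therefore positive.\<close>

lemma cost_middle_plate:
  assumes K: "K \<in> P" "\<And>j. j \<noteq> i \<Longrightarrow> full j K"
    and noend: "\<And>K i. K \<in> P \<Longrightarrow> (\<And>j. j \<noteq> i \<Longrightarrow> full j K) \<Longrightarrow> lo K $ i \<noteq> a $ i \<and> hi K $ i \<noteq> b $ i"
  shows "cost (cbox a b) P \<ge> 2 * area i (cbox a b) + 1" "card P \<ge> 5"
proof -
  have ne: "P \<noteq> {}" using K by auto
  obtain j k where ax: "axes i j k" using axes_exists by blast
  let ?L = "{L. L \<in> P \<and> lo L $ i = a $ i}" and ?U = "{L. L \<in> P \<and> hi L $ i = b $ i}"
  have nofull: "\<not> full i L" if "L \<in> P" for L
  proof
    assume f: "full i L"
    have "max (lo K $ l) (lo L $ l) < min (hi K $ l) (hi L $ l)" for l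
    proof (cases "l = i")
      case True
      then show ?thesis using piece_within_full[OF that K(1) f] by simp
    next
      case False
      then show ?thesis using piece_within_full[OF K(1) that K(2)] by blast
    qed
    then have "K = L" by (rule pieces_eq[OF K(1) that])
    moreover have "lo K $ i \<noteq> a $ i" using noend[OF K(1,2)] by blast
    ultimately show False using f unfolding full_def by blast
  qed
  have disj: "?L \<inter> ?U = {}" using nofull unfolding full_def by blast
  have "lo K $ i \<noteq> a $ i \<and> hi K $ i \<noteq> b $ i" by (rule noend[OF K(1,2)])
  then have KLU: "K \<notin> ?L" "K \<notin> ?U" by simp_all
  have aD: "area i (cbox a b) > 0" by (rule area_whole_pos[OF ne])
  \<comment> \<open>a face is not covered by a single piece, as this would be an end plate\<close>
  have big: "2 \<le> card X" if X: "(\<Sum>L\<in>X. area i L) = area i (cbox a b)" "X \<subseteq> P"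
    "\<And>L. L \<in> X \<Longrightarrow> lo L $ i = a $ i \<or> hi L $ i = b $ i" for X
  proof -
    have fX: "finite X" using X(2) fin finite_subset by blast
    have "X \<noteq> {}" using X(1) aD by (metis sum.empty less_irrefl)
    then have "card X \<noteq> 0" using fX by simp
    moreover have "card X \<noteq> 1"
    proof
      assume "card X = 1"
      then obtain L where L: "X = {L}" by (rule card_1_singletonE)
      then have LP: "L \<in> P" using X(2) by blast
      have "area i L = area i (cbox a b)" using X(1) unfolding L by simp
      then have eq: "side L j * side L k = side (cbox a b) j * side (cbox a b) k"
        by (simp only: area_axes[OF ax])
      have l: "side L j \<le> side (cbox a b) j" "side L k \<le> side (cbox a b) k" "side L j > 0" "side L k > 0"
        by (rule side_le_whole[OF LP] side_pos[OF LP])+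
      have "side L j = side (cbox a b) j"
      proof (rule ccontr)
        assume "side L j \<noteq> side (cbox a b) j"
        then have "side L j < side (cbox a b) j" using l(1) by simp
        then have "side L j * side L k < side (cbox a b) j * side L k"
          using l(4) by (rule mult_strict_right_mono)
        also have "\<dots> \<le> side (cbox a b) j * side (cbox a b) k"
          by (rule mult_left_mono) (use l in auto)
        finally show False using eq by linarith
      qed
      moreover from this have "side L k = side (cbox a b) k" using eq l(3) by (metis mult_left_cancel less_irrefl)
      ultimately have "full j L" "full k L" by (simp_all only: full_iff[OF LP])
      then have "full l L" if "l \<noteq> i" for l using that by (rule axes_all[OF ax])
      then have "lo L $ i \<noteq> a $ i \<and> hi L $ i \<noteq> b $ i" by (rule noend[OF LP])
      moreover have "lo L $ i = a $ i \<or> hi L $ i = b $ i" using X(3)[of L] L by blast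
      ultimately show False by blast
    qed
    ultimately show ?thesis by linarith
  qed
  have cL: "2 \<le> card ?L" by (rule big) (use face_lower[OF ne] in auto)
  have cU: "2 \<le> card ?U" by (rule big) (use face_upper[OF ne] in auto)
  have fLU: "finite ?L" "finite ?U" using fin by auto
  have "5 \<le> card (insert K (?L \<union> ?U))"
    using cL cU KLU fLU disj by (simp add: card_Un_disjoint)
  also have "\<dots> \<le> card P" by (rule card_mono) (use fin K in auto)
  finally show "card P \<ge> 5" .
  have "j \<noteq> i" "k \<noteq> i" using ax unfolding axes_def by blast+
  then have "full j K" "full k K" using K(2) by blast+
  then have "side K j = side (cbox a b) j" "side K k = side (cbox a b) k"
    by (simp_all only: full_iff[OF K(1)])
  then have "area i K = area i (cbox a b)" by (simp only: area_axes[OF ax])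
  then have "2 * area i (cbox a b) = area i K + (\<Sum>L\<in>?U. area i L)"
    using face_upper[OF ne, of i] by linarith
  also have "\<dots> = (\<Sum>L\<in>insert K ?U. area i L)" using KLU fLU by simp
  also have "\<dots> \<le> excess i" unfolding excess_lower[OF ne]
    by (rule sum_mono2) (use fin area_nonneg KLU disj K in auto)
  finally have 2: "2 * area i (cbox a b) \<le> excess i" .
  have "?L \<noteq> {}"
  proof
    assume "?L = {}"
    then show False using cL by (simp only: card.empty)
  qed
  then obtain L where "L \<in> ?L" by (meson all_not_in_conv)
  then have L: "L \<in> P" "lo L $ i = a $ i" by simp_all
  then obtain l where l: "l \<noteq> i" "\<not> full l L" using noend[of L i] by blast
  have "1 \<le> excess l" using excess_ge_1 L l by blast
  then have "cost (cbox a b) P \<ge> excess i + 1"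
    unfolding cost_excess sum_axes[OF ax]
    using l(1) axes_other[OF ax, of l] excess_nonneg[OF ne, of j] excess_nonneg[OF ne, of k] by auto
  then show "cost (cbox a b) P \<ge> 2 * area i (cbox a b) + 1" using 2 by simp
qed

end

section \<open>Cutting off an end plate\<close>

text \<open>\<open>K\<close> is cut off from \<open>D\<close> by a plane orthogonal to the axis \<open>i\<close>, at the lower or at the upper end,
  and \<open>E\<close> is the rest.\<close>

definition end_cut :: "(real ^ 3) set \<Rightarrow> 3 \<Rightarrow> (real ^ 3) set \<Rightarrow> (real ^ 3) set \<Rightarrow> bool" where
  "end_cut D i K E \<longleftrightarrow>
     K = D \<inter> {x. x $ i \<le> lo D $ i + side K i} \<and> E = D \<inter> {x. lo D $ i + side K i \<le> x $ i} \<or>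
     K = D \<inter> {x. hi D $ i - side K i \<le> x $ i} \<and> E = D \<inter> {x. x $ i \<le> hi D $ i - side K i}"

text \<open>A dissection of \<open>D\<close> into finitely many boxes, and at least one, with positive integer sides.\<close>

definition tiling :: "(real ^ 3) set \<Rightarrow> (real ^ 3) set set \<Rightarrow> bool" where
  "tiling D P \<longleftrightarrow> P \<noteq> {} \<and> (\<exists>a b. D = cbox a b \<and> tiled P a b)"

context tiled
begin

text \<open>What remains of \<open>P\<close> without \<open>K\<close> covers the interior of the remaining box, and hence, being closed,
  the whole of it.\<close>

lemma remaining_division:
  assumes K: "K \<in> P" and uv: "\<And>j. u $ j < v $ j" and sub: "cbox u v \<subseteq> cbox a b"
    and off: "box u v \<inter> K = {}" and rest: "\<And>L. L \<in> P \<Longrightarrow> L \<noteq> K \<Longrightarrow> L \<subseteq> cbox u v"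
  shows "P - {K} division_of cbox u v"
proof (rule division_ofI)
  show "finite (P - {K})" using fin by simp
  show "L \<subseteq> cbox u v" if "L \<in> P - {K}" for L using that rest by auto
  show "L \<noteq> {}" if "L \<in> P - {K}" for L using that division_ofD(3)[OF div] by auto
  show "\<exists>c d. L = cbox c d" if "L \<in> P - {K}" for L using that division_ofD(4)[OF div] by auto
  show "interior L \<inter> interior M = {}" if "L \<in> P - {K}" "M \<in> P - {K}" "L \<noteq> M" for L M
    using that division_ofD(5)[OF div] by auto
  have "closed L" if "L \<in> P" for L using division_ofD(4)[OF div that] closed_cbox by metis
  then have cl: "closed (\<Union>(P - {K}))" using fin by (intro closed_Union) auto
  have ne: "box u v \<noteq> {}" using uv by (simp add: interval_ne_empty_cart)
  have "box u v \<subseteq> \<Union>P" using sub box_subset_cbox division_ofD(6)[OF div] by blast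
  then have "box u v \<subseteq> \<Union>(P - {K})" using off by auto
  then have "closure (box u v) \<subseteq> \<Union>(P - {K})" using cl by (rule closure_minimal)
  then have "cbox u v \<subseteq> \<Union>(P - {K})" using closure_box[OF ne] by simp
  moreover have "\<Union>(P - {K}) \<subseteq> cbox u v" using rest by auto
  ultimately show "\<Union>(P - {K}) = cbox u v" by auto
qed

lemma end_plate:
  assumes K: "K \<in> P" and full: "\<And>j. j \<noteq> i \<Longrightarrow> full j K"
    and e: "lo K $ i = a $ i \<or> hi K $ i = b $ i" and two: "2 \<le> card P"
  shows "\<exists>E. end_cut (cbox a b) i K E \<and> tiling E (P - {K}) \<and>
      (\<forall>j. j \<noteq> i \<longrightarrow> side K j = side (cbox a b) j \<and> side E j = side (cbox a b) j) \<and>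
      side K i + side E i = side (cbox a b) i"
proof -
  have ne: "P \<noteq> {}" using K by auto
  have PK: "P - {K} \<noteq> {}"
  proof
    assume "P - {K} = {}"
    then have "P = {K}" using K by auto
    then show False using two by simp
  qed
  then obtain L where L: "L \<in> P" "L \<noteq> K" by auto
  have notfull: "\<not> full i K"
  proof
    assume "full i K"
    then have "max (lo K $ j) (lo L $ j) < min (hi K $ j) (hi L $ j)" for j
      using piece_within_full[OF K L(1), of j] full[of j] by (cases "j = i") auto
    then show False using pieces_eq[OF K L(1)] L by auto
  qed
  have sep: "hi K $ i \<le> lo M $ i \<or> hi M $ i \<le> lo K $ i" if M: "M \<in> P" "M \<noteq> K" for M
  proof (rule ccontr)
    assume n: "\<not> ?thesis"
    have "max (lo K $ j) (lo M $ j) < min (hi K $ j) (hi M $ j)" for j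
    proof (cases "j = i")
      case True then show ?thesis using n piece(2)[OF K, of i] piece(2)[OF M(1), of i] by auto
    next
      case False then show ?thesis using piece_within_full[OF K M(1) full] by blast
    qed
    then show False using pieces_eq[OF K M(1)] M by auto
  qed
  have loK: "j \<noteq> i \<Longrightarrow> lo K $ j = a $ j" and hiK: "j \<noteq> i \<Longrightarrow> hi K $ j = b $ j" for j
    using full[of j] unfolding full_def by auto
  have sideK: "side K i = hi K $ i - lo K $ i" "lo K $ i < hi K $ i" using piece[OF K] by auto
  have lD: "lo (cbox a b) = a" "hi (cbox a b) = b"
    using lo_cbox hi_cbox whole_ne[OF ne] by auto
  have memK: "x \<in> K \<longleftrightarrow> (\<forall>j. lo K $ j \<le> x $ j \<and> x $ j \<le> hi K $ j)" for x
    by (subst piece(1)[OF K]) (simp add: mem_box_cart)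
  have memM: "x \<in> M \<Longrightarrow> lo M $ j \<le> x $ j \<and> x $ j \<le> hi M $ j" if "M \<in> P" for x M j
    using piece(1)[OF that] by (metis mem_box_cart(2))
  have fin_goal: ?thesis if uv: "\<And>j. u $ j < v $ j" and E: "E = cbox u v" and cut: "end_cut (cbox a b) i K E"
    and sub: "E \<subseteq> cbox a b"
    and off: "box u v \<inter> K = {}" and rest: "\<And>L. L \<in> P \<Longrightarrow> L \<noteq> K \<Longrightarrow> L \<subseteq> E"
    and sd: "\<And>j. j \<noteq> i \<Longrightarrow> u $ j = a $ j \<and> v $ j = b $ j" "v $ i - u $ i + side K i = b $ i - a $ i" for u v E
  proof -
    have "P - {K} division_of cbox u v"
      by (rule remaining_division[OF K uv _ off]) (use rest sub E in auto)
    then have "tiled (P - {K}) u v"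
      by unfold_locales (use side_pos side_Nats in auto)
    then have "tiling E (P - {K})" unfolding tiling_def using E PK by blast
    moreover have "cbox u v \<noteq> {}" using uv by (simp add: cbox_ne_cart less_imp_le)
    then have "side E j = v $ j - u $ j" for j using side_cbox E by blast
    ultimately show ?thesis using cut sd side_whole[OF ne] full_iff[OF K] full
      by (intro exI[of _ E]) auto
  qed
  from e show ?thesis
  proof
    assume l: "lo K $ i = a $ i"
    then have h: "hi K $ i < b $ i" using notfull piece(4)[OF K, of i] by (auto simp: full_def)
    define u where "u = (\<chi> j. if j = i then hi K $ i else a $ j)"
    show ?thesis
    proof (rule fin_goal[where u = u and v = b and E = "cbox u b"])
      show "u $ j < b $ j" for j using h ab_less[OF ne] by (simp add: u_def)
      show "cbox u b = cbox u b" ..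
      have eqE: "cbox u b = cbox a b \<inter> {x. hi K $ i \<le> x $ i}"
      proof (rule set_eqI)
        fix x
        have "u $ j \<le> x $ j \<and> x $ j \<le> b $ j
            \<longleftrightarrow> a $ j \<le> x $ j \<and> x $ j \<le> b $ j \<and> (j = i \<longrightarrow> hi K $ i \<le> x $ i)" for j
          using piece(2,3)[OF K, of i] unfolding u_def by (cases "j = i") auto
        then show "x \<in> cbox u b \<longleftrightarrow> x \<in> cbox a b \<inter> {x. hi K $ i \<le> x $ i}"
          by (auto simp: mem_box_cart)
      qed
      have eqK: "K = cbox a b \<inter> {x. x $ i \<le> hi K $ i}"
      proof (rule set_eqI)
        fix x
        have "lo K $ j \<le> x $ j \<and> x $ j \<le> hi K $ j
            \<longleftrightarrow> a $ j \<le> x $ j \<and> x $ j \<le> b $ j \<and> (j = i \<longrightarrow> x $ i \<le> hi K $ i)" for j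
          using l loK[of j] hiK[of j] h by (cases "j = i") auto
        then have "(\<forall>j. lo K $ j \<le> x $ j \<and> x $ j \<le> hi K $ j) \<longleftrightarrow> (\<forall>j. a $ j \<le> x $ j \<and> x $ j \<le> b $ j) \<and> x $ i \<le> hi K $ i"
          by auto
        then show "x \<in> K \<longleftrightarrow> x \<in> cbox a b \<inter> {x. x $ i \<le> hi K $ i}"
          by (simp add: memK mem_box_cart)
      qed
      have "lo (cbox a b) $ i + side K i = hi K $ i" using sideK l lD by simp
      then show "end_cut (cbox a b) i K (cbox u b)" unfolding end_cut_def using eqE eqK by simp
      show "cbox u b \<subseteq> cbox a b" using eqE by auto
      show "box u b \<inter> K = {}"
        unfolding disjoint_iff
      proof (intro allI impI notI)
        fix x assume "x \<in> box u b" "x \<in> K"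
        then have "u $ i < x $ i" "x $ i \<le> hi K $ i" by (auto simp: memK mem_box_cart)
        then show False by (simp add: u_def)
      qed
      show "M \<subseteq> cbox u b" if M: "M \<in> P" "M \<noteq> K" for M
      proof
        fix x assume x: "x \<in> M"
        have sp: "hi K $ i \<le> lo M $ i" using sep[OF M] piece(2,3)[OF M(1), of i] l by auto
        have "u $ j \<le> x $ j \<and> x $ j \<le> b $ j" for j
          using sp memM[OF M(1) x, of j] piece(3,4)[OF M(1), of j] unfolding u_def by (cases "j = i") auto
        then show "x \<in> cbox u b" by (simp add: mem_box_cart)
      qed
      show "j \<noteq> i \<Longrightarrow> u $ j = a $ j \<and> b $ j = b $ j" for j by (simp add: u_def)
      show "b $ i - u $ i + side K i = b $ i - a $ i" using sideK l by (simp add: u_def)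
    qed
  next
    assume l: "hi K $ i = b $ i"
    then have h: "a $ i < lo K $ i" using notfull piece(3)[OF K, of i] by (auto simp: full_def)
    define v where "v = (\<chi> j. if j = i then lo K $ i else b $ j)"
    show ?thesis
    proof (rule fin_goal[where u = a and v = v and E = "cbox a v"])
      show "a $ j < v $ j" for j using h ab_less[OF ne] by (simp add: v_def)
      show "cbox a v = cbox a v" ..
      have eqE: "cbox a v = cbox a b \<inter> {x. x $ i \<le> lo K $ i}"
      proof (rule set_eqI)
        fix x
        have "a $ j \<le> x $ j \<and> x $ j \<le> v $ j
            \<longleftrightarrow> a $ j \<le> x $ j \<and> x $ j \<le> b $ j \<and> (j = i \<longrightarrow> x $ i \<le> lo K $ i)" for j
          using piece(2,4)[OF K, of i] unfolding v_def by (cases "j = i") auto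
        then show "x \<in> cbox a v \<longleftrightarrow> x \<in> cbox a b \<inter> {x. x $ i \<le> lo K $ i}"
          by (auto simp: mem_box_cart)
      qed
      have eqK: "K = cbox a b \<inter> {x. lo K $ i \<le> x $ i}"
      proof (rule set_eqI)
        fix x
        have "lo K $ j \<le> x $ j \<and> x $ j \<le> hi K $ j
            \<longleftrightarrow> a $ j \<le> x $ j \<and> x $ j \<le> b $ j \<and> (j = i \<longrightarrow> lo K $ i \<le> x $ i)" for j
          using l loK[of j] hiK[of j] h by (cases "j = i") auto
        then have "(\<forall>j. lo K $ j \<le> x $ j \<and> x $ j \<le> hi K $ j) \<longleftrightarrow> (\<forall>j. a $ j \<le> x $ j \<and> x $ j \<le> b $ j) \<and> lo K $ i \<le> x $ i"
          by auto
        then show "x \<in> K \<longleftrightarrow> x \<in> cbox a b \<inter> {x. lo K $ i \<le> x $ i}"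
          by (simp add: memK mem_box_cart)
      qed
      have "hi (cbox a b) $ i - side K i = lo K $ i" using sideK l lD by simp
      then show "end_cut (cbox a b) i K (cbox a v)" unfolding end_cut_def using eqE eqK by simp
      show "cbox a v \<subseteq> cbox a b" using eqE by auto
      show "box a v \<inter> K = {}"
        unfolding disjoint_iff
      proof (intro allI impI notI)
        fix x assume "x \<in> box a v" "x \<in> K"
        then have "x $ i < v $ i" "lo K $ i \<le> x $ i" by (auto simp: memK mem_box_cart)
        then show False by (simp add: v_def)
      qed
      show "M \<subseteq> cbox a v" if M: "M \<in> P" "M \<noteq> K" for M
      proof
        fix x assume x: "x \<in> M"
        have sp: "hi M $ i \<le> lo K $ i" using sep[OF M] piece(2,4)[OF M(1), of i] l by auto
        have "a $ j \<le> x $ j \<and> x $ j \<le> v $ j" for j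
          using sp memM[OF M(1) x, of j] piece(3,4)[OF M(1), of j] unfolding v_def by (cases "j = i") auto
        then show "x \<in> cbox a v" by (simp add: mem_box_cart)
      qed
      show "j \<noteq> i \<Longrightarrow> a $ j = a $ j \<and> v $ j = b $ j" for j by (simp add: v_def)
      show "v $ i - a $ i + side K i = b $ i - a $ i" using sideK l by (simp add: v_def)
    qed
  qed
qed

end

text \<open>Cutting off an end plate costs the area of the cut.\<close>

lemma cost_peel:
  assumes "finite P" "K \<in> P"
    and s: "\<And>j. j \<noteq> i \<Longrightarrow> side K j = side D j \<and> side E j = side D j" "side K i + side E i = side D i"
  shows "cost D P = area i D + cost E (P - {K})"
proof -
  obtain j k where ax: "axes i j k" using axes_exists by blast
  then have s': "side K j = side D j" "side E j = side D j" "side K k = side D k" "side E k = side D k"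
    using s(1)[of j] s(1)[of k] by (auto simp: axes_def)
  have "(\<Sum>L\<in>P. flat_area L) = flat_area K + (\<Sum>L\<in>P - {K}. flat_area L)"
    by (rule sum.remove) (use assms in auto)
  then show ?thesis
    unfolding cost_def flat_area_axes[OF ax] area_axes[OF ax] s' s(2)[symmetric]
    by (simp add: algebra_simps)
qed

text \<open>The trichotomy on which all lower bounds rest.\<close>

theorem tiling_cases [consumes 2, case_names end_plate no_plate middle_plate]:
  assumes til: "tiling D P" and two: "2 \<le> card P"
  obtains K i E where "K \<in> P" "end_cut D i K E" "tiling E (P - {K})"
      "\<And>j. j \<noteq> i \<Longrightarrow> side K j = side D j" "\<And>j. j \<noteq> i \<Longrightarrow> side E j = side D j"
      "side K i + side E i = side D i" "cost D P = area i D + cost E (P - {K})"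
  | "\<And>K i j. K \<in> P \<Longrightarrow> i \<noteq> j \<Longrightarrow> \<not> (side K i = side D i \<and> side K j = side D j)"
      "\<And>d. d > 0 \<Longrightarrow> (\<And>i. d \<le> side D i) \<Longrightarrow> cost D P \<ge> flat_area D - vol D / d"
  | i where "cost D P \<ge> 2 * area i D + 1" "card P \<ge> 5"
proof -
  obtain a b where D: "D = cbox a b" and t: "tiled P a b" and ne: "P \<noteq> {}"
    using til unfolding tiling_def by auto
  interpret tiled P a b by fact
  show ?thesis
  proof (cases "\<exists>K i. K \<in> P \<and> (\<forall>j. j \<noteq> i \<longrightarrow> full j K) \<and> (lo K $ i = a $ i \<or> hi K $ i = b $ i)")
    case True
    then obtain K i where K: "K \<in> P" "\<And>j. j \<noteq> i \<Longrightarrow> full j K" "lo K $ i = a $ i \<or> hi K $ i = b $ i"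
      by auto
    obtain E where E: "end_cut (cbox a b) i K E" "tiling E (P - {K})"
      "\<And>j. j \<noteq> i \<Longrightarrow> side K j = side (cbox a b) j \<and> side E j = side (cbox a b) j"
      "side K i + side E i = side (cbox a b) i"
      using end_plate[OF K two] by blast
    have "cost D P = area i D + cost E (P - {K})"
      unfolding D by (rule cost_peel[OF fin K(1) E(3,4)])
    then show ?thesis using that(1)[of K i E] K(1) E unfolding D by blast
  next
    case noend: False
    show ?thesis
    proof (cases "\<exists>K i j. K \<in> P \<and> i \<noteq> j \<and> full i K \<and> full j K")
      case True
      then obtain K i j where K: "K \<in> P" "i \<noteq> j" "full i K" "full j K" by blast
      obtain k where "axes i j k" using axes_third K(2) by blast
      then have "axes k i j" by (auto simp: axes_def)
      then have f: "full l K" if "l \<noteq> k" for l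
        using K(3,4) that by (rule axes_all[where Q = "\<lambda>l. full l K"])
      have "\<And>K i. K \<in> P \<Longrightarrow> (\<And>j. j \<noteq> i \<Longrightarrow> full j K) \<Longrightarrow> lo K $ i \<noteq> a $ i \<and> hi K $ i \<noteq> b $ i"
        using noend by blast
      then show ?thesis using that(3)[of k] cost_middle_plate[OF K(1) f] unfolding D by simp
    next
      case False
      then have np: "\<not> (full i K \<and> full j K)" if "K \<in> P" "i \<noteq> j" for K i j using that by blast
      show ?thesis
      proof (rule that(2))
        show "\<not> (side K i = side D i \<and> side K j = side D j)" if "K \<in> P" "i \<noteq> j" for K i j
          using np[OF that] unfolding full_iff[OF that(1)] D .
        show "flat_area D - vol D / d \<le> cost D P" if "d > 0" "\<And>i. d \<le> side D i" for d
          unfolding D by (rule cost_no_plate[OF ne np]) (use that D in auto)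
      qed
    qed
  qed
qed

lemma tiling_facts:
  assumes "tiling D P"
  shows "finite P" "P \<noteq> {}" "K \<in> P \<Longrightarrow> side K i \<in> \<nat>" "K \<in> P \<Longrightarrow> side K i \<ge> 1"
    "K \<in> P \<Longrightarrow> side K i \<le> side D i" "(\<Sum>K\<in>P. vol K) = vol D"
    "cost D P \<ge> real (card P) - 1" "side D i \<ge> 1"
proof -
  obtain a b where D: "D = cbox a b" and t: "tiled P a b" and ne: "P \<noteq> {}"
    using assms unfolding tiling_def by auto
  interpret tiled P a b by fact
  show "finite P" "P \<noteq> {}" "K \<in> P \<Longrightarrow> side K i \<in> \<nat>" "K \<in> P \<Longrightarrow> side K i \<ge> 1"
    "K \<in> P \<Longrightarrow> side K i \<le> side D i" "(\<Sum>K\<in>P. vol K) = vol D"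
    "cost D P \<ge> real (card P) - 1"
    using fin ne side_Nats side_ge1 side_le_whole vol_sum cost_ge_card unfolding D by auto
  obtain L where "L \<in> P" using ne by auto
  then show "side D i \<ge> 1" using side_ge1[of L i] side_le_whole[of L i] unfolding D by linarith
qed

section \<open>Flat boxes\<close>

lemma axes_ex_cases: "axes i j k \<Longrightarrow> l = i \<or> l = j \<or> l = k"
  using axes_UNIV[of i j k] by auto

lemma areas_axes:
  assumes "axes i j k"
  shows "area i K = side K j * side K k" "area j K = side K k * side K i" "area k K = side K i * side K j"
  using assms area_axes[of i j k K] area_axes[of j k i K] area_axes[of k i j K] by (auto simp: axes_def)

lemma vol_axes: "axes i j k \<Longrightarrow> vol K = side K i * side K j * side K k"
  unfolding vol_def by (rule prod_axes)

text \<open>A box with integer sides. The box that remains after cutting off an end plate is again one.\<close>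

definition nat_box :: "(real ^ 3) set \<Rightarrow> bool" where
  "nat_box D \<longleftrightarrow> (\<forall>i. side D i \<in> \<nat>)"

lemma nat_box_rest:
  assumes "nat_box D" "tiling D P" "K \<in> P" "tiling E Q" "side K i + side E i = side D i"
    "\<And>j. j \<noteq> i \<Longrightarrow> side E j = side D j"
  shows "nat_box E"
  unfolding nat_box_def
proof
  fix j
  show "side E j \<in> \<nat>"
  proof (cases "j = i")
    case True
    obtain x y where "side D i = real x" "side K i = real y"
      using assms(1) tiling_facts(3)[OF assms(2,3), of i] unfolding nat_box_def by (metis Nats_cases)
    moreover then have "y \<le> x" using assms(5) tiling_facts(8)[OF assms(4), of i] by simp
    ultimately have "side E i = real (x - y)" using assms(5) by (simp add: of_nat_diff)
    then show ?thesis using True by simp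
  next
    case False
    then show ?thesis using assms(1,6) unfolding nat_box_def by simp
  qed
qed

lemma Nats_ge_Suc: "x \<in> \<nat> \<Longrightarrow> x > real m \<Longrightarrow> x \<ge> real (Suc m)"
  by (auto elim!: Nats_cases)

lemma sum_Nats: "(\<And>x. x \<in> A \<Longrightarrow> f x \<in> \<nat>) \<Longrightarrow> (\<Sum>x\<in>A. f x) \<in> (\<nat> :: real set)"
  by (induction A rule: infinite_finite_induct) auto

text \<open>A dissection of a box of thickness 1 is a dissection of a rectangle, and its cost is a matter of
  semiperimeters.\<close>

lemma flat_piece:
  assumes "tiling D P" "side D i = 1" "K \<in> P"
  shows "side K i = 1"
  using tiling_facts(4,5)[OF assms(1,3), of i] assms(2) by simp

lemma flat_cost:
  assumes "tiling D P" "axes i j k" "side D i = 1"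
  shows "cost D P = (\<Sum>K\<in>P. side K j + side K k) - (side D j + side D k)"
    and "(\<Sum>K\<in>P. side K j * side K k) = side D j * side D k"
proof -
  have v: "(\<Sum>K\<in>P. side K j * side K k) = (\<Sum>K\<in>P. vol K)"
    by (rule sum.cong) (use vol_axes[OF assms(2)] flat_piece[OF assms(1,3)] in auto)
  then show a: "(\<Sum>K\<in>P. side K j * side K k) = side D j * side D k"
    using tiling_facts(6)[OF assms(1)] vol_axes[OF assms(2), of D] assms(3) by simp
  have "(\<Sum>K\<in>P. flat_area K) = (\<Sum>K\<in>P. (side K j + side K k) + side K j * side K k)"
    by (rule sum.cong) (use flat_area_axes[OF assms(2)] flat_piece[OF assms(1,3)] in auto)
  then show "cost D P = (\<Sum>K\<in>P. side K j + side K k) - (side D j + side D k)"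
    unfolding cost_def sum.distrib a flat_area_axes[OF assms(2), of D] assms(3) by simp
qed

text \<open>If \<open>q\<close> maps \<open>P\<close> injectively and \<open>f\<close> is positive only where \<open>q\<close> takes a value in a small exceptional
  set \<open>E\<close>, then the sum of \<open>f\<close> is bounded by a sum over \<open>E\<close>. Below, \<open>f\<close> compares a piece with an average
  one, and \<open>E\<close> lists the few shapes that are better than average. As the shapes are distinct, each
  can occur at most once.\<close>

lemma sum_defect_le:
  fixes f :: "'a \<Rightarrow> real" and g :: "'b \<Rightarrow> real"
  assumes "finite P" "inj_on q P" "finite E"
    and "\<And>x. x \<in> P \<Longrightarrow> q x \<notin> E \<Longrightarrow> f x \<le> 0"
    and "\<And>x. x \<in> P \<Longrightarrow> q x \<in> E \<Longrightarrow> f x \<le> g (q x)"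
    and "\<And>e. e \<in> E \<Longrightarrow> 0 \<le> g e"
  shows "(\<Sum>x\<in>P. f x) \<le> (\<Sum>e\<in>E. g e)"
proof -
  have "(\<Sum>x\<in>P. f x) \<le> (\<Sum>x\<in>P. if q x \<in> E then g (q x) else 0)"
    by (rule sum_mono) (use assms in auto)
  also have "\<dots> = (\<Sum>e\<in>q ` P. if e \<in> E then g e else 0)"
    using assms(2) by (simp add: sum.reindex)
  also have "\<dots> = (\<Sum>e\<in>q ` P \<inter> E. g e)"
    using assms(1) by (simp add: sum.inter_restrict)
  also have "\<dots> \<le> (\<Sum>e\<in>E. g e)"
    by (rule sum_mono2) (use assms in auto)
  finally show ?thesis .
qed

text \<open>The two sides of a rectangle, the shorter one first.\<close>

definition face_dims :: "3 \<Rightarrow> 3 \<Rightarrow> (real ^ 3) set \<Rightarrow> real \<times> real" where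
  "face_dims j k K = (min (side K j) (side K k), max (side K j) (side K k))"

lemma face_dims_inj:
  assumes "tiling D P" "axes i j k" "side D i = 1" "inj_on dims P"
  shows "inj_on (face_dims j k) P"
proof (rule inj_onI)
  fix K L assume KL: "K \<in> P" "L \<in> P" and eq: "face_dims j k K = face_dims j k L"
  have one: "side K i = 1" "side L i = 1" using flat_piece[OF assms(1,3)] KL by auto
  have "{#side K j, side K k#} = {#side L j, side L k#}"
    using eq unfolding face_dims_def by (auto simp: min_def max_def split: if_splits)
  then have "dims K = dims L" unfolding dims_axes[OF assms(2)] one by simp
  then show "K = L" using assms(4) KL by (auto dest: inj_onD)
qed

lemma piece_nat_sides:
  assumes "tiling D P" "K \<in> P"
  obtains x y :: nat where "side K j = real x" "side K k = real y" "x \<ge> 1" "y \<ge> 1"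
proof -
  obtain x y where "side K j = real x" "side K k = real y"
    using tiling_facts(3)[OF assms] by (metis Nats_cases)
  then show ?thesis using that[of x y] tiling_facts(4)[OF assms, of j] tiling_facts(4)[OF assms, of k] by simp
qed

text \<open>The smallest semiperimeters of distinct integer rectangles are 2, 3, 4, 4 and 5.\<close>

lemma semiperimeters_three:
  assumes t: "tiling D P" and ax: "axes i j k" and D: "side D i = 1" and inj: "inj_on dims P" and c: "card P = 3"
  shows "(\<Sum>K\<in>P. side K j + side K k) \<ge> 9"
proof -
  have "(\<Sum>K\<in>P. 4 - (side K j + side K k)) \<le> (\<Sum>e\<in>{(1,1),(1,2)}. 4 - (fst e + snd e))"
  proof (rule sum_defect_le[OF tiling_facts(1)[OF t] face_dims_inj[OF t ax D inj]])
    fix K assume K: "K \<in> P"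
    obtain x y where xy: "side K j = real x" "side K k = real y" "x \<ge> 1" "y \<ge> 1"
      using piece_nat_sides[OF t K] .
    show "4 - (side K j + side K k) \<le> 0" if n: "face_dims j k K \<notin> {(1,1),(1,2)}"
    proof (rule ccontr)
      assume "\<not> ?thesis"
      then have "x + y < 4" using xy by simp
      then have "(x, y) \<in> {(1,1),(1,2),(2,1)}" using xy by auto
      then show False using n xy unfolding face_dims_def by auto
    qed
    show "4 - (side K j + side K k) \<le> 4 - (fst (face_dims j k K) + snd (face_dims j k K))"
      unfolding face_dims_def by (simp add: min_def max_def)
  qed auto
  then show ?thesis using c by (simp add: sum_subtractf)
qed

lemma semiperimeters_five:
  assumes t: "tiling D P" and ax: "axes i j k" and D: "side D i = 1" and inj: "inj_on dims P" and c: "card P = 5"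
  shows "(\<Sum>K\<in>P. side K j + side K k) \<ge> 18"
proof -
  have "(\<Sum>K\<in>P. 5 - (side K j + side K k)) \<le> (\<Sum>e\<in>{(1,1),(1,2),(1,3),(2,2)}. 5 - (fst e + snd e))"
  proof (rule sum_defect_le[OF tiling_facts(1)[OF t] face_dims_inj[OF t ax D inj]])
    fix K assume K: "K \<in> P"
    obtain x y where xy: "side K j = real x" "side K k = real y" "x \<ge> 1" "y \<ge> 1"
      using piece_nat_sides[OF t K] .
    show "5 - (side K j + side K k) \<le> 0" if n: "face_dims j k K \<notin> {(1,1),(1,2),(1,3),(2,2)}"
    proof (rule ccontr)
      assume "\<not> ?thesis"
      then have "x + y < 5" using xy by simp
      then have "(x, y) \<in> {(1,1),(1,2),(2,1),(1,3),(3,1),(2,2)}" using xy by auto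
      then show False using n xy unfolding face_dims_def by auto
    qed
    show "5 - (side K j + side K k) \<le> 5 - (fst (face_dims j k K) + snd (face_dims j k K))"
      unfolding face_dims_def by (simp add: min_def max_def)
  qed auto
  then show ?thesis using c by (simp add: sum_subtractf)
qed

text \<open>In a square of side 5 without pieces of full length the trivial bound 18 improves to 21.
  Three times the semiperimeter minus the area of an \<open>x \<times> y\<close> rectangle is \<open>9 - (x - 3) (y - 3)\<close>, which
  for sides below 5 is less than 9 only for four shapes, with deficits 4, 2, 1 and 1.\<close>

lemma semiperimeters_five_square:
  assumes t: "tiling D P" and ax: "axes i j k" and D: "side D i = 1" and inj: "inj_on dims P" and c: "card P = 5"
    and s: "side D j = 5" "side D k = 5" and small: "\<And>K. K \<in> P \<Longrightarrow> side K j < 5 \<and> side K k < 5"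
  shows "(\<Sum>K\<in>P. side K j + side K k) \<ge> 21"
proof -
  have "(\<Sum>K\<in>P. (side K j - 3) * (side K k - 3))
      \<le> (\<Sum>e\<in>{(1,1),(1,2),(2,2),(4,4)}. (fst e - 3) * (snd e - 3))"
  proof (rule sum_defect_le[OF tiling_facts(1)[OF t] face_dims_inj[OF t ax D inj]])
    fix K assume K: "K \<in> P"
    obtain x y where xy: "side K j = real x" "side K k = real y" "x \<ge> 1" "y \<ge> 1"
      using piece_nat_sides[OF t K] .
    show "(side K j - 3) * (side K k - 3) \<le> 0" if n: "face_dims j k K \<notin> {(1,1),(1,2),(2,2),(4,4)}"
    proof -
      have "x \<in> {1,2,3,4}" "y \<in> {1,2,3,4}" using xy small[OF K] by auto
      moreover have "(x, y) \<notin> {(1,1),(1,2),(2,1),(2,2),(4,4)}" using n xy unfolding face_dims_def by auto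
      ultimately show ?thesis using xy by auto
    qed
    show "(side K j - 3) * (side K k - 3) \<le> (fst (face_dims j k K) - 3) * (snd (face_dims j k K) - 3)"
      unfolding face_dims_def by (simp add: min_def max_def mult.commute)
  qed auto
  then have le: "(\<Sum>K\<in>P. (side K j - 3) * (side K k - 3)) \<le> 8" by simp
  have "(\<Sum>K\<in>P. (side K j - 3) * (side K k - 3))
      = (\<Sum>K\<in>P. side K j * side K k - 3 * (side K j + side K k) + 9)"
    by (rule sum.cong) (auto simp: algebra_simps)
  also have "\<dots> = (\<Sum>K\<in>P. side K j * side K k) - 3 * (\<Sum>K\<in>P. side K j + side K k) + 45"
    using c by (simp add: sum.distrib sum_subtractf sum_distrib_left)
  also have "(\<Sum>K\<in>P. side K j * side K k) = 25" using flat_cost(2)[OF t ax D] s by simp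
  finally have "(\<Sum>K\<in>P. side K j + side K k) > real 20" using le by simp
  moreover have "(\<Sum>K\<in>P. side K j + side K k) \<in> \<nat>"
    using tiling_facts(3)[OF t] by (intro sum_Nats Nats_add) auto
  ultimately show ?thesis using Nats_ge_Suc by fastforce
qed

section \<open>Dissections into two to six pieces\<close>

lemma tiling_singleton:
  assumes "tiling D {K}"
  shows "K = D"
proof -
  obtain a b where "{K} division_of cbox a b" "D = cbox a b"
    using assms unfolding tiling_def tiled_def by auto
  then show ?thesis using division_ofD(6) by force
qed

text \<open>A \<open>1 \<times> 2 \<times> t\<close> box cut into two pieces: a cut of cost \<open>t\<close> leaves congruent pieces.\<close>

lemma cost_two_thickness_two:
  assumes t: "tiling D P" and ax: "axes i j k" and D: "side D i = 1" "side D j = 2"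
    and inj: "inj_on dims P" and c: "card P = 2"
  shows "cost D P \<ge> 2"
proof -
  have Dk: "side D k \<ge> 1" using tiling_facts(8)[OF t] .
  have two: "2 \<le> card P" using c by simp
  show ?thesis
  proof (cases rule: tiling_cases[OF t two])
    case (1 K l E)
    have cE: "cost E (P - {K}) \<ge> 0"
      using tiling_facts(7)[OF 1(3)] c 1(1) tiling_facts(1)[OF t] by (simp add: card_Diff_singleton)
    from axes_ex_cases[OF ax, of l] show ?thesis
    proof (elim disjE)
      assume "l = i"
      then show ?thesis using 1(6) D tiling_facts(4)[OF t 1(1), of i] tiling_facts(8)[OF 1(3), of i] by simp
    next
      assume "l = k"
      then show ?thesis using 1(7) cE D areas_axes[OF ax, of D] by simp
    next
      assume l: "l = j"
      have "card (P - {K}) = 1" using c 1(1) by (simp add: card_Diff_singleton)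
      then obtain L where L: "P - {K} = {L}" by (rule card_1_singletonE)
      then have LE: "L = E" using 1(3) tiling_singleton by simp
      have LP: "L \<in> P" "L \<noteq> K" using L by auto
      have ni: "i \<noteq> j" "k \<noteq> j" using ax by (auto simp: axes_def)
      have "side K j = 1" "side L j = 1"
        using 1(6) D l tiling_facts(4)[OF t 1(1), of j] tiling_facts(4)[OF t LP(1), of j] LE by auto
      moreover have "side K i = 1" "side L i = 1" "side K k = side L k"
        using 1(4)[of i] 1(5)[of i] 1(4)[of k] 1(5)[of k] l LE ni D by auto
      ultimately have "dims K = dims L" unfolding dims_axes[OF ax] by simp
      then show ?thesis using inj 1(1) LP by (auto dest: inj_onD)
    qed
  next
    case 2
    have "cost D P \<ge> flat_area D - vol D / 1"
      by (rule 2(2)) (use tiling_facts(8)[OF t] in auto)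
    then show ?thesis using Dk D by (simp add: flat_area_axes[OF ax] vol_axes[OF ax])
  next
    case (3 l)
    then show ?thesis using c by simp
  qed
qed

lemma cost_three:
  assumes t: "tiling D P" and ax: "axes i j k" and nD: "nat_box D" and D: "side D i = 1" "side D j \<ge> 2"
    and inj: "inj_on dims P" and c: "card P = 3"
  shows "cost D P \<ge> 6 - side D j"
proof -
  obtain p q where pq: "side D j = real p" "side D k = real q"
    using nD unfolding nat_box_def by (metis Nats_cases)
  have q1: "q \<ge> 1" using tiling_facts(8)[OF t, of k] pq by simp
  have c2: "cost D P \<ge> 2" using tiling_facts(7)[OF t] c by simp
  show ?thesis
  proof (cases "p \<ge> 4 \<or> q \<le> 3")
    case True
    moreover have "cost D P \<ge> 9 - (side D j + side D k)"
      using semiperimeters_three[OF t ax D(1) inj c] flat_cost(1)[OF t ax D(1)] by simp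
    ultimately show ?thesis using c2 pq by auto
  next
    case False
    then have p: "p = 2 \<or> p = 3" and q: "q \<ge> 4" using D pq by auto
    have two: "2 \<le> card P" using c by simp
    show ?thesis
    proof (cases rule: tiling_cases[OF t two])
      case (1 K l E)
      have cE: "card (P - {K}) = 2"
        using c 1(1) by (simp add: card_Diff_singleton)
      have cE0: "cost E (P - {K}) \<ge> 1" using tiling_facts(7)[OF 1(3)] cE by simp
      from axes_ex_cases[OF ax, of l] show ?thesis
      proof (elim disjE)
        assume "l = i"
        then show ?thesis using 1(6) D tiling_facts(4)[OF t 1(1), of i] tiling_facts(8)[OF 1(3), of i] by simp
      next
        assume "l = j"
        then show ?thesis using 1(7) cE0 D areas_axes[OF ax, of D] pq q by simp
      next
        assume l: "l = k"
        then have co: "cost D P = real p + cost E (P - {K})" using 1(7) D areas_axes[OF ax, of D] pq by simp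
        show ?thesis
        proof (cases "p = 2")
          case True
          have ni: "i \<noteq> k" "j \<noteq> k" using ax by (auto simp: axes_def)
          have "cost E (P - {K}) \<ge> 2"
            by (rule cost_two_thickness_two[OF 1(3) ax _ _ inj_on_subset[OF inj] cE])
              (use 1(5)[of i] 1(5)[of j] l ni D pq True in auto)
          then show ?thesis using co pq True by simp
        next
          case False
          then show ?thesis using co pq p cE0 by simp
        qed
      qed
    next
      case 2
      have "cost D P \<ge> flat_area D - vol D / 1"
        by (rule 2(2)) (use tiling_facts(8)[OF t] in auto)
      then show ?thesis using D q pq by (simp add: flat_area_axes[OF ax] vol_axes[OF ax])
    next
      case (3 l)
      then show ?thesis using c by simp
    qed
  qed
qed

text \<open>Four pieces in a \<open>1 \<times> p \<times> n\<close> box with \<open>n \<ge> 4\<close> cost at least 6 unless the box is a column. In a column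
  they cost 3.\<close>

lemma cost_four:
  assumes t: "tiling D P" and ax: "axes i j k" and nD: "nat_box D" and D: "side D i = 1" "side D k \<ge> 4"
    and inj: "inj_on dims P" and c: "card P = 4"
  shows "cost D P \<ge> 6 \<or> side D j = 1"
proof (cases "side D j = 1")
  case False
  then have j2: "side D j \<ge> 2"
    using tiling_facts(8)[OF t, of j] nD Nats_ge_Suc[of "side D j" 1] unfolding nat_box_def by simp
  have two: "2 \<le> card P" using c by simp
  have "cost D P \<ge> 6"
  proof (cases rule: tiling_cases[OF t two])
    case (1 K l E)
    have cE: "card (P - {K}) = 3" using c 1(1) by (simp add: card_Diff_singleton)
    have cE0: "cost E (P - {K}) \<ge> 2" using tiling_facts(7)[OF 1(3)] cE by simp
    from axes_ex_cases[OF ax, of l] show ?thesis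
    proof (elim disjE)
      assume "l = i"
      then show ?thesis using 1(6) D tiling_facts(4)[OF t 1(1), of i] tiling_facts(8)[OF 1(3), of i] by simp
    next
      assume "l = j"
      then show ?thesis using 1(7) cE0 D areas_axes[OF ax, of D] by simp
    next
      assume l: "l = k"
      have ni: "i \<noteq> k" "j \<noteq> k" using ax by (auto simp: axes_def)
      have sE: "side E i = 1" "side E j = side D j" using 1(5)[of i] 1(5)[of j] l ni D by auto
      have "nat_box E" by (rule nat_box_rest[OF nD t 1(1,3,6,5)])
      then have "cost E (P - {K}) \<ge> 6 - side E j"
        by (rule cost_three[OF 1(3) ax _ _ _ inj_on_subset[OF inj] cE]) (use sE j2 in auto)
      then show ?thesis using 1(7) l D areas_axes[OF ax, of D] sE by simp
    qed
  next
    case 2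
    have "cost D P \<ge> flat_area D - vol D / 1"
      by (rule 2(2)) (use tiling_facts(8)[OF t] in auto)
    then show ?thesis using D j2 by (simp add: flat_area_axes[OF ax] vol_axes[OF ax])
  next
    case (3 l)
    then show ?thesis using c by simp
  qed
  then show ?thesis ..
qed simp

text \<open>Five pieces in an \<open>m \<times> n \<times> n\<close> box. The cost is at least \<open>n + 6\<close>, except when \<open>m = 1\<close> and an end plate
  can be cut off that leaves a column.\<close>

lemma cost_five:
  assumes t: "tiling D P" and ax: "axes i j k" and nD: "nat_box D"
    and D: "side D j = n" "side D k = n" "side D i < n" and n: "n \<ge> 4"
    and inj: "inj_on dims P" and c: "card P = 5"
  shows "cost D P \<ge> n + 6 \<or>
    side D i = 1 \<and> (\<exists>K l E. K \<in> P \<and> l \<noteq> i \<and> end_cut D l K E \<and> tiling E (P - {K}) \<and>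
      side K l = n - 1 \<and> side E l = 1 \<and> (\<forall>j. j \<noteq> l \<longrightarrow> side K j = side D j \<and> side E j = side D j))"
proof -
  define m where "m = side D i"
  have m1: "m \<ge> 1" unfolding m_def by (rule tiling_facts(8)[OF t])
  have mN: "m \<in> \<nat>" using nD unfolding m_def nat_box_def by simp
  have m2: "m \<ge> 2" if "m \<noteq> 1" using Nats_ge_Suc[OF mN, of 1] m1 that by simp
  have nn: "n * n \<ge> 4 * n" using n by (intro mult_right_mono) auto
  have nm: "n * m \<ge> 2 * n" if "m \<noteq> 1"
    using mult_left_mono[OF m2[OF that], of n] n by (simp add: mult.commute)
  have nm1: "n * m \<ge> n" using mult_left_mono[OF m1, of n] n by simp
  have two: "2 \<le> card P" using c by simp
  have small: "cost D P \<ge> 18 - 2 * n" if "m = 1"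
    using semiperimeters_five[OF t ax _ inj c] flat_cost(1)[OF t ax] D that m_def by simp
  show ?thesis
  proof (cases rule: tiling_cases[OF t two])
    case (1 K l E)
    have cE: "card (P - {K}) = 4" using c 1(1) by (simp add: card_Diff_singleton)
    have cE0: "cost E (P - {K}) \<ge> 3" using tiling_facts(7)[OF 1(3)] cE by simp
    show ?thesis
    proof (cases "l = i")
      case True
      then have "cost D P = n * n + cost E (P - {K})" using 1(7) D areas_axes[OF ax, of D] by simp
      then have "cost D P \<ge> n + 6" using cE0 nn n by linarith
      then show ?thesis ..
    next
      case False
      obtain k' where ax': "axes i l k'" using axes_third False by metis
      have D': "side D l = n" "side D k' = n"
        using axes_ex_cases[OF ax, of l] axes_ex_cases[OF ax, of k'] ax' D by (auto simp: axes_def)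
      have co: "cost D P = n * m + cost E (P - {K})"
        using 1(7) D' areas_axes[OF ax', of D] m_def by simp
      show ?thesis
      proof (cases "m = 1")
        case True
        have ni: "i \<noteq> l" "k' \<noteq> l" using ax' by (auto simp: axes_def)
        have sE: "side E i = 1" "side E k' = n" using 1(5) ni D' True m_def by auto
        have "nat_box E" by (rule nat_box_rest[OF nD t 1(1,3,6,5)])
        then have "cost E (P - {K}) \<ge> 6 \<or> side E l = 1"
          by (rule cost_four[OF 1(3) ax' _ _ _ inj_on_subset[OF inj] cE]) (use sE n in auto)
        then show ?thesis
        proof
          assume "cost E (P - {K}) \<ge> 6"
          then show ?thesis using co True by simp
        next
          assume e: "side E l = 1"
          then have "side K l = n - 1" using 1(6) D' by simp
          moreover have "\<forall>j. j \<noteq> l \<longrightarrow> side K j = side D j \<and> side E j = side D j"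
            using 1(4,5) by simp
          ultimately show ?thesis using 1(1,2,3) e True False unfolding m_def by blast
        qed
      next
        case False
        then have "cost D P \<ge> n + 6" using co nm[OF False] cE0 n by linarith
        then show ?thesis ..
      qed
    qed
  next
    case 2
    have "m \<le> side D l" for l using axes_ex_cases[OF ax, of l] D m_def by auto
    then have "cost D P \<ge> flat_area D - vol D / m"
      using 2(2)[of m] m1 by simp
    then have co: "cost D P \<ge> 2 * (n * m)" using D m1
      by (simp add: flat_area_axes[OF ax] vol_axes[OF ax] m_def[symmetric] mult.commute)
    show ?thesis
    proof (cases "m = 1")
      case True
      have nN: "n \<in> \<nat>" using nD D unfolding nat_box_def by metis
      consider "n \<ge> 6" | "n = 4" | "n = 5"
        using Nats_ge_Suc[OF nN, of 4] Nats_ge_Suc[OF nN, of 5] n by fastforce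
      then show ?thesis
      proof cases
        case 1 then show ?thesis using co True by simp
      next
        case 2 then show ?thesis using small True by simp
      next
        case 3
        have "side K j < 5 \<and> side K k < 5" if K: "K \<in> P" for K
        proof -
          have "side K i = side D i" using flat_piece[OF t _ K, of i] True m_def by simp
          moreover have "i \<noteq> j" "i \<noteq> k" using ax by (auto simp: axes_def)
          ultimately have "side K j \<noteq> side D j" "side K k \<noteq> side D k"
            using 2(1)[OF K, of i j] 2(1)[OF K, of i k] by auto
          then show ?thesis using tiling_facts(5)[OF t K, of j] tiling_facts(5)[OF t K, of k] D 3 by auto
        qed
        then have "(\<Sum>K\<in>P. side K j + side K k) \<ge> 21"
          by (intro semiperimeters_five_square[OF t ax _ inj c]) (use True m_def D 3 in auto)
        then show ?thesis using flat_cost(1)[OF t ax] D True m_def 3 by simp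
      qed
    next
      case False
      then have "cost D P \<ge> n + 6" using co nm[OF False] n by linarith
      then show ?thesis ..
    qed
  next
    case (3 l)
    have "area l D \<ge> n * m"
    proof -
      have "n * m \<le> n * n" using D n m_def by (intro mult_left_mono) auto
      then show ?thesis
        using axes_ex_cases[OF ax, of l] areas_axes[OF ax, of D] D m_def by (auto simp: mult.commute)
    qed
    then have co: "cost D P \<ge> 2 * (n * m) + 1" using 3 by simp
    show ?thesis
    proof (cases "m = 1")
      case True
      have nN: "n \<in> \<nat>" using nD D unfolding nat_box_def by metis
      consider "n \<ge> 5" | "n = 4"
        using Nats_ge_Suc[OF nN, of 4] n by fastforce
      then show ?thesis
      proof cases
        case 1 then show ?thesis using co True by simp
      next
        case 2 then show ?thesis using small True by simp
      qed
    next
      case False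
      then have "cost D P \<ge> n + 6" using co nm[OF False] n by linarith
      then show ?thesis ..
    qed
  qed
qed

text \<open>The box \<open>D\<close>, a cube of side \<open>n\<close>, is cut into the block \<open>K\<close> of side \<open>n - 1\<close> in direction \<open>i\<close> and a
  layer \<open>E\<close>, which is in turn cut into the slab \<open>L\<close> of side \<open>n - 1\<close> in direction \<open>l\<close> and the column \<open>F\<close>.
  The other pieces in \<open>P\<close> dissect \<open>F\<close>.\<close>

definition block_slab_column ::
    "real \<Rightarrow> (real ^ 3) set \<Rightarrow> (real ^ 3) set set \<Rightarrow> 3 \<Rightarrow> (real ^ 3) set \<Rightarrow> 3 \<Rightarrow> (real ^ 3) set \<Rightarrow> (real ^ 3) set \<Rightarrow> bool" where
  "block_slab_column n D P i K l L F \<longleftrightarrow>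
     K \<in> P \<and> L \<in> P \<and> L \<noteq> K \<and> l \<noteq> i \<and> tiling F (P - {K} - {L}) \<and>
     (\<exists>E. end_cut D i K E \<and> end_cut E l L F \<and> (\<forall>j. side E j = (if j = i then 1 else n))) \<and>
     (\<forall>j. side K j = (if j = i then n - 1 else n)) \<and>
     (\<forall>j. side L j = (if j = i then 1 else if j = l then n - 1 else n)) \<and>
     (\<forall>j. side F j = (if j = i \<or> j = l then 1 else n))"

lemma cost_six:
  assumes t: "tiling D P" and D: "\<And>i. side D i = n" and nN: "n \<in> \<nat>" and n: "n \<ge> 4"
    and inj: "inj_on dims P" and c: "card P = 6"
  shows "cost D P \<ge> n ^ 2 + n + 6 \<or> (\<exists>i K l L F. block_slab_column n D P i K l L F)"
proof -
  have nD: "nat_box D" unfolding nat_box_def using D nN by simp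
  have nn: "n * n \<ge> 4 * n" using n by (intro mult_right_mono) auto
  have two: "2 \<le> card P" using c by simp
  have ar: "area i D = n * n" for i using axes_exists[of i] area_axes D by metis
  show ?thesis
  proof (cases rule: tiling_cases[OF t two])
    case (1 K i E)
    obtain j k where ax: "axes i j k" using axes_exists by blast
    then have ni: "j \<noteq> i" "k \<noteq> i" by (auto simp: axes_def)
    have cE: "card (P - {K}) = 5" using c 1(1) by (simp add: card_Diff_singleton)
    have nE: "nat_box E" by (rule nat_box_rest[OF nD t 1(1,3,6,5)])
    have sE: "side E l = n" if "l \<noteq> i" for l using 1(5)[OF that] D by simp
    have Ei: "side E i < n" using 1(6) D tiling_facts(4)[OF t 1(1), of i] by simp
    have "cost E (P - {K}) \<ge> n + 6 \<or>
      side E i = 1 \<and> (\<exists>L l F. L \<in> P - {K} \<and> l \<noteq> i \<and> end_cut E l L F \<and> tiling F (P - {K} - {L}) \<and>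
      side L l = n - 1 \<and> side F l = 1 \<and> (\<forall>j. j \<noteq> l \<longrightarrow> side L j = side E j \<and> side F j = side E j))"
      by (rule cost_five[OF 1(3) ax nE _ _ Ei n inj_on_subset[OF inj] cE]) (use sE ni in auto)
    then show ?thesis
    proof
      assume "cost E (P - {K}) \<ge> n + 6"
      then show ?thesis using 1(7) ar by (simp add: power2_eq_square)
    next
      assume "side E i = 1 \<and> (\<exists>L l F. L \<in> P - {K} \<and> l \<noteq> i \<and> end_cut E l L F \<and> tiling F (P - {K} - {L}) \<and>
      side L l = n - 1 \<and> side F l = 1 \<and> (\<forall>j. j \<noteq> l \<longrightarrow> side L j = side E j \<and> side F j = side E j))"
      then obtain L l F where L: "side E i = 1" "L \<in> P" "L \<noteq> K" "l \<noteq> i" "end_cut E l L F" "tiling F (P - {K} - {L})"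
        "side L l = n - 1" "side F l = 1" "\<And>j. j \<noteq> l \<Longrightarrow> side L j = side E j" "\<And>j. j \<noteq> l \<Longrightarrow> side F j = side E j"
        by blast
      have "side E j = (if j = i then 1 else n)" for j using sE L(1) by simp
      moreover have "side K j = (if j = i then n - 1 else n)" for j
        using 1(4)[of j] 1(6) L(1) D by simp
      moreover have "side L j = (if j = i then 1 else if j = l then n - 1 else n)" for j
        using L(9)[of j] L(7,4,1) sE by (cases "j = l"; cases "j = i") auto
      moreover have "side F j = (if j = i \<or> j = l then 1 else n)" for j
        using L(10)[of j] L(8,4,1) sE by (cases "j = l"; cases "j = i") auto
      ultimately have "block_slab_column n D P i K l L F"
        unfolding block_slab_column_def using 1(1,2) L(2-6) by blast
      then show ?thesis by blast
    qed
  next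
    case 2
    have "cost D P \<ge> flat_area D - vol D / n"
      using 2(2)[of n] n D by simp
    then have "cost D P \<ge> 2 * (n * n)" using D n
      by (simp add: flat_area_axes[OF axes_123] vol_axes[OF axes_123])
    then have "cost D P \<ge> n * n + n + 6" using nn n by linarith
    then show ?thesis by (simp add: power2_eq_square)
  next
    case (3 l)
    then have "cost D P \<ge> n * n + n + 6" unfolding ar using nn n by linarith
    then show ?thesis by (simp add: power2_eq_square)
  qed
qed

section \<open>The internal interface is the cost\<close>

lemma sum_pairs:
  fixes f :: "'a set \<Rightarrow> real"
  assumes "finite P"
  shows "2 * (\<Sum>D | D \<subseteq> P \<and> card D = 2. f D) = (\<Sum>x\<in>P. \<Sum>y\<in>P - {x}. f {x, y})"
  using assms
proof (induction P)
  case empty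
  have "{D :: 'a set. D \<subseteq> {} \<and> card D = 2} = {}" by auto
  then show ?case by (simp only: sum.empty mult_zero_right)
next
  case (insert z P)
  let ?S = "\<lambda>P. {D. D \<subseteq> P \<and> card D = 2}"
  have S: "?S (insert z P) = ?S P \<union> (\<lambda>y. {z, y}) ` P"
  proof (intro set_eqI iffI)
    fix D assume D: "D \<in> ?S (insert z P)"
    show "D \<in> ?S P \<union> (\<lambda>y. {z, y}) ` P"
    proof (cases "z \<in> D")
      case True
      then obtain y where "D = {z, y}" "y \<noteq> z" using D by (auto simp: card_2_iff)
      then show ?thesis using D by auto
    qed (use D in auto)
  next
    fix D assume "D \<in> ?S P \<union> (\<lambda>y. {z, y}) ` P"
    then show "D \<in> ?S (insert z P)" using insert.hyps by (auto simp: card_2_iff)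
  qed
  have "sum f (?S (insert z P)) = sum f (?S P) + sum f ((\<lambda>y. {z, y}) ` P)"
    unfolding S by (rule sum.union_disjoint) (use insert.hyps in auto)
  also have "sum f ((\<lambda>y. {z, y}) ` P) = (\<Sum>y\<in>P. f {z, y})"
    by (subst sum.reindex) (auto simp: inj_on_def doubleton_eq_iff)
  finally have 1: "2 * sum f (?S (insert z P)) = (\<Sum>x\<in>P. \<Sum>y\<in>P - {x}. f {x, y}) + 2 * (\<Sum>y\<in>P. f {z, y})"
    using insert.IH by simp
  have "(\<Sum>y\<in>insert z P - {x}. f {x, y}) = f {z, x} + (\<Sum>y\<in>P - {x}. f {x, y})" if "x \<in> P" for x
  proof -
    have "insert z P - {x} = insert z (P - {x})" using that insert.hyps by auto
    then show ?thesis using insert.hyps by (simp add: insert_commute)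
  qed
  then have "(\<Sum>x\<in>insert z P. \<Sum>y\<in>insert z P - {x}. f {x, y})
      = (\<Sum>y\<in>insert z P - {z}. f {z, y}) + (\<Sum>x\<in>P. f {z, x} + (\<Sum>y\<in>P - {x}. f {x, y}))"
    using insert.hyps by simp
  also have "insert z P - {z} = P" using insert.hyps by auto
  finally show ?case using 1 by (simp add: sum.distrib)
qed

lemma overlap_nonzeroD: "overlap p q r s \<noteq> 0 \<Longrightarrow> max p r < min q s"
proof (rule ccontr)
  assume "overlap p q r s \<noteq> 0" "\<not> max p r < min q s"
  moreover from this(2) have "max 0 (min q s - max p r) = 0" by (intro max_absorb1) linarith
  ultimately show False unfolding overlap_def by blast
qed

context tiled
begin

text \<open>The length of the common part of two pieces, projected to the \<open>j\<close>-th axis.\<close>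

abbreviation ov :: "(real ^ 3) set \<Rightarrow> (real ^ 3) set \<Rightarrow> 3 \<Rightarrow> real" where
  "ov K L j \<equiv> overlap (lo K $ j) (hi K $ j) (lo L $ j) (hi L $ j)"

text \<open>The area in which \<open>L\<close> lies on top of \<open>K\<close> in direction \<open>i\<close>: it is nonzero only if the upper face of
  \<open>K\<close> and the lower face of \<open>L\<close> are in the same plane.\<close>

definition contact :: "3 \<Rightarrow> (real ^ 3) set \<Rightarrow> (real ^ 3) set \<Rightarrow> real" where
  "contact i K L = (if hi K $ i = lo L $ i then \<Prod>j\<in>UNIV - {i}. ov K L j else 0)"

lemma ov_commute: "ov K L j = ov L K j" by (simp add: overlap_def max.commute min.commute)

lemma contact_axes: "axes i j k \<Longrightarrow> contact i K L = (if hi K $ i = lo L $ i then ov K L j * ov K L k else 0)"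
  unfolding contact_def by (subst axes_diff) (auto simp: axes_def)

text \<open>A piece that does not touch the upper face of the box is covered by pieces from above.\<close>

lemma contact_sum_above:
  assumes K: "K \<in> P"
  shows "(\<Sum>L\<in>P. contact i K L) = (if hi K $ i < b $ i then area i K else 0)"
proof (cases "hi K $ i < b $ i")
  case False
  have "contact i K L = 0" if "L \<in> P" for L
  proof -
    have "hi K $ i \<noteq> lo L $ i" using False piece(2,4)[OF that, of i] by simp
    then show ?thesis by (simp add: contact_def)
  qed
  then show ?thesis using False by simp
next
  case True
  define v where "v = (\<chi> j. if j = i then b $ i else hi K $ j)"
  let ?A = "\<lambda>L. \<Prod>j\<in>UNIV - {i}. overlap (lo K $ j) (v $ j) (lo L $ j) (hi L $ j)"
  have A: "?A L = (\<Prod>j\<in>UNIV - {i}. ov K L j)" for L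
    by (rule prod.cong) (auto simp: v_def)
  have "(\<Sum>L | L \<in> P \<and> lo L $ i \<le> hi K $ i \<and> hi K $ i < hi L $ i. ?A L) = (\<Prod>j\<in>UNIV - {i}. v $ j - lo K $ j)"
  proof (rule section_sum)
    show "lo K $ j \<le> v $ j" for j
      using piece(2)[OF K, of j] piece(2)[OF K, of i] True by (auto simp: v_def)
    show "v $ j \<le> b $ j" for j using piece(4)[OF K, of j] by (simp add: v_def)
    show "a $ i \<le> hi K $ i" using piece(2,3)[OF K, of i] by simp
  qed (use piece(3)[OF K] True in auto)
  also have "\<dots> = area i K" unfolding area_def
    by (rule prod.cong) (auto simp: v_def piece(5)[OF K])
  finally have 1: "(\<Sum>L | L \<in> P \<and> lo L $ i \<le> hi K $ i \<and> hi K $ i < hi L $ i. \<Prod>j\<in>UNIV - {i}. ov K L j) = area i K"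
    unfolding A .
  have "contact i K L = (if lo L $ i \<le> hi K $ i \<and> hi K $ i < hi L $ i then \<Prod>j\<in>UNIV - {i}. ov K L j else 0)"
    if L: "L \<in> P" for L
  proof (cases "lo L $ i < hi K $ i \<and> hi K $ i < hi L $ i")
    case True
    have "(\<Prod>j\<in>UNIV - {i}. ov K L j) = 0"
    proof (rule ccontr)
      assume "(\<Prod>j\<in>UNIV - {i}. ov K L j) \<noteq> 0"
      then have nz: "ov K L j \<noteq> 0" if "j \<noteq> i" for j using that by simp
      have "max (lo K $ j) (lo L $ j) < min (hi K $ j) (hi L $ j)" for j
      proof (cases "j = i")
        case j: True
        then show ?thesis using True piece(2)[OF K, of i] by simp
      next
        case False
        then show ?thesis by (rule overlap_nonzeroD[OF nz])
      qed
      then have "K = L" by (rule pieces_eq[OF K L])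
      then show False using True by simp
    qed
    then show ?thesis by (simp add: contact_def)
  next
    case False
    then show ?thesis using piece(2)[OF L, of i] by (auto simp: contact_def)
  qed
  then show ?thesis using 1 True fin by (simp add: sum.inter_filter[symmetric])
qed

text \<open>Two distinct pieces are separated in some direction, and only there can they be in contact.\<close>

lemma flat_area_Int:
  assumes K: "K \<in> P" and L: "L \<in> P" and ne: "K \<noteq> L"
  shows "flat_area (K \<inter> L) = (\<Sum>i\<in>UNIV. contact i K L + contact i L K)"
proof -
  define p q :: "real ^ 3"
    where "p = (\<chi> i. max (lo K $ i) (lo L $ i))" and "q = (\<chi> i. min (hi K $ i) (hi L $ i))"
  have "cbox (lo K) (hi K) \<inter> cbox (lo L) (hi L) = cbox p q"
    by (auto simp: mem_box_cart p_def q_def)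
  then have KL: "K \<inter> L = cbox p q" using piece(1)[OF K] piece(1)[OF L] by simp
  have ov: "ov K L j = max 0 (q $ j - p $ j)" for j by (simp add: overlap_def p_def q_def)
  have "\<exists>i. q $ i \<le> p $ i"
  proof (rule ccontr)
    assume "\<not> ?thesis"
    then have "p $ i < q $ i" for i by (auto simp: not_le)
    then have "max (lo K $ i) (lo L $ i) < min (hi K $ i) (hi L $ i)" for i
      unfolding p_def q_def vec_lambda_beta .
    then show False using pieces_eq[OF K L] ne by blast
  qed
  then obtain i where i: "q $ i \<le> p $ i" ..
  obtain j k where ax: "axes i j k" using axes_exists by blast
  have ovi: "ov K L i = 0" unfolding ov using i by simp
  then have ovi': "ov L K i = 0" by (subst ov_commute)
  have ax': "axes j k i" "axes k i j" using ax by (auto simp: axes_def)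
  have "contact j K L = 0" "contact k K L = 0" "contact j L K = 0" "contact k L K = 0"
    unfolding contact_axes[OF ax'(1)] contact_axes[OF ax'(2)] ovi ovi' by simp_all
  then have rhs: "(\<Sum>l\<in>UNIV. contact l K L + contact l L K) = contact i K L + contact i L K"
    unfolding sum_axes[OF ax] by simp
  have lK: "lo K $ i < hi K $ i" "lo L $ i < hi L $ i" using piece(2)[OF K] piece(2)[OF L] by auto
  show ?thesis
  proof (cases "cbox p q = {}")
    case True
    then obtain l where l: "q $ l < p $ l" by (auto simp: interval_eq_empty_cart)
    have "contact i K L = 0 \<and> contact i L K = 0"
    proof (cases "l = i")
      case True
      then have "min (hi K $ i) (hi L $ i) < max (lo K $ i) (lo L $ i)"
        using l unfolding p_def q_def by simp
      then have "hi K $ i \<noteq> lo L $ i \<and> hi L $ i \<noteq> lo K $ i" using lK by linarith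
      then show ?thesis by (simp add: contact_def)
    next
      case False
      have "ov K L l = 0" unfolding ov using l by simp
      moreover from this have "ov L K l = 0" by (subst ov_commute)
      moreover have "l = j \<or> l = k" using False axes_other[OF ax, of l] by blast
      ultimately have "ov K L j * ov K L k = 0" "ov L K j * ov L K k = 0" by auto
      then show ?thesis by (simp only: contact_axes[OF ax] if_cancel)
    qed
    then show ?thesis unfolding rhs KL True by (simp add: flat_area_def)
  next
    case False
    then have pq: "p $ l \<le> q $ l" for l by (simp add: cbox_ne_cart)
    have s: "side (cbox p q) l = ov K L l" for l
      unfolding side_cbox[OF False] ov using pq[of l] by simp
    have "p $ i = q $ i" using pq[of i] i by simp
    then have "(hi K $ i = lo L $ i) \<noteq> (hi L $ i = lo K $ i)"
      using lK unfolding p_def q_def vec_lambda_beta by linarith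
    moreover have "ov L K j = ov K L j" "ov L K k = ov K L k" by (rule ov_commute)+
    ultimately have "contact i K L + contact i L K = ov K L j * ov K L k"
      unfolding contact_axes[OF ax] by (cases "hi K $ i = lo L $ i") simp_all
    then show ?thesis unfolding rhs KL flat_area_axes[OF ax] s ovi by simp
  qed
qed

lemma interface_eq_cost:
  assumes ne: "P \<noteq> {}"
  shows "internal_interface P = cost (cbox a b) P"
proof -
  have self: "contact i K K = 0" if "K \<in> P" for i K
    using piece(2)[OF that, of i] by (simp add: contact_def)
  have "2 * internal_interface P = (\<Sum>K\<in>P. \<Sum>L\<in>P - {K}. flat_area (K \<inter> L))"
    unfolding internal_interface_def sum_pairs[OF fin] by simp
  also have "\<dots> = (\<Sum>K\<in>P. \<Sum>L\<in>P - {K}. \<Sum>i\<in>UNIV. contact i K L + contact i L K)"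
  proof (rule sum.cong[OF refl], rule sum.cong[OF refl])
    fix K L assume "K \<in> P" "L \<in> P - {K}"
    then show "flat_area (K \<inter> L) = (\<Sum>i\<in>UNIV. contact i K L + contact i L K)"
      by (intro flat_area_Int) auto
  qed
  also have "\<dots> = (\<Sum>K\<in>P. \<Sum>L\<in>P. \<Sum>i\<in>UNIV. contact i K L + contact i L K)"
  proof (rule sum.cong[OF refl])
    fix K assume "K \<in> P"
    then show "(\<Sum>L\<in>P - {K}. \<Sum>i\<in>UNIV. contact i K L + contact i L K)
        = (\<Sum>L\<in>P. \<Sum>i\<in>UNIV. contact i K L + contact i L K)"
      by (intro sum.mono_neutral_left) (use fin self in auto)
  qed
  also have "\<dots> = (\<Sum>K\<in>P. \<Sum>L\<in>P. \<Sum>i\<in>UNIV. contact i K L) + (\<Sum>K\<in>P. \<Sum>L\<in>P. \<Sum>i\<in>UNIV. contact i L K)"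
    by (simp add: sum.distrib)
  also have "(\<Sum>K\<in>P. \<Sum>L\<in>P. \<Sum>i\<in>UNIV. contact i L K) = (\<Sum>K\<in>P. \<Sum>L\<in>P. \<Sum>i\<in>UNIV. contact i K L)"
    by (rule sum.swap)
  finally have "internal_interface P = (\<Sum>K\<in>P. \<Sum>L\<in>P. \<Sum>i\<in>UNIV. contact i K L)" by simp
  also have "\<dots> = (\<Sum>K\<in>P. \<Sum>i\<in>UNIV. \<Sum>L\<in>P. contact i K L)"
    by (rule sum.cong[OF refl]) (rule sum.swap)
  also have "\<dots> = (\<Sum>i\<in>UNIV. \<Sum>K\<in>P. \<Sum>L\<in>P. contact i K L)" by (rule sum.swap)
  also have "\<dots> = (\<Sum>i\<in>UNIV. excess i)"
  proof (rule sum.cong[OF refl])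
    fix i
    have "(\<Sum>K\<in>P. \<Sum>L\<in>P. contact i K L) = (\<Sum>K\<in>P. if hi K $ i \<noteq> b $ i then area i K else 0)"
    proof (rule sum.cong[OF refl])
      fix K assume K: "K \<in> P"
      have "hi K $ i < b $ i \<longleftrightarrow> hi K $ i \<noteq> b $ i" using piece(4)[OF K, of i] by auto
      then show "(\<Sum>L\<in>P. contact i K L) = (if hi K $ i \<noteq> b $ i then area i K else 0)"
        unfolding contact_sum_above[OF K] by (simp only:)
    qed
    then show "(\<Sum>K\<in>P. \<Sum>L\<in>P. contact i K L) = excess i"
      unfolding excess_upper[OF ne] by (simp add: sum.inter_filter[OF fin])
  qed
  finally show ?thesis by (simp add: cost_excess)
qed

end

section \<open>Admissible dissections of the cube\<close>

lemma cube_ne: "cube n \<noteq> {}"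
  unfolding cube_def by (simp add: cbox_ne_cart)

lemma side_cube: "side (cube n) i = real n"
  using side_cbox[of 0 "vec (real n)" i] cube_ne[of n] unfolding cube_def by simp

lemma lo_cube: "lo (cube n) $ i = 0" and hi_cube: "hi (cube n) $ i = real n"
  using lo_cbox hi_cbox cube_ne[of n] unfolding cube_def by auto

lemma mem_cube: "x \<in> cube n \<longleftrightarrow> (\<forall>i. 0 \<le> x $ i \<and> x $ i \<le> real n)"
  unfolding cube_def by (simp add: mem_box_cart)

lemma admissible_tiled:
  assumes "admissible n k P"
  shows "tiled P 0 (vec (real n))"
  using assms unfolding admissible_def cube_def by unfold_locales auto

lemma admissible_tiling:
  assumes "admissible n k P" "k > 0"
  shows "tiling (cube n) P" "card P = k" "inj_on dims P"
proof -
  show "card P = k" "inj_on dims P" using assms unfolding admissible_def by auto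
  moreover from this have "P \<noteq> {}" using assms(2) by auto
  ultimately show "tiling (cube n) P"
    using admissible_tiled[OF assms(1)] unfolding tiling_def cube_def by blast
qed

lemma total_surface_cost: "total_surface P = 6 * real n ^ 2 + 2 * cost (cube n) P"
proof -
  have "total_surface P = 2 * (\<Sum>K\<in>P. flat_area K)"
    unfolding total_surface_def surface_area_def flat_area_def by (simp add: sum_distrib_left)
  then show ?thesis unfolding cost_def by (simp add: flat_area_def side_cube power2_eq_square)
qed

lemma admissible_interface:
  assumes "admissible n k P" "k > 0"
  shows "internal_interface P = cost (cube n) P"
proof -
  interpret tiled P 0 "vec (real n)" by (rule admissible_tiled[OF assms(1)])
  have "P \<noteq> {}" using admissible_tiling[OF assms] assms(2) by auto
  then show ?thesis unfolding cube_def by (rule interface_eq_cost)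
qed

lemma triple_mset_cases:
  assumes "{#a, b, c#} = {#x, y, z#}"
  obtains "a = x" "b = y" "c = z" | "a = x" "b = z" "c = y" | "a = y" "b = x" "c = z"
    | "a = y" "b = z" "c = x" | "a = z" "b = x" "c = y" | "a = z" "b = y" "c = x"
  using assms by (auto simp: add_eq_conv_ex)

lemma flat_area_dims: "dims K = {# x, y, z #} \<Longrightarrow> flat_area K = x * y + y * z + z * x"
  unfolding dims_def by (erule triple_mset_cases) (auto simp: flat_area_def)

lemma vol_dims: "dims K = {# x, y, z #} \<Longrightarrow> vol K = x * y * z"
  unfolding dims_def vol_axes[OF axes_123] by (erule triple_mset_cases) auto

lemma vol_eq_dims: "dims K = dims L \<Longrightarrow> vol K = vol L"
  using vol_dims[of K] unfolding dims_def[of L] vol_axes[OF axes_123, of L] .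

lemma side_in_dims: "side K i \<in># dims K"
  using exhaust_3[of i] unfolding dims_def by auto

section \<open>Dissections into a block, a slab and four sticks\<close>

text \<open>The dissections into a block, a slab and four sticks, with a given set of stick lengths.\<close>

definition sticks :: "nat \<Rightarrow> nat set \<Rightarrow> (real ^ 3) set set \<Rightarrow> bool" where
  "sticks n L P \<longleftrightarrow> P division_of cube n \<and> (\<exists>B S C. P = {B, S} \<union> C \<and>
        dims B = {# real n - 1, real n, real n #} \<and>
        dims S = {# 1, real n - 1, real n #} \<and>
        cut_column n L C)"

lemma block_slab_sticks_iff: "block_slab_sticks n P \<longleftrightarrow> (\<exists>L\<in>four_distinct_parts n. sticks n L P)"
proof -
  have "D \<and> (\<exists>B S C. \<exists>L\<in>X. Q B S C L) \<longleftrightarrow> (\<exists>L\<in>X. D \<and> (\<exists>B S C. Q B S C L))"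
    for D X and Q :: "'x \<Rightarrow> 'x \<Rightarrow> 'y \<Rightarrow> 'z \<Rightarrow> bool"
    by blast
  then show ?thesis unfolding block_slab_sticks_def sticks_def .
qed

lemma four_partsD:
  assumes "L \<in> four_distinct_parts n"
  shows "finite L" "card L = 4" "0 \<notin> L" "\<Sum>L = n" "l \<in> L \<Longrightarrow> 1 \<le> l" "l \<in> L \<Longrightarrow> l < n"
proof -
  show L: "finite L" "card L = 4" "0 \<notin> L" "\<Sum>L = n"
    using assms unfolding four_distinct_parts_def by auto
  show "1 \<le> l" if "l \<in> L" 
  proof -
    have "l \<noteq> 0" using L(3) that by metis
    then show ?thesis by linarith
  qed
  show "l < n" if l: "l \<in> L"
  proof -
    have "L \<noteq> {l}" using L(2) by auto
    then obtain m where m: "m \<in> L" "m \<noteq> l" using l by blast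
    have "\<Sum>{m, l} \<le> \<Sum>L" using L(1) m(1) l by (intro sum_mono2) auto
    moreover have "\<Sum>{m, l} = m + l" using m(2) by simp
    ultimately have "m + l \<le> n" using L(4) by linarith
    moreover have "m \<noteq> 0" using L(3) m(1) by metis
    ultimately show ?thesis by linarith
  qed
qed

lemma sticks_facts:
  assumes L: "L \<in> four_distinct_parts n" and P: "sticks n L P" and n: "n \<ge> 3"
  shows "admissible n 6 P" "cost (cube n) P = real n ^ 2 + real n + 3"
    "vol ` P = {real n * real n * (real n - 1), real n * (real n - 1)} \<union> real ` L"
proof -
  obtain B S C where BSC: "P = {B, S} \<union> C" and B: "dims B = {# real n - 1, real n, real n #}"
    and S: "dims S = {# 1, real n - 1, real n #}" and C: "cut_column n L C"
    using P unfolding sticks_def by blast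
  have divP: "P division_of cube n" using P unfolding sticks_def by blast
  have bij: "bij_betw dims C ((\<lambda>l. {# 1, 1, real l #}) ` L)"
    using C unfolding cut_column_def by blast
  have injL: "inj_on (\<lambda>l. {# 1, 1, real l #}) L" by (rule inj_onI) simp
  have cC: "card C = 4"
    using bij_betw_same_card[OF bij] card_image[OF injL] four_partsD(2)[OF L] by simp
  then have fC: "finite C" using card.infinite by fastforce
  have dC: "\<exists>l\<in>L. dims K = {# 1, 1, real l #}" if "K \<in> C" for K
    using bij that by (auto dest: bij_betwE)
  have BS: "dims B \<noteq> dims S" unfolding B S using n by (auto elim!: triple_mset_cases)
  have BC: "dims B \<noteq> dims K" if "K \<in> C" for K
    using dC[OF that] n unfolding B by (auto elim!: triple_mset_cases)
  have SC: "dims S \<noteq> dims K" if "K \<in> C" for K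
  proof
    assume eq: "dims S = dims K"
    obtain l where "dims K = {# 1, 1, real l #}" using dC[OF \<open>K \<in> C\<close>] by blast
    then have "{# 1, real n - 1, real n #} = {# 1, 1, real l #}" using eq S by simp
    then show False by (rule triple_mset_cases) (use n in auto)
  qed
  have notin: "B \<noteq> S" "B \<notin> C" "S \<notin> C" using BS BC SC by auto
  have injC: "inj_on dims C" using bij by (rule bij_betw_imp_inj_on)
  have inj: "inj_on dims P"
    unfolding BSC inj_on_def
    using BS BC SC BC[THEN not_sym] SC[THEN not_sym] injC[unfolded inj_on_def] by auto
  have cP: "card P = 6" unfolding BSC using notin cC fC by simp
  have sum_flat: "(\<Sum>K\<in>P. f K) = f B + f S + (\<Sum>K\<in>C. f K)" for f :: "_ \<Rightarrow> real"
    unfolding BSC using notin fC by simp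
  have N: "x \<in> \<nat> \<and> x > 0" if "K \<in> P" "x \<in># dims K" for K x
  proof -
    have 1: "real n - 1 \<in> \<nat>" using n by (metis Nats_1 Nats_diff of_nat_1 of_nat_in_Nats of_nat_le_iff order_trans one_le_numeral)
    from that(1) consider "K = B" | "K = S" | "K \<in> C" unfolding BSC by auto
    then show ?thesis
    proof cases
      case 1
      then show ?thesis using that(2) B n \<open>real n - 1 \<in> \<nat>\<close> by auto
    next
      case 2
      then show ?thesis using that(2) S n \<open>real n - 1 \<in> \<nat>\<close> by auto
    next
      case 3
      then obtain l where l: "l \<in> L" "dims K = {# 1, 1, real l #}" using dC by blast
      then show ?thesis using that(2) four_partsD(5)[OF L l(1)] by auto
    qed
  qed
  show "admissible n 6 P"
    unfolding admissible_def using divP cP inj N side_in_dims by blast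
  have "(\<Sum>K\<in>C. flat_area K) = (\<Sum>K\<in>C. 1 + 2 * vol K)"
  proof (rule sum.cong[OF refl])
    fix K assume "K \<in> C"
    then obtain l where "dims K = {# 1, 1, real l #}" using dC by blast
    then show "flat_area K = 1 + 2 * vol K" using flat_area_dims vol_dims by fastforce
  qed
  also have "\<dots> = 4 + 2 * (\<Sum>K\<in>C. vol K)"
    using cC by (simp add: sum.distrib sum_distrib_left)
  finally have fl: "(\<Sum>K\<in>C. flat_area K) = 4 + 2 * (\<Sum>K\<in>C. vol K)" .
  have "(\<Sum>K\<in>P. vol K) = vol (cube n)"
    using admissible_tiling(1)[OF \<open>admissible n 6 P\<close>] tiling_facts(6) by simp
  then have "(\<Sum>K\<in>C. vol K) = real n"
    unfolding sum_flat vol_dims[OF B] vol_dims[OF S] vol_axes[OF axes_123, of "cube n"] side_cube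
    by (simp add: algebra_simps)
  then show "cost (cube n) P = real n ^ 2 + real n + 3"
    unfolding cost_def sum_flat flat_area_dims[OF B] flat_area_dims[OF S] fl
    by (simp add: flat_area_def side_cube power2_eq_square algebra_simps)
  have "vol ` C = real ` L"
  proof
    show "vol ` C \<subseteq> real ` L" using dC vol_dims by fastforce
    show "real ` L \<subseteq> vol ` C"
    proof
      fix y assume "y \<in> real ` L"
      then obtain l where l: "l \<in> L" "y = real l" by auto
      then have "{# 1, 1, real l #} \<in> dims ` C" using bij_betw_imp_surj_on[OF bij] by auto
      then obtain K where K: "K \<in> C" "dims K = {# 1, 1, real l #}" by auto
      have "vol K = y" unfolding vol_dims[OF K(2)] l by simp
      then show "y \<in> vol ` C" using K(1) by blast
    qed
  qed
  then show "vol ` P = {real n * real n * (real n - 1), real n * (real n - 1)} \<union> real ` L"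
    unfolding BSC using vol_dims[OF B] vol_dims[OF S] by (auto simp: mult_ac)
qed

text \<open>The lengths of the sticks are recovered from the volumes: all other pieces have volume at
  least \<open>n\<close>.\<close>

definition stick_lengths :: "nat \<Rightarrow> (real ^ 3) set set \<Rightarrow> nat set" where
  "stick_lengths n P = {l. l < n \<and> real l \<in> vol ` P}"

lemma stick_lengths_eq:
  assumes L: "L \<in> four_distinct_parts n" and P: "sticks n L P" and n: "n \<ge> 3"
  shows "stick_lengths n P = L"
proof -
  have "real n * (real n - 1) \<ge> real n" using n mult_left_mono[of 1 "real n - 1" "real n"] by simp
  moreover have "real n * real n * (real n - 1) \<ge> real n"
    using n mult_mono[of 1 "real n - 1" "real n" "real n * real n"] by (simp add: mult.commute)
  ultimately have "real x \<noteq> real n * real n * (real n - 1)" "real x \<noteq> real n * (real n - 1)"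
    if "x < n" for x using that by linarith+
  then show ?thesis
    unfolding stick_lengths_def sticks_facts(3)[OF assms] using four_partsD(6)[OF L] by auto
qed

text \<open>If the column is what is left after cutting off the block and the slab, the remaining four pieces
  are sticks of distinct lengths that add up to \<open>n\<close>. The second claim ties the sticks to the
  particular block and slab, which the relation between dissections with equal stick lengths needs.\<close>

lemma block_slab_column_sticks:
  assumes adm: "admissible n 6 P" and str: "block_slab_column (real n) (cube n) P i K l L F" and n: "n \<ge> 3"
  shows "\<exists>M\<in>four_distinct_parts n. sticks n M P \<and>
    dims ` (P - {K} - {L}) = (\<lambda>l. {# 1, 1, real l #}) ` M"
proof -
  note t = admissible_tiling[OF adm, simplified]
  have s: "K \<in> P" "L \<in> P" "L \<noteq> K" "l \<noteq> i" "tiling F (P - {K} - {L})"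
    "\<And>j. side K j = (if j = i then real n - 1 else real n)"
    "\<And>j. side L j = (if j = i then 1 else if j = l then real n - 1 else real n)"
    "\<And>j. side F j = (if j = i \<or> j = l then 1 else real n)"
    using str unfolding block_slab_column_def by auto
  define C where "C = P - {K} - {L}"
  obtain k where ax: "axes i l k" using axes_third s(4) by metis
  have ne: "i \<noteq> l" "k \<noteq> i" "k \<noteq> l" using ax by (auto simp: axes_def)
  have tC: "tiling F C" using s(5) by (simp add: C_def)
  have C1: "side M i = 1" "side M l = 1" if "M \<in> C" for M
    using flat_piece[OF tC _ that, of i] flat_piece[OF tC _ that, of l] s(8) by auto
  define len where "len M = nat \<lfloor>side M k\<rfloor>" for M
  have len: "side M k = real (len M)" "len M \<ge> 1" if M: "M \<in> C" for M
  proof -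
    show 1: "side M k = real (len M)"
      using tiling_facts(3)[OF tC M, of k] unfolding len_def by (auto elim!: Nats_cases)
    show "len M \<ge> 1" using tiling_facts(4)[OF tC M, of k] 1 by simp
  qed
  have dC: "dims M = {# 1, 1, real (len M) #}" if "M \<in> C" for M
    unfolding dims_axes[OF ax] using C1[OF that] len[OF that] by simp
  have injC: "inj_on dims C" by (rule inj_on_subset[OF t(3)]) (auto simp: C_def)
  have injl: "inj_on len C" using injC dC by (auto simp: inj_on_def)
  have finP: "finite P" using tiling_facts(1) t(1) by blast
  have cC: "card C = 4" unfolding C_def using t(2) s(1-3) finP by (simp add: card_Diff_singleton)
  have finC: "finite C" using finP by (simp add: C_def)
  have "(\<Sum>M\<in>C. vol M) = real n"
    using tiling_facts(6)[OF tC] vol_axes[OF ax, of F] s(8) ne by simp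
  moreover have "(\<Sum>M\<in>C. vol M) = (\<Sum>M\<in>C. real (len M))"
    by (rule sum.cong[OF refl]) (use vol_axes[OF ax] C1 len in auto)
  ultimately have "real (\<Sum>M\<in>C. len M) = real n" by simp
  then have sumC: "(\<Sum>M\<in>C. len M) = n" by (simp only: of_nat_eq_iff)
  have parts: "len ` C \<in> four_distinct_parts n"
    unfolding four_distinct_parts_def
    using finC card_image[OF injl] cC sumC len(2) by (force simp: sum.reindex[OF injl])
  have img: "dims ` C = (\<lambda>l. {# 1, 1, real l #}) ` len ` C"
    unfolding image_image using dC by (intro image_cong) auto
  obtain a b where F: "F = cbox a b" and div: "C division_of cbox a b"
    using tC unfolding tiling_def tiled_def by blast
  have "dims F = {# 1, 1, real n #}" unfolding dims_axes[OF ax] using s(8) ne by simp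
  then have "cut_column n (len ` C) C"
    unfolding cut_column_def bij_betw_def using F div injC img by blast
  moreover have "P = {K, L} \<union> C" using s(1,2) by (auto simp: C_def)
  moreover have "dims K = {# real n - 1, real n, real n #}"
    unfolding dims_axes[OF ax] using s(6) ne by simp
  moreover have "dims L = {# 1, real n - 1, real n #}"
    unfolding dims_axes[OF ax] using s(7) ne by simp
  moreover have "P division_of cube n" using adm unfolding admissible_def by blast
  ultimately have "sticks n (len ` C) P" unfolding sticks_def by blast
  then show ?thesis using parts img unfolding C_def by (intro bexI[of _ "len ` C"] conjI) (simp_all add: C_def)
qed

lemma four_parts_ge_10:
  assumes "L \<in> four_distinct_parts n"
  shows "n \<ge> 10"
proof -
  note L = four_partsD[OF assms]
  obtain a b c d where abcd: "L = {a, b, c, d}" "distinct [a, b, c, d]"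
    using L(2) by (auto simp: card_Suc_eq numeral_eq_Suc)
  then have "n = a + b + c + d" using L(4) by auto
  moreover have "a > 0" "b > 0" "c > 0" "d > 0" using abcd L(5) by (auto simp: Suc_le_eq)
  ultimately show ?thesis using abcd(2) by auto
qed

lemma cost_dichotomy:
  assumes "admissible n 6 P" "n \<ge> 4"
  shows "cost (cube n) P \<ge> real n ^ 2 + real n + 6 \<or>
    (\<exists>i K l L F. block_slab_column (real n) (cube n) P i K l L F)"
  by (rule cost_six) (use admissible_tiling[OF assms(1)] assms side_cube in auto)

section \<open>Symmetries\<close>

text \<open>A signed permutation of the coordinates: the \<open>m\<close>-th coordinate of the image is the \<open>p m\<close>-th
  coordinate of the argument, reflected at the centre of the cube if \<open>s m\<close> holds.\<close>

definition signed_perm :: "nat \<Rightarrow> (3 \<Rightarrow> bool) \<Rightarrow> (3 \<Rightarrow> 3) \<Rightarrow> real ^ 3 \<Rightarrow> real ^ 3" where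
  "signed_perm n s p x = (\<chi> m. if s m then real n - x $ p m else x $ p m)"

lemma signed_perm_nth: "signed_perm n s p x $ m = (if s m then real n - x $ p m else x $ p m)"
  by (simp add: signed_perm_def)

lemma signed_perm_inverse:
  assumes "bij p"
  shows "signed_perm n s p (signed_perm n (s \<circ> inv p) (inv p) y) = y"
    and "signed_perm n (s \<circ> inv p) (inv p) (signed_perm n s p x) = x"
  unfolding vec_eq_iff signed_perm_nth using assms
  by (auto simp: bij_is_inj bij_is_surj inv_f_f surj_f_inv_f)

lemma signed_perm_image:
  assumes "bij p" "\<And>x. x \<in> S \<longleftrightarrow> signed_perm n s p x \<in> S'"
  shows "signed_perm n s p ` S = S'"
proof
  show "signed_perm n s p ` S \<subseteq> S'" using assms(2) by auto
  show "S' \<subseteq> signed_perm n s p ` S"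
  proof
    fix y assume y: "y \<in> S'"
    let ?x = "signed_perm n (s \<circ> inv p) (inv p) y"
    have eq: "signed_perm n s p ?x = y" by (rule signed_perm_inverse(1)[OF assms(1)])
    then have "?x \<in> S" using assms(2)[of ?x] y by simp
    then show "y \<in> signed_perm n s p ` S" using eq by (metis image_eqI)
  qed
qed

lemma all_bij: "bij p \<Longrightarrow> (\<forall>m. Q (p m)) \<longleftrightarrow> (\<forall>m. Q m)"
  by (metis bij_pointE)

lemma signed_perm_cube: "bij p \<Longrightarrow> signed_perm n s p ` cube n = cube n"
proof (rule signed_perm_image)
  fix x assume p: "bij p"
  have "signed_perm n s p x \<in> cube n \<longleftrightarrow> (\<forall>m. 0 \<le> x $ p m \<and> x $ p m \<le> real n)"
    unfolding mem_cube signed_perm_nth by (intro all_cong1) auto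
  also have "\<dots> \<longleftrightarrow> x \<in> cube n" unfolding mem_cube by (rule all_bij[OF p])
  finally show "x \<in> cube n \<longleftrightarrow> signed_perm n s p x \<in> cube n" ..
qed

lemma signed_perm_dist:
  assumes "bij p"
  shows "dist (signed_perm n s p x) (signed_perm n s p y) = dist x y"
proof -
  have "(\<Sum>m\<in>UNIV. (dist (signed_perm n s p x $ m) (signed_perm n s p y $ m))\<^sup>2)
      = (\<Sum>m\<in>UNIV. (dist (x $ p m) (y $ p m))\<^sup>2)"
    by (rule sum.cong) (auto simp: signed_perm_nth dist_real_def power2_eq_square algebra_simps)
  also have "\<dots> = (\<Sum>m\<in>UNIV. (dist (x $ m) (y $ m))\<^sup>2)"
    using assms by (rule sum.reindex_bij_betw)
  finally show ?thesis unfolding dist_vec_def L2_set_def by simp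
qed

lemma signed_perm_symmetry: "bij p \<Longrightarrow> cube_symmetry n (signed_perm n s p)"
  unfolding cube_symmetry_def using signed_perm_dist signed_perm_cube by blast

lemma signed_perm_cbox:
  fixes n s p a b
  defines "a' \<equiv> (\<chi> m. if s m then real n - b $ p m else a $ p m)"
    and "b' \<equiv> (\<chi> m. if s m then real n - a $ p m else b $ p m)"
  assumes p: "bij p"
  shows "signed_perm n s p ` cbox a b = cbox a' b'" "signed_perm n s p ` box a b = box a' b'"
proof -
  show "signed_perm n s p ` cbox a b = cbox a' b'"
  proof (rule signed_perm_image[OF p])
    fix x
    have "signed_perm n s p x \<in> cbox a' b' \<longleftrightarrow> (\<forall>m. a $ p m \<le> x $ p m \<and> x $ p m \<le> b $ p m)"
      unfolding mem_box_cart signed_perm_nth a'_def b'_def by (intro all_cong1) auto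
    also have "\<dots> \<longleftrightarrow> x \<in> cbox a b" unfolding mem_box_cart by (rule all_bij[OF p])
    finally show "x \<in> cbox a b \<longleftrightarrow> signed_perm n s p x \<in> cbox a' b'" ..
  qed
  show "signed_perm n s p ` box a b = box a' b'"
  proof (rule signed_perm_image[OF p])
    fix x
    have "signed_perm n s p x \<in> box a' b' \<longleftrightarrow> (\<forall>m. a $ p m < x $ p m \<and> x $ p m < b $ p m)"
      unfolding mem_box_cart signed_perm_nth a'_def b'_def by (intro all_cong1) auto
    also have "\<dots> \<longleftrightarrow> x \<in> box a b" unfolding mem_box_cart by (rule all_bij[OF p])
    finally show "x \<in> box a b \<longleftrightarrow> signed_perm n s p x \<in> box a' b'" ..
  qed
qed

lemma signed_perm_interior:
  assumes "bij p"
  shows "interior (signed_perm n s p ` cbox a b) = signed_perm n s p ` interior (cbox a b)"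
  unfolding signed_perm_cbox[OF assms] interior_cbox ..

lemma signed_perm_dims:
  assumes p: "bij p" and ne: "cbox a b \<noteq> {}"
  shows "dims (signed_perm n s p ` cbox a b) = dims (cbox a b)"
proof -
  have ne': "signed_perm n s p ` cbox a b \<noteq> {}" using ne by simp
  have s: "side (signed_perm n s p ` cbox a b) m = side (cbox a b) (p m)" for m
    unfolding side_cbox[OF ne] signed_perm_cbox(1)[OF p]
    by (subst side_cbox) (use ne' signed_perm_cbox(1)[OF p] in auto)
  have "axes (p 1) (p 2) (p 3)"
    unfolding axes_def inj_eq[OF bij_is_inj[OF p]] by simp
  then have "dims (cbox a b) = {# side (cbox a b) (p 1), side (cbox a b) (p 2), side (cbox a b) (p 3) #}"
    by (rule dims_axes)
  then show ?thesis unfolding dims_def[of "signed_perm n s p ` cbox a b"] s by simp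
qed

lemma signed_perm_inj: "bij p \<Longrightarrow> inj (signed_perm n s p)"
  by (rule inj_on_inverseI[where g = "signed_perm n (s \<circ> inv p) (inv p)"]) (rule signed_perm_inverse(2))

lemma signed_perm_division:
  assumes p: "bij p" and C: "C division_of cbox a b"
  shows "(`) (signed_perm n s p) ` C division_of signed_perm n s p ` cbox a b"
proof (rule division_ofI)
  let ?g = "signed_perm n s p"
  show "finite ((`) ?g ` C)" using C by blast
  show "K \<subseteq> ?g ` cbox a b" if "K \<in> (`) ?g ` C" for K using that division_ofD(2)[OF C] by auto
  show "K \<noteq> {}" if "K \<in> (`) ?g ` C" for K using that division_ofD(3)[OF C] by auto
  show "\<exists>c d. K = cbox c d" if "K \<in> (`) ?g ` C" for K
    using that division_ofD(4)[OF C] signed_perm_cbox(1)[OF p] by (metis (no_types, lifting) imageE)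
  show "interior K \<inter> interior L = {}" if KL: "K \<in> (`) ?g ` C" "L \<in> (`) ?g ` C" "K \<noteq> L" for K L
  proof -
    obtain K' L' where K': "K = ?g ` K'" "L = ?g ` L'" "K' \<in> C" "L' \<in> C" using KL by blast
    then have "K' \<noteq> L'" using KL(3) by blast
    then have d: "interior K' \<inter> interior L' = {}" using division_ofD(5)[OF C] K' by blast
    have i: "interior (?g ` M) = ?g ` interior M" if "M \<in> C" for M
      using division_ofD(4)[OF C that] signed_perm_interior[OF p] by metis
    show ?thesis unfolding K' i[OF K'(3)] i[OF K'(4)]
      using d image_Int[OF signed_perm_inj[OF p]] by (metis image_empty)
  qed
  show "\<Union>((`) ?g ` C) = ?g ` cbox a b" using division_ofD(6)[OF C] by blast
qed

text \<open>The block, the slab and the column in coordinates. The flags \<open>s\<close> and \<open>t\<close> tell whether the block and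
  the slab, respectively, are at the lower end.\<close>

lemma column_images:
  assumes str: "block_slab_column (real n) (cube n) P i K l L F" and n: "n \<ge> 3"
  obtains s t where
    "K = {x \<in> cube n. if s then x $ i \<le> real n - 1 else 1 \<le> x $ i}"
    "L = {x \<in> cube n. (if s then real n - 1 \<le> x $ i else x $ i \<le> 1) \<and> (if t then x $ l \<le> real n - 1 else 1 \<le> x $ l)}"
    "F = {x \<in> cube n. (if s then real n - 1 \<le> x $ i else x $ i \<le> 1) \<and> (if t then real n - 1 \<le> x $ l else x $ l \<le> 1)}"
proof -
  obtain E where E: "end_cut (cube n) i K E" "end_cut E l L F" "\<And>j. side E j = (if j = i then 1 else real n)"
    and s: "l \<noteq> i" "side K i = real n - 1" "side L l = real n - 1"
    using str unfolding block_slab_column_def by auto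
  obtain s where KE: "K = {x \<in> cube n. if s then x $ i \<le> real n - 1 else 1 \<le> x $ i}"
    "E = {x \<in> cube n. if s then real n - 1 \<le> x $ i else x $ i \<le> 1}"
  proof -
    have "K = cube n \<inter> {x. x $ i \<le> real n - 1} \<and> E = cube n \<inter> {x. real n - 1 \<le> x $ i}
        \<or> K = cube n \<inter> {x. 1 \<le> x $ i} \<and> E = cube n \<inter> {x. x $ i \<le> 1}"
      using E(1) unfolding end_cut_def lo_cube hi_cube s(2) by simp
    then show thesis
    proof
      assume "K = cube n \<inter> {x. x $ i \<le> real n - 1} \<and> E = cube n \<inter> {x. real n - 1 \<le> x $ i}"
      then show thesis by (intro that[of True]) auto
    next
      assume "K = cube n \<inter> {x. 1 \<le> x $ i} \<and> E = cube n \<inter> {x. x $ i \<le> 1}"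
      then show thesis by (intro that[of False]) auto
    qed
  qed
  define u v :: "real ^ 3" where "u = (\<chi> j. if j = i \<and> s then real n - 1 else 0)"
    and "v = (\<chi> j. if j = i \<and> \<not> s then 1 else real n)"
  have "x \<in> E \<longleftrightarrow> x \<in> cbox u v" for x
  proof -
    have "u $ j \<le> x $ j \<and> x $ j \<le> v $ j \<longleftrightarrow> (0 \<le> x $ j \<and> x $ j \<le> real n) \<and>
        (j = i \<longrightarrow> (if s then real n - 1 \<le> x $ i else x $ i \<le> 1))" for j
      using n by (cases "j = i") (auto simp: u_def v_def)
    then have "x \<in> cbox u v \<longleftrightarrow> x \<in> cube n \<and> (if s then real n - 1 \<le> x $ i else x $ i \<le> 1)"
      unfolding mem_box_cart mem_cube by simp metis
    then show ?thesis unfolding KE(2) by simp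
  qed
  then have Euv: "E = cbox u v" by blast
  have "cbox u v \<noteq> {}" unfolding cbox_ne_cart u_def v_def using n by auto
  then have lh: "lo E $ l = 0" "hi E $ l = real n"
    unfolding Euv using lo_cbox hi_cbox s(1) by (auto simp: u_def v_def)
  obtain t where LF: "L = E \<inter> {x. if t then x $ l \<le> real n - 1 else 1 \<le> x $ l}"
    "F = E \<inter> {x. if t then real n - 1 \<le> x $ l else x $ l \<le> 1}"
  proof -
    have "L = E \<inter> {x. x $ l \<le> real n - 1} \<and> F = E \<inter> {x. real n - 1 \<le> x $ l}
        \<or> L = E \<inter> {x. 1 \<le> x $ l} \<and> F = E \<inter> {x. x $ l \<le> 1}"
      using E(2) unfolding end_cut_def lh s(3) by simp
    then show thesis
    proof
      assume "L = E \<inter> {x. x $ l \<le> real n - 1} \<and> F = E \<inter> {x. real n - 1 \<le> x $ l}"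
      then show thesis by (intro that[of True]) auto
    next
      assume "L = E \<inter> {x. 1 \<le> x $ l} \<and> F = E \<inter> {x. x $ l \<le> 1}"
      then show thesis by (intro that[of False]) auto
    qed
  qed
  show thesis
    by (rule that[of s t]) (use KE LF in auto)
qed

text \<open>The signed permutation that matches the distinguished directions \<open>i\<close>, \<open>l\<close> of both dissections, and
  reflects those in which the blocks or the slabs are at opposite ends, maps block to block, slab
  to slab and column to column. The sticks then agree up to their order.\<close>

lemma same_lengths_symmetric:
  assumes P: "block_slab_column (real n) (cube n) P i K l L F"
    and Q: "block_slab_column (real n) (cube n) Q i' K' l' L' F'"
    and len: "image_mset dims (mset_set (P - {K} - {L})) = image_mset dims (mset_set (Q - {K'} - {L'}))"
    and n: "n \<ge> 3"
  shows "same_up_to_symmetry n P Q"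
proof -
  obtain s t where KLF:
    "K = {x \<in> cube n. if s then x $ i \<le> real n - 1 else 1 \<le> x $ i}"
    "L = {x \<in> cube n. (if s then real n - 1 \<le> x $ i else x $ i \<le> 1) \<and> (if t then x $ l \<le> real n - 1 else 1 \<le> x $ l)}"
    "F = {x \<in> cube n. (if s then real n - 1 \<le> x $ i else x $ i \<le> 1) \<and> (if t then real n - 1 \<le> x $ l else x $ l \<le> 1)}"
    by (rule column_images[OF P n])
  obtain s' t' where KLF':
    "K' = {x \<in> cube n. if s' then x $ i' \<le> real n - 1 else 1 \<le> x $ i'}"
    "L' = {x \<in> cube n. (if s' then real n - 1 \<le> x $ i' else x $ i' \<le> 1) \<and> (if t' then x $ l' \<le> real n - 1 else 1 \<le> x $ l')}"
    "F' = {x \<in> cube n. (if s' then real n - 1 \<le> x $ i' else x $ i' \<le> 1) \<and> (if t' then real n - 1 \<le> x $ l' else x $ l' \<le> 1)}"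
    by (rule column_images[OF Q n])
  have str: "K \<in> P" "L \<in> P" "l \<noteq> i" "tiling F (P - {K} - {L})" "\<And>j. side F j = (if j = i \<or> j = l then 1 else real n)"
    and str': "K' \<in> Q" "L' \<in> Q" "l' \<noteq> i'" "tiling F' (Q - {K'} - {L'})"
      "\<And>j. side F' j = (if j = i' \<or> j = l' then 1 else real n)"
    using P Q unfolding block_slab_column_def by auto
  obtain k where ax: "axes i l k" using axes_third str(3) by metis
  obtain k' where ax': "axes i' l' k'" using axes_third str'(3) by metis
  define p where "p m = (if m = i' then i else if m = l' then l else k)" for m :: 3
  define f where "f m = (if m = i' then s \<noteq> s' else if m = l' then t \<noteq> t' else False)" for m :: 3
  have "inj p"
  proof (rule injI)
    fix m m' assume "p m = p m'"
    then show "m = m'"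
      using ax axes_ex_cases[OF ax', of m] axes_ex_cases[OF ax', of m']
      unfolding p_def axes_def by (auto split: if_splits)
  qed
  then have p: "bij p" by (simp add: bij_def finite_UNIV_inj_surj)
  define g where "g = signed_perm n f p"
  have cube: "g x \<in> cube n \<longleftrightarrow> x \<in> cube n" for x
    using signed_perm_cube[OF p, of n f] signed_perm_inj[OF p, of n f] unfolding g_def
    by (metis inj_image_mem_iff)
  have gi: "g x $ i' = (if s \<noteq> s' then real n - x $ i else x $ i)" for x
    unfolding g_def signed_perm_nth by (simp add: p_def f_def)
  have gl: "g x $ l' = (if t \<noteq> t' then real n - x $ l else x $ l)" for x
    unfolding g_def signed_perm_nth using str'(3) by (simp add: p_def f_def)
  have img: "g ` S = S'" if "\<And>x. x \<in> S \<longleftrightarrow> g x \<in> S'" for S S'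
    unfolding g_def by (rule signed_perm_image[OF p]) (use that in \<open>simp add: g_def\<close>)
  have cond: "(if s' then g x $ i' \<le> real n - 1 else 1 \<le> g x $ i')
        \<longleftrightarrow> (if s then x $ i \<le> real n - 1 else 1 \<le> x $ i)"
      "(if s' then real n - 1 \<le> g x $ i' else g x $ i' \<le> 1)
        \<longleftrightarrow> (if s then real n - 1 \<le> x $ i else x $ i \<le> 1)"
      "(if t' then g x $ l' \<le> real n - 1 else 1 \<le> g x $ l')
        \<longleftrightarrow> (if t then x $ l \<le> real n - 1 else 1 \<le> x $ l)"
      "(if t' then real n - 1 \<le> g x $ l' else g x $ l' \<le> 1)
        \<longleftrightarrow> (if t then real n - 1 \<le> x $ l else x $ l \<le> 1)" for x
    unfolding gi gl by auto
  have gK: "g ` K = K'" and gL: "g ` L = L'" and gF: "g ` F = F'"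
    unfolding KLF KLF' by (rule img; unfold mem_Collect_eq cube cond; rule refl)+
  define C where "C = P - {K} - {L}"
  define D where "D = Q - {K'} - {L'}"
  have tC: "tiling F C" and tD: "tiling F' D" using str(4) str'(4) by (simp_all add: C_def D_def)
  obtain a b where F: "F = cbox a b" and Cdiv: "C division_of cbox a b"
    using tC unfolding tiling_def tiled_def by blast
  obtain a' b' where F': "F' = cbox a' b'" and Ddiv: "D division_of cbox a' b'"
    using tD unfolding tiling_def tiled_def by blast
  have gC: "(`) g ` C division_of cbox a' b'"
    using signed_perm_division[OF p Cdiv, of n f] gF unfolding F F' g_def by simp
  have "inj g" unfolding g_def by (rule signed_perm_inj[OF p])
  then have inj: "inj ((`) g)" by (intro injI) (simp add: inj_image_eq_iff)
  have dg: "dims (g ` M) = dims M" if M: "M \<in> C" for M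
  proof -
    obtain c d where "M = cbox c d" "M \<noteq> {}" using division_ofD(3,4)[OF Cdiv M] by metis
    then show ?thesis using signed_perm_dims[OF p] unfolding g_def by blast
  qed
  have "image_mset dims (mset_set ((`) g ` C)) = image_mset dims (image_mset ((`) g) (mset_set C))"
    by (simp only: image_mset_mset_set[OF inj_on_subset[OF inj subset_UNIV]])
  also have "\<dots> = image_mset dims (mset_set C)"
    unfolding image_mset.compositionality
    by (rule image_mset_cong) (simp add: dg tiling_facts(1)[OF tC])
  also have "\<dots> = image_mset dims (mset_set D)" using len by (simp add: C_def D_def)
  finally have m: "image_mset dims (mset_set ((`) g ` C)) = image_mset dims (mset_set D)" .
  have "k' \<noteq> i'" "k' \<noteq> l'" using ax' unfolding axes_def by auto
  then have "dims F' = {# 1, 1, real n #}" unfolding dims_axes[OF ax'] str'(5) by simp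
  then have col: "reordered_column n ((`) g ` C) D"
    unfolding reordered_column_def using gC Ddiv m F' by blast
  have "(`) g ` P - (`) g ` C = (`) g ` (P - C)" using inj by (simp add: image_set_diff)
  also have "P - C = {K, L}" using str(1,2) by (auto simp: C_def)
  also have "(`) g ` {K, L} = {K', L'}" using gK gL by simp
  also have "\<dots> = Q - D" using str'(1,2) by (auto simp: D_def)
  finally have "(`) g ` P - (`) g ` C = Q - D" .
  moreover have "(`) g ` C \<subseteq> (`) g ` P" "D \<subseteq> Q" by (auto simp: C_def D_def)
  moreover have "cube_symmetry n g" unfolding g_def by (rule signed_perm_symmetry[OF p])
  ultimately show ?thesis unfolding same_up_to_symmetry_def using col by blast
qed

text \<open>A cube symmetry in the sense of \<open>cube_symmetry\<close> is any isometry, so the invariance of the volume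
  goes through the decomposition into a translation and an orthogonal map.\<close>

lemma isometry_measure:
  fixes g :: "real ^ 3 \<Rightarrow> real ^ 3"
  assumes g: "\<And>x y. dist (g x) (g y) = dist x y" and S: "S \<in> lmeasurable"
  shows "measure lebesgue (g ` S) = measure lebesgue S"
proof -
  define f where "f x = g x - g 0" for x
  have f: "orthogonal_transformation f"
    unfolding orthogonal_transformation_isometry f_def using g by (simp add: dist_norm)
  have "g ` S = (+) (g 0) ` f ` S" by (simp add: f_def image_image)
  then show ?thesis by (simp only: measure_translation measure_orthogonal_image[OF f S])
qed

lemma vol_measure:
  assumes "K = cbox a b" "K \<noteq> {}"
  shows "measure lebesgue K = vol K"
proof -
  have "\<And>j. a $ j \<le> b $ j" using assms cbox_ne_cart by blast
  then have "measure lborel K = vol K"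
    unfolding vol_def assms(1) content_cbox_prod
    using assms side_cbox[of a b] by (intro prod.cong) (auto simp: max_def)
  then show ?thesis using assms by simp
qed

lemma symmetric_same_volumes:
  assumes P: "admissible n k P" and Q: "admissible n k Q" and same: "same_up_to_symmetry n P Q"
  shows "vol ` P = vol ` Q"
proof -
  obtain g C D where g: "cube_symmetry n g" and C: "C \<subseteq> (`) g ` P" and D: "D \<subseteq> Q"
    and eq: "(`) g ` P - C = Q - D" and col: "reordered_column n C D"
    using same unfolding same_up_to_symmetry_def by (elim exE conjE) (rule that)
  obtain a b where div: "C division_of cbox a b" "D division_of cbox a b"
    and ms: "image_mset dims (mset_set C) = image_mset dims (mset_set D)"
    using col unfolding reordered_column_def by (elim exE conjE) (rule that)
  have divP: "P division_of cube n" "Q division_of cube n"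
    using P Q unfolding admissible_def by auto
  have vm: "measure lebesgue K = vol K" if X: "X division_of S" "K \<in> X" for K S and X :: "(real ^ 3) set set"
  proof -
    obtain c d where "K = cbox c d" using division_ofD(4)[OF X] by blast
    then show ?thesis by (rule vol_measure) (rule division_ofD(3)[OF X])
  qed
  have "dims ` C = dims ` D"
  proof -
    have "finite C" "finite D" using div by blast+
    then show ?thesis using arg_cong[OF ms, of set_mset] by simp
  qed
  have sub: "vol ` X \<subseteq> vol ` Y" if "dims ` X = dims ` Y" for X Y
  proof
    fix v assume "v \<in> vol ` X"
    then obtain K where K: "K \<in> X" "v = vol K" by blast
    then have "dims K \<in> dims ` Y" using that by blast
    then obtain K' where "K' \<in> Y" "dims K = dims K'" by blast
    then show "v \<in> vol ` Y" using K(2) vol_eq_dims[of K K'] by blast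
  qed
  have "vol ` C = vol ` D" using sub \<open>dims ` C = dims ` D\<close> by (metis subset_antisym)
  moreover have mv: "measure lebesgue ` X = vol ` X" if "X division_of S" for X S
    by (rule image_cong[OF refl]) (rule vm[OF that])
  ultimately have mCD: "measure lebesgue ` C = measure lebesgue ` D"
    unfolding mv[OF div(1)] mv[OF div(2)] by blast
  have meas: "measure lebesgue (g ` K) = measure lebesgue K" if K: "K \<in> P" for K
  proof (rule isometry_measure)
    show "dist (g x) (g y) = dist x y" for x y using g unfolding cube_symmetry_def by blast
    obtain c d where "K = cbox c d" using division_ofD(4)[OF divP(1) K] by blast
    then show "K \<in> lmeasurable" by simp
  qed
  have "vol ` P = measure lebesgue ` P" by (rule mv[OF divP(1), symmetric])
  also have "\<dots> = measure lebesgue ` (`) g ` P"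
    unfolding image_image by (rule image_cong[OF refl]) (rule meas[symmetric])
  also have "\<dots> = measure lebesgue ` C \<union> measure lebesgue ` ((`) g ` P - C)"
    using C by (simp add: image_Un[symmetric] Un_absorb1)
  also have "\<dots> = measure lebesgue ` D \<union> measure lebesgue ` (Q - D)" unfolding mCD eq ..
  also have "\<dots> = measure lebesgue ` Q" using D by (simp add: image_Un[symmetric] Un_absorb1)
  also have "\<dots> = vol ` Q" by (rule mv[OF divP(2)])
  finally show ?thesis .
qed

section \<open>Constructions\<close>

text \<open>A box given by its three coordinate intervals. Dissections are assembled from bricks by the three
  splitting lemmas below.\<close>

definition brick :: "real \<Rightarrow> real \<Rightarrow> real \<Rightarrow> real \<Rightarrow> real \<Rightarrow> real \<Rightarrow> (real ^ 3) set" where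
  "brick x x' y y' z z' = cbox (vector [x, y, z]) (vector [x', y', z'])"

lemma mem_brick:
  "p \<in> brick x x' y y' z z' \<longleftrightarrow> x \<le> p $ 1 \<and> p $ 1 \<le> x' \<and> y \<le> p $ 2 \<and> p $ 2 \<le> y' \<and> z \<le> p $ 3 \<and> p $ 3 \<le> z'"
  unfolding brick_def mem_box_cart forall_3 vector_3 by blast

lemma mem_interior_brick:
  "p \<in> interior (brick x x' y y' z z') \<longleftrightarrow> x < p $ 1 \<and> p $ 1 < x' \<and> y < p $ 2 \<and> p $ 2 < y' \<and> z < p $ 3 \<and> p $ 3 < z'"
  unfolding brick_def interior_cbox mem_box_cart forall_3 vector_3 by blast

lemma brick_ne: "x \<le> x' \<Longrightarrow> y \<le> y' \<Longrightarrow> z \<le> z' \<Longrightarrow> brick x x' y y' z z' \<noteq> {}"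
  unfolding brick_def cbox_ne_cart forall_3 vector_3 by blast

lemma side_brick:
  assumes "x \<le> x'" "y \<le> y'" "z \<le> z'"
  shows "side (brick x x' y y' z z') 1 = x' - x" "side (brick x x' y y' z z') 2 = y' - y"
    "side (brick x x' y y' z z') 3 = z' - z"
  using side_cbox[OF brick_ne[OF assms, unfolded brick_def]] unfolding brick_def by (simp_all add: vector_3)

lemma dims_brick:
  "x \<le> x' \<Longrightarrow> y \<le> y' \<Longrightarrow> z \<le> z' \<Longrightarrow> dims (brick x x' y y' z z') = {# x' - x, y' - y, z' - z #}"
  unfolding dims_def side_brick ..

lemma vol_brick:
  "x \<le> x' \<Longrightarrow> y \<le> y' \<Longrightarrow> z \<le> z' \<Longrightarrow> vol (brick x x' y y' z z') = (x' - x) * (y' - y) * (z' - z)"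
  by (rule vol_dims) (rule dims_brick)

lemma cube_brick: "cube n = brick 0 (real n) 0 (real n) 0 (real n)"
  by (rule set_eqI) (auto simp: mem_cube mem_brick forall_3)

lemma brick_self: "x \<le> x' \<Longrightarrow> y \<le> y' \<Longrightarrow> z \<le> z' \<Longrightarrow> {brick x x' y y' z z'} division_of brick x x' y y' z z'"
  using brick_ne unfolding brick_def by blast

lemma brick_split_x:
  assumes "x \<le> x'" "x' \<le> x''" "P division_of brick x x' y y' z z'" "Q division_of brick x' x'' y y' z z'"
  shows "P \<union> Q division_of brick x x'' y y' z z'"
proof -
  have "brick x x'' y y' z z' = brick x x' y y' z z' \<union> brick x' x'' y y' z z'"
    using assms(1,2) by (auto simp: mem_brick)
  moreover have "interior (brick x x' y y' z z') \<inter> interior (brick x' x'' y y' z z') = {}"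
    by (auto simp: mem_interior_brick)
  ultimately show ?thesis using division_disjoint_union[OF assms(3,4)] by simp
qed

lemma brick_split_y:
  assumes "y \<le> y'" "y' \<le> y''" "P division_of brick x x' y y' z z'" "Q division_of brick x x' y' y'' z z'"
  shows "P \<union> Q division_of brick x x' y y'' z z'"
proof -
  have "brick x x' y y'' z z' = brick x x' y y' z z' \<union> brick x x' y' y'' z z'"
    using assms(1,2) by (auto simp: mem_brick)
  moreover have "interior (brick x x' y y' z z') \<inter> interior (brick x x' y' y'' z z') = {}"
    by (auto simp: mem_interior_brick)
  ultimately show ?thesis using division_disjoint_union[OF assms(3,4)] by simp
qed

lemma brick_split_z:
  assumes "z \<le> z'" "z' \<le> z''" "P division_of brick x x' y y' z z'" "Q division_of brick x x' y y' z' z''"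
  shows "P \<union> Q division_of brick x x' y y' z z''"
proof -
  have "brick x x' y y' z z'' = brick x x' y y' z z' \<union> brick x x' y y' z' z''"
    using assms(1,2) by (auto simp: mem_brick)
  moreover have "interior (brick x x' y y' z z') \<inter> interior (brick x x' y y' z' z'') = {}"
    by (auto simp: mem_interior_brick)
  ultimately show ?thesis using division_disjoint_union[OF assms(3,4)] by simp
qed

lemma triple_rotate: "{# x, y, z #} = {# y, z, x #}"
  by (metis add_mset_commute)

lemma triple_reverse: "{# x, y, z #} = {# z, y, x #}"
  by (metis add_mset_commute)

lemma sticks_exist:
  assumes L: "L \<in> four_distinct_parts n"
  shows "\<exists>P. sticks n L P"
proof -
  note Lf = four_partsD[OF L]
  obtain a b c d where abcd: "L = {a, b, c, d}" "a \<noteq> b" "a \<noteq> c" "a \<noteq> d" "b \<noteq> c" "b \<noteq> d" "c \<noteq> d"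
    using Lf(2) by (auto simp: card_Suc_eq numeral_eq_Suc)
  have "n = a + b + c + d" using Lf(4) abcd by simp
  then have n: "real n = real a + real b + real c + real d" by simp
  have n1: "real n \<ge> 1" using four_parts_ge_10[OF L] by simp
  define A where "A = brick 0 (real a) (real n - 1) (real n) (real n - 1) (real n)"
  define B where "B = brick (real a) (real a + real b) (real n - 1) (real n) (real n - 1) (real n)"
  define G where "G = brick (real a + real b) (real a + real b + real c) (real n - 1) (real n) (real n - 1) (real n)"
  define H where "H = brick (real a + real b + real c) (real n) (real n - 1) (real n) (real n - 1) (real n)"
  define S where "S = brick 0 (real n) 0 (real n - 1) (real n - 1) (real n)"
  define K where "K = brick 0 (real n) 0 (real n) 0 (real n - 1)"
  define C where "C = {A} \<union> ({B} \<union> ({G} \<union> {H}))"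
  have col: "dims (brick x x' (real n - 1) (real n) (real n - 1) (real n)) = {# 1, 1, x' - x #}"
    if "x \<le> x'" for x x'
    using that triple_rotate[of "x' - x" 1 1] by (simp add: dims_brick)
  have dA: "dims A = {# 1, 1, real a #}" and dB: "dims B = {# 1, 1, real b #}"
    and dG: "dims G = {# 1, 1, real c #}" and dH: "dims H = {# 1, 1, real d #}"
    unfolding A_def B_def G_def H_def by (subst col; simp add: n)+
  have C: "C division_of brick 0 (real n) (real n - 1) (real n) (real n - 1) (real n)"
    unfolding C_def A_def B_def G_def H_def
    by (insert n n1,
        rule brick_split_x[where x' = "real a"], simp, simp,
        rule brick_self, simp, simp, simp,
        rule brick_split_x[where x' = "real a + real b"], simp, simp,
        rule brick_self, simp, simp, simp,
        rule brick_split_x[where x' = "real a + real b + real c"], simp, simp,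
        rule brick_self, simp, simp, simp,
        rule brick_self, simp, simp, simp)
  have div: "({K} \<union> ({S} \<union> C)) division_of cube n"
    unfolding cube_brick
  proof (rule brick_split_z)
    show "{K} division_of brick 0 (real n) 0 (real n) 0 (real n - 1)"
      unfolding K_def by (rule brick_self) (use n1 in auto)
    show "{S} \<union> C division_of brick 0 (real n) 0 (real n) (real n - 1) (real n)"
      by (rule brick_split_y[OF _ _ _ C]) (use n1 in \<open>auto simp: S_def intro!: brick_self\<close>)
  qed (use n1 in auto)
  have "dims K = {# real n, real n, real n - 1 #}" "dims S = {# real n, real n - 1, 1 #}"
    unfolding K_def S_def using n1 by (simp_all add: dims_brick)
  then have dK: "dims K = {# real n - 1, real n, real n #}" and dS: "dims S = {# 1, real n - 1, real n #}"
    by (simp_all only: triple_reverse)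
  have "inj_on dims C"
    unfolding C_def inj_on_def using abcd(2-7) dA dB dG dH by auto
  moreover have "dims ` C = (\<lambda>l. {# 1, 1, real l #}) ` L"
    unfolding C_def abcd(1) by (simp add: dA dB dG dH) blast
  ultimately have "bij_betw dims C ((\<lambda>l. {# 1, 1, real l #}) ` L)"
    unfolding bij_betw_def by simp
  moreover have "dims (brick 0 (real n) (real n - 1) (real n) (real n - 1) (real n)) = {# 1, 1, real n #}"
    using col[of 0 "real n"] by simp
  ultimately have cut: "cut_column n L C"
    unfolding cut_column_def using C[unfolded brick_def] unfolding brick_def by blast
  have "sticks n L ({K} \<union> ({S} \<union> C))"
    unfolding sticks_def
  proof (intro conjI exI)
    show "{K} \<union> ({S} \<union> C) = {K, S} \<union> C" by blast
  qed (fact div dK dS cut)+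
  then show ?thesis ..
qed

lemma admissible_bricks:
  assumes "set Ks division_of cube n" "distinct (map vol Ks)"
    "\<And>K i. K \<in> set Ks \<Longrightarrow> side K i \<in> \<nat> \<and> side K i > 0"
  shows "admissible n (length Ks) (set Ks)" "total_surface (set Ks) = sum_list (map surface_area Ks)"
proof -
  have d: "distinct Ks" "inj_on vol (set Ks)" using assms(2) by (auto simp: distinct_map)
  have "inj_on dims (set Ks)"
    by (rule inj_onI) (use d(2) vol_eq_dims in \<open>auto dest: inj_onD\<close>)
  then show "admissible n (length Ks) (set Ks)"
    unfolding admissible_def using assms d(1) by (simp add: distinct_card)
  show "total_surface (set Ks) = sum_list (map surface_area Ks)"
    unfolding total_surface_def using d(1) by (simp add: sum_list_distinct_conv_sum_set)
qed

text \<open>All sides are positive integers.\<close>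

definition nat_brick :: "(real ^ 3) set \<Rightarrow> bool" where
  "nat_brick K \<longleftrightarrow> (\<forall>i. side K i \<in> \<nat> \<and> side K i > 0)"

lemma nat_brick_brick:
  "x < x' \<Longrightarrow> y < y' \<Longrightarrow> z < z' \<Longrightarrow> x' - x \<in> \<nat> \<Longrightarrow> y' - y \<in> \<nat> \<Longrightarrow> z' - z \<in> \<nat> \<Longrightarrow> nat_brick (brick x x' y y' z z')"
  unfolding nat_brick_def forall_3 by (simp add: side_brick)

lemma surface_brick:
  "x \<le> x' \<Longrightarrow> y \<le> y' \<Longrightarrow> z \<le> z' \<Longrightarrow> surface_area (brick x x' y y' z z') =
    2 * ((x' - x) * (y' - y) + (y' - y) * (z' - z) + (z' - z) * (x' - x))"
  unfolding surface_area_def by (simp add: side_brick)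

text \<open>The three dissections below have pieces of pairwise distinct volumes.\<close>

lemma example_three: "\<exists>P. admissible 3 6 P \<and> total_surface P = 100"
proof -
  define Ks where "Ks = [brick 0 3 0 3 0 1, brick 0 2 0 2 1 3, brick 0 2 2 3 1 3,
     brick 2 3 0 3 1 2, brick 2 3 0 1 2 3, brick 2 3 1 3 2 3]"
  have "{brick 0 3 0 3 0 1} \<union> (({brick 0 2 0 2 1 3} \<union> {brick 0 2 2 3 1 3}) \<union>
     ({brick 2 3 0 3 1 2} \<union> ({brick 2 3 0 1 2 3} \<union> {brick 2 3 1 3 2 3}))) division_of brick 0 3 0 3 0 3"
    by (rule brick_split_z[where z' = "1"], simp, simp,
        rule brick_self, simp, simp, simp,
        rule brick_split_x[where x' = "2"], simp, simp,
        rule brick_split_y[where y' = "2"], simp, simp,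
        rule brick_self, simp, simp, simp,
        rule brick_self, simp, simp, simp,
        rule brick_split_z[where z' = "2"], simp, simp,
        rule brick_self, simp, simp, simp,
        rule brick_split_y[where y' = "1"], simp, simp,
        rule brick_self, simp, simp, simp,
        rule brick_self, simp, simp, simp)
  then have div: "set Ks division_of cube 3" unfolding cube_brick Ks_def by (simp add: insert_commute)
  have "distinct (map vol Ks)" by (simp add: Ks_def vol_brick)
  moreover have "\<forall>K\<in>set Ks. nat_brick K" by (simp add: Ks_def nat_brick_brick)
  ultimately have "admissible 3 (length Ks) (set Ks)" "total_surface (set Ks) = sum_list (map surface_area Ks)"
    using admissible_bricks[OF div] unfolding nat_brick_def by blast+
  moreover have "length Ks = 6" "sum_list (map surface_area Ks) = 100"
    by (simp_all add: Ks_def surface_brick)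
  ultimately show ?thesis by metis
qed

lemma example_four: "\<exists>P. admissible 4 6 P \<and> total_surface P = 148"
proof -
  define Ks where "Ks = [brick 0 4 0 4 0 3, brick 0 3 0 1 3 4, brick 3 4 0 1 3 4,
     brick 0 2 1 4 3 4, brick 2 4 1 3 3 4, brick 2 4 3 4 3 4]"
  have "{brick 0 4 0 4 0 3} \<union> (({brick 0 3 0 1 3 4} \<union> {brick 3 4 0 1 3 4}) \<union>
     ({brick 0 2 1 4 3 4} \<union> ({brick 2 4 1 3 3 4} \<union> {brick 2 4 3 4 3 4}))) division_of brick 0 4 0 4 0 4"
    by (rule brick_split_z[where z' = "3"], simp, simp,
        rule brick_self, simp, simp, simp,
        rule brick_split_y[where y' = "1"], simp, simp,
        rule brick_split_x[where x' = "3"], simp, simp,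
        rule brick_self, simp, simp, simp,
        rule brick_self, simp, simp, simp,
        rule brick_split_x[where x' = "2"], simp, simp,
        rule brick_self, simp, simp, simp,
        rule brick_split_y[where y' = "3"], simp, simp,
        rule brick_self, simp, simp, simp,
        rule brick_self, simp, simp, simp)
  then have div: "set Ks division_of cube 4" unfolding cube_brick Ks_def by (simp add: insert_commute)
  have "distinct (map vol Ks)" by (simp add: Ks_def vol_brick)
  moreover have "\<forall>K\<in>set Ks. nat_brick K" by (simp add: Ks_def nat_brick_brick)
  ultimately have "admissible 4 (length Ks) (set Ks)" "total_surface (set Ks) = sum_list (map surface_area Ks)"
    using admissible_bricks[OF div] unfolding nat_brick_def by blast+
  moreover have "length Ks = 6" "sum_list (map surface_area Ks) = 148"
    by (simp_all add: Ks_def surface_brick)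
  ultimately show ?thesis by metis
qed

text \<open>Too short for four distinct sticks: the top layer is cut into an \<open>n \<times> (n - 2)\<close> slab and a strip
  of width 2, whose end of length 3 is cut into \<open>3 \<times> 1\<close>, \<open>1 \<times> 1\<close> and \<open>2 \<times> 1\<close>.\<close>

lemma example_five_to_nine:
  assumes "5 \<le> n" "n \<le> 9"
  shows "\<exists>P. admissible n 6 P \<and> total_surface P = 8 * real n ^ 2 + 2 * real n + 12"
proof -
  define r where "r = real n"
  have r: "r \<in> {5, 6, 7, 8, 9}" using assms unfolding r_def by (auto simp: numeral_eq_Suc le_Suc_eq)
  have r5: "5 \<le> r" using r by auto
  define Ks where "Ks = [brick 0 r 0 r 0 (r - 1), brick 0 r 0 (r - 2) (r - 1) r,
     brick 0 (r - 3) (r - 2) r (r - 1) r, brick (r - 3) r (r - 2) (r - 1) (r - 1) r,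
     brick (r - 3) (r - 2) (r - 1) r (r - 1) r, brick (r - 2) r (r - 1) r (r - 1) r]"
  have "{brick 0 r 0 r 0 (r - 1)} \<union> ({brick 0 r 0 (r - 2) (r - 1) r} \<union>
     ({brick 0 (r - 3) (r - 2) r (r - 1) r} \<union> ({brick (r - 3) r (r - 2) (r - 1) (r - 1) r} \<union>
     ({brick (r - 3) (r - 2) (r - 1) r (r - 1) r} \<union> {brick (r - 2) r (r - 1) r (r - 1) r}))))
     division_of brick 0 r 0 r 0 r"
    by (insert r5,
        rule brick_split_z[where z' = "r - 1"], simp, simp,
        rule brick_self, simp, simp, simp,
        rule brick_split_y[where y' = "r - 2"], simp, simp,
        rule brick_self, simp, simp, simp,
        rule brick_split_x[where x' = "r - 3"], simp, simp,
        rule brick_self, simp, simp, simp,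
        rule brick_split_y[where y' = "r - 1"], simp, simp,
        rule brick_self, simp, simp, simp,
        rule brick_split_x[where x' = "r - 2"], simp, simp,
        rule brick_self, simp, simp, simp,
        rule brick_self, simp, simp, simp)
  then have div: "set Ks division_of cube n" unfolding cube_brick Ks_def r_def by (simp add: insert_commute)
  have "distinct (map vol Ks)" using r by (auto simp add: Ks_def vol_brick)
  moreover have "\<forall>K\<in>set Ks. nat_brick K" using r by (auto simp add: Ks_def nat_brick_brick)
  ultimately have "admissible n (length Ks) (set Ks)" "total_surface (set Ks) = sum_list (map surface_area Ks)"
    using admissible_bricks[OF div] unfolding nat_brick_def by blast+
  moreover have "sum_list (map surface_area Ks) = 8 * real n ^ 2 + 2 * real n + 12"
    using r unfolding r_def[symmetric] by (auto simp add: Ks_def surface_brick)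
  moreover have "length Ks = 6" by (simp add: Ks_def)
  ultimately show ?thesis by metis
qed

section \<open>The cube of side three\<close>

text \<open>The possible dimensions of a piece in the cube of side 3, as sorted lists.\<close>

definition triples :: "real list set" where
  "triples = {[1,1,1], [1,1,2], [1,1,3], [1,2,2], [1,2,3], [1,3,3], [2,2,2], [2,2,3], [2,3,3], [3,3,3]}"

lemma sorted_triples:
  assumes "x \<in> {1, 2, 3}" "y \<in> {1, 2, 3}" "z \<in> {1, 2, 3}"
  shows "sorted_list_of_multiset {# x, y, z #} \<in> triples"
  using assms unfolding triples_def by (elim insertE emptyE) simp_all

lemma triplesD: "l \<in> triples \<Longrightarrow> mset l = {# l ! 0, l ! 1, l ! 2 #}"
  unfolding triples_def by (elim insertE emptyE) simp_all

text \<open>The \<open>b\<close>s indicate which of the ten shapes occur. Six distinct shapes of total volume 27 are only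
  possible with volumes 1, 2, 3, 4, 8 and 9.\<close>

lemma volume_flat_area_ten:
  fixes b1 b2 b3 b4 b5 b6 b7 b8 b9 b10 :: real
  assumes "b1 \<in> {0,1}" "b2 \<in> {0,1}" "b3 \<in> {0,1}" "b4 \<in> {0,1}" "b5 \<in> {0,1}"
    "b6 \<in> {0,1}" "b7 \<in> {0,1}" "b8 \<in> {0,1}" "b9 \<in> {0,1}" "b10 \<in> {0,1}"
    and c: "b1 + b2 + b3 + b4 + b5 + b6 + b7 + b8 + b9 + b10 = 6"
    and v: "b1 + 2 * b2 + 3 * b3 + 4 * b4 + 6 * b5 + 9 * b6 + 8 * b7 + 12 * b8 + 18 * b9 + 27 * b10 = 27"
  shows "3 * b1 + 5 * b2 + 7 * b3 + 8 * b4 + 11 * b5 + 15 * b6 + 12 * b7 + 16 * b8 + 21 * b9 + 27 * b10 \<ge> 50"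
proof -
  have "x = 0 \<or> x = 1" if "x \<in> {0, 1}" for x :: real using that by simp
  note d = assms(1-10)[THEN this]
  have "0 \<le> x" "x \<le> 1" if "x = 0 \<or> x = 1" for x :: real using that by auto
  note lb = d[THEN this(1)] and ub = d[THEN this(2)]
  \<comment> \<open>relative to volume 6 per piece, the shapes of volume 1 to 4 fall short by at most 14 in total\<close>
  have e: "3 * b6 + 2 * b7 + 6 * b8 + 12 * b9 + 21 * b10 = 5 * b1 + 4 * b2 + 3 * b3 + 2 * b4 - 9"
    using c v by simp
  have "5 * b1 + 4 * b2 + 3 * b3 + 2 * b4 \<le> 14" using ub(1-4) by simp
  then have e': "3 * b6 + 2 * b7 + 6 * b8 + 12 * b9 + 21 * b10 \<le> 5" using e by simp
  have z8: "b8 = 0" and z9: "b9 = 0" and z10: "b10 = 0"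
    using e' d(8-10) lb(6-10) by auto
  have o6: "b6 = 1" using d(6)
  proof
    assume "b6 = 0"
    then have "b1 + 2 * b2 + 3 * b3 + 4 * b4 + 6 * b5 + 8 * b7 = 27" using v z8 z9 z10 by simp
    then show ?thesis using ub(1-5,7) by simp
  qed
  have z5: "b5 = 0" using d(5)
  proof
    assume "b5 = 1"
    then have cv: "b1 + b2 + b3 + b4 + b7 = 4" "b1 + 2 * b2 + 3 * b3 + 4 * b4 + 8 * b7 = 12"
      using c v z8 z9 z10 o6 by simp_all
    show ?thesis using cv d(1) d(2) d(3) d(4) d(7) by (elim disjE) simp_all
  qed
  have "b1 + b2 + b3 + b4 + b7 = 5" using c z5 o6 z8 z9 z10 by simp
  then have "b1 = 1" "b2 = 1" "b3 = 1" "b4 = 1" "b7 = 1" using ub(1-4,7) by simp_all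
  then show ?thesis using o6 z5 z8 z9 z10 by simp
qed

lemma total_surface_three:
  assumes P: "admissible 3 6 P"
  shows "total_surface P \<ge> 100"
proof -
  note t = admissible_tiling[OF P, simplified]
  define q where "q K = sorted_list_of_multiset (dims K)" for K
  have q: "q K \<in> triples \<and> dims K = {# q K ! 0, q K ! 1, q K ! 2 #}" if K: "K \<in> P" for K
  proof -
    have s: "side K i \<in> {1, 2, 3}" for i
    proof -
      obtain m where m: "side K i = real m" using tiling_facts(3)[OF t(1) K, of i] by (auto elim: Nats_cases)
      have "1 \<le> side K i" by (rule tiling_facts(4)[OF t(1) K])
      moreover have "side K i \<le> 3" using tiling_facts(5)[OF t(1) K, of i] by (simp add: side_cube)
      ultimately have "m \<in> {1, 2, 3}" using m by auto
      then show ?thesis using m by auto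
    qed
    have "q K \<in> triples" unfolding q_def dims_def by (rule sorted_triples[OF s s s])
    moreover have "dims K = mset (q K)" unfolding q_def by (simp only: mset_sorted_list_of_multiset)
    ultimately show ?thesis using triplesD[of "q K"] by (simp only:)
  qed
  have injq: "inj_on q P"
  proof (rule inj_onI)
    fix K L assume KL: "K \<in> P" "L \<in> P" and eq: "q K = q L"
    have "dims K = dims L" using q[OF KL(1)] q[OF KL(2)] unfolding eq by (simp only:)
    then show "K = L" using t(3) KL by (auto dest: inj_onD)
  qed
  have fP: "finite P" using tiling_facts(1)[OF t(1)] .
  have conv: "(\<Sum>K\<in>P. f (q K)) = (\<Sum>l\<in>triples. of_bool (l \<in> q ` P) * f l)" for f :: "real list \<Rightarrow> real"
  proof -
    have "(\<Sum>K\<in>P. f (q K)) = (\<Sum>l\<in>q ` P. f l)" by (simp add: sum.reindex[OF injq])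
    also have "\<dots> = (\<Sum>l\<in>triples. of_bool (l \<in> q ` P) * f l)"
      by (rule sum.mono_neutral_cong_left) (use q in \<open>auto simp: triples_def\<close>)
    finally show ?thesis .
  qed
  have expand: "(\<Sum>l\<in>triples. g l) = g [1,1,1] + g [1,1,2] + g [1,1,3] + g [1,2,2] + g [1,2,3]
      + g [1,3,3] + g [2,2,2] + g [2,2,3] + g [2,3,3] + g [3,3,3]" for g :: "real list \<Rightarrow> real"
    unfolding triples_def by simp
  let ?b = "\<lambda>l. of_bool (l \<in> q ` P) :: real"
  have "(\<Sum>K\<in>P. 1 :: real) = 6" using t(2) by simp
  then have c: "?b [1,1,1] + ?b [1,1,2] + ?b [1,1,3] + ?b [1,2,2] + ?b [1,2,3]
      + ?b [1,3,3] + ?b [2,2,2] + ?b [2,2,3] + ?b [2,3,3] + ?b [3,3,3] = 6"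
    unfolding conv[of "\<lambda>_. 1"] expand by simp
  have "(\<Sum>K\<in>P. vol K) = 27"
    using tiling_facts(6)[OF t(1)] by (simp add: vol_axes[OF axes_123] side_cube)
  also have "(\<Sum>K\<in>P. vol K) = (\<Sum>K\<in>P. q K ! 0 * q K ! 1 * q K ! 2)"
    by (rule sum.cong[OF refl]) (rule vol_dims, use q in blast)
  finally have v: "?b [1,1,1] + 2 * ?b [1,1,2] + 3 * ?b [1,1,3] + 4 * ?b [1,2,2] + 6 * ?b [1,2,3]
      + 9 * ?b [1,3,3] + 8 * ?b [2,2,2] + 12 * ?b [2,2,3] + 18 * ?b [2,3,3] + 27 * ?b [3,3,3] = 27"
    unfolding conv[of "\<lambda>l. l ! 0 * l ! 1 * l ! 2"] expand by (simp add: mult.commute)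
  have "(\<Sum>K\<in>P. flat_area K) = (\<Sum>K\<in>P. q K ! 0 * q K ! 1 + q K ! 1 * q K ! 2 + q K ! 2 * q K ! 0)"
    by (rule sum.cong[OF refl]) (rule flat_area_dims, use q in blast)
  also have "\<dots> = 3 * ?b [1,1,1] + 5 * ?b [1,1,2] + 7 * ?b [1,1,3] + 8 * ?b [1,2,2] + 11 * ?b [1,2,3]
      + 15 * ?b [1,3,3] + 12 * ?b [2,2,2] + 16 * ?b [2,2,3] + 21 * ?b [2,3,3] + 27 * ?b [3,3,3]"
    unfolding conv[of "\<lambda>l. l ! 0 * l ! 1 + l ! 1 * l ! 2 + l ! 2 * l ! 0"] expand
    by (simp add: mult.commute)
  also have "\<dots> \<ge> 50"
    by (rule volume_flat_area_ten[OF _ _ _ _ _ _ _ _ _ _ c v]) simp_all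
  finally have "(\<Sum>K\<in>P. flat_area K) \<ge> 50" .
  then show ?thesis
    unfolding total_surface_cost[of P 3] cost_def by (simp add: flat_area_def side_cube)
qed

section \<open>The minimum and the optimal dissections\<close>

lemma T_eqI:
  assumes "admissible n k P" "total_surface P = v" "\<And>Q. admissible n k Q \<Longrightarrow> v \<le> total_surface Q"
  shows "T n k = v"
  unfolding T_def by (rule Least_equality) (use assms in auto)

lemma min_interface_eqI:
  assumes "admissible n k P" "internal_interface P = v" "\<And>Q. admissible n k Q \<Longrightarrow> v \<le> internal_interface Q"
  shows "min_interface n k = v"
  unfolding min_interface_def by (rule Least_equality) (use assms in auto)

text \<open>The dichotomy behind the theorem. The second alternative is void for \<open>n < 10\<close>.\<close>

lemma cost_or_sticks:
  assumes "admissible n 6 P" "n \<ge> 4"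
  shows "cost (cube n) P \<ge> real n ^ 2 + real n + 6 \<or> (\<exists>L\<in>four_distinct_parts n. sticks n L P)"
  using cost_dichotomy[OF assms] block_slab_column_sticks[OF assms(1)] assms(2) by fastforce

lemma total_surface_small:
  assumes "admissible n 6 P" "4 \<le> n" "n \<le> 9"
  shows "total_surface P \<ge> 8 * real n ^ 2 + 2 * real n + 12"
proof -
  have "\<not> (\<exists>L\<in>four_distinct_parts n. sticks n L P)" using four_parts_ge_10 assms(3) by fastforce
  then have "cost (cube n) P \<ge> real n ^ 2 + real n + 6" using cost_or_sticks[OF assms(1,2)] by blast
  then show ?thesis unfolding total_surface_cost[of P n] by simp
qed

lemma cost_lower:
  assumes "admissible n 6 P" "n \<ge> 4"
  shows "cost (cube n) P \<ge> real n ^ 2 + real n + 3"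
proof (rule disjE[OF cost_or_sticks[OF assms]])
  assume "\<exists>L\<in>four_distinct_parts n. sticks n L P"
  then obtain L where L: "L \<in> four_distinct_parts n" "sticks n L P" by (elim bexE)
  have "cost (cube n) P = real n ^ 2 + real n + 3" by (rule sticks_facts(2)[OF L]) (use assms in simp)
  then show ?thesis by simp
qed simp

lemma four_parts_exist: "n \<ge> 10 \<Longrightarrow> {1, 2, 3, n - 6} \<in> four_distinct_parts n"
  unfolding four_distinct_parts_def by auto

lemma T_large:
  assumes n: "n \<ge> 10"
  shows "T n 6 = 8 * real n ^ 2 + 2 * real n + 6" "min_interface n 6 = real n ^ 2 + real n + 3"
proof -
  have L: "{1, 2, 3, n - 6} \<in> four_distinct_parts n" by (rule four_parts_exist[OF n])
  obtain P where P: "sticks n {1, 2, 3, n - 6} P" using sticks_exist[OF L] by blast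
  have n3: "n \<ge> 3" and n4: "n \<ge> 4" using n by auto
  have adm: "admissible n 6 P" by (rule sticks_facts(1)[OF L P n3])
  have co: "cost (cube n) P = real n ^ 2 + real n + 3" by (rule sticks_facts(2)[OF L P n3])
  show "T n 6 = 8 * real n ^ 2 + 2 * real n + 6"
  proof (rule T_eqI[OF adm])
    show "total_surface P = 8 * real n ^ 2 + 2 * real n + 6"
      unfolding total_surface_cost[of P n] co by simp
    show "8 * real n ^ 2 + 2 * real n + 6 \<le> total_surface Q" if "admissible n 6 Q" for Q
      unfolding total_surface_cost[of Q n] using cost_lower[OF that n4] by simp
  qed
  show "min_interface n 6 = real n ^ 2 + real n + 3"
  proof (rule min_interface_eqI[OF adm])
    show "internal_interface P = real n ^ 2 + real n + 3"
      using admissible_interface[OF adm] co by simp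
    show "real n ^ 2 + real n + 3 \<le> internal_interface Q" if "admissible n 6 Q" for Q
      using admissible_interface[OF that] cost_lower[OF that n4] by simp
  qed
qed

lemma optimal_iff_cost:
  "n \<ge> 10 \<Longrightarrow> optimal n P \<longleftrightarrow> admissible n 6 P \<and> cost (cube n) P = real n ^ 2 + real n + 3"
  unfolding optimal_def T_large(1) total_surface_cost[of P n] by auto

lemma optimal_iff_sticks:
  assumes n: "n \<ge> 10"
  shows "optimal n P \<longleftrightarrow> (\<exists>L\<in>four_distinct_parts n. sticks n L P)"
proof
  assume "optimal n P"
  then have P: "admissible n 6 P" "cost (cube n) P = real n ^ 2 + real n + 3"
    using optimal_iff_cost[OF n] by auto
  show "\<exists>L\<in>four_distinct_parts n. sticks n L P"
  proof (rule disjE[OF cost_or_sticks[OF P(1)]])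
    assume "cost (cube n) P \<ge> real n ^ 2 + real n + 6"
    then show ?thesis using P(2) by simp
  qed (use n in simp)
next
  assume "\<exists>L\<in>four_distinct_parts n. sticks n L P"
  then obtain L where L: "L \<in> four_distinct_parts n" "sticks n L P" by (elim bexE)
  have "n \<ge> 3" using n by simp
  then show "optimal n P" using sticks_facts(1,2)[OF L] optimal_iff_cost[OF n] by simp
qed

lemma optimal_structure:
  assumes n: "n \<ge> 10" and P: "optimal n P"
  obtains i K l L F where "admissible n 6 P" "block_slab_column (real n) (cube n) P i K l L F"
    "stick_lengths n P \<in> four_distinct_parts n"
    "dims ` (P - {K} - {L}) = (\<lambda>l. {# 1, 1, real l #}) ` stick_lengths n P"
proof -
  have adm: "admissible n 6 P" and co: "cost (cube n) P = real n ^ 2 + real n + 3"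
    using P optimal_iff_cost[OF n] by auto
  have n3: "n \<ge> 3" and n4: "n \<ge> 4" using n by auto
  have "\<not> cost (cube n) P \<ge> real n ^ 2 + real n + 6" using co by simp
  then obtain i K l L F where str: "block_slab_column (real n) (cube n) P i K l L F"
    using cost_dichotomy[OF adm n4] by blast
  obtain M where M: "M \<in> four_distinct_parts n" "sticks n M P"
    "dims ` (P - {K} - {L}) = (\<lambda>l. {# 1, 1, real l #}) ` M"
    using block_slab_column_sticks[OF adm str n3] by (elim bexE conjE)
  have "stick_lengths n P = M" by (rule stick_lengths_eq[OF M(1,2) n3])
  then show thesis using that[OF adm str] M by simp
qed

lemma symmetric_iff_stick_lengths:
  assumes n: "n \<ge> 10" and P: "optimal n P" and Q: "optimal n Q"
  shows "same_up_to_symmetry n P Q \<longleftrightarrow> stick_lengths n P = stick_lengths n Q"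
proof
  assume same: "same_up_to_symmetry n P Q"
  have "admissible n 6 P" "admissible n 6 Q" using P Q unfolding optimal_def by auto
  then have "vol ` P = vol ` Q" using same by (rule symmetric_same_volumes)
  then show "stick_lengths n P = stick_lengths n Q" by (simp add: stick_lengths_def)
next
  assume eq: "stick_lengths n P = stick_lengths n Q"
  obtain i K l L F where p: "admissible n 6 P" "block_slab_column (real n) (cube n) P i K l L F"
    "stick_lengths n P \<in> four_distinct_parts n"
    "dims ` (P - {K} - {L}) = (\<lambda>l. {# 1, 1, real l #}) ` stick_lengths n P"
    by (rule optimal_structure[OF n P])
  obtain i' K' l' L' F' where q: "admissible n 6 Q" "block_slab_column (real n) (cube n) Q i' K' l' L' F'"
    "stick_lengths n Q \<in> four_distinct_parts n"
    "dims ` (Q - {K'} - {L'}) = (\<lambda>l. {# 1, 1, real l #}) ` stick_lengths n Q"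
    by (rule optimal_structure[OF n Q])
  have "inj_on dims P" using p(1) unfolding admissible_def by simp
  then have i: "inj_on dims (P - {K} - {L})" by (rule inj_on_subset) blast
  have "inj_on dims Q" using q(1) unfolding admissible_def by simp
  then have i': "inj_on dims (Q - {K'} - {L'})" by (rule inj_on_subset) blast
  have "image_mset dims (mset_set (P - {K} - {L})) = image_mset dims (mset_set (Q - {K'} - {L'}))"
    unfolding image_mset_mset_set[OF i] image_mset_mset_set[OF i'] p(4) q(4) eq ..
  then show "same_up_to_symmetry n P Q"
    using same_lengths_symmetric[OF p(2) q(2)] n by simp
qed

lemma card_symmetry_classes:
  assumes n: "n \<ge> 10"
  shows "card (symmetry_classes n) = card (four_distinct_parts n)"
proof -
  let ?C = "\<lambda>L. {P. optimal n P \<and> stick_lengths n P = L}"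
  have n3: "n \<ge> 3" using n by simp
  have ex: "\<exists>P. optimal n P \<and> stick_lengths n P = L" if L: "L \<in> four_distinct_parts n" for L
  proof -
    obtain P where P: "sticks n L P" using sticks_exist[OF L] ..
    have "optimal n P" unfolding optimal_iff_sticks[OF n] using L P by (rule rev_bexI)
    then show ?thesis using stick_lengths_eq[OF L P n3] by (intro exI conjI)
  qed
  have parts: "stick_lengths n P \<in> four_distinct_parts n" if "optimal n P" for P
    by (rule optimal_structure[OF n that])
  have cls: "{(P, Q). optimal n P \<and> optimal n Q \<and> same_up_to_symmetry n P Q} `` {P}
      = ?C (stick_lengths n P)" if P: "optimal n P" for P
  proof (rule set_eqI)
    fix Q
    show "Q \<in> {(P, Q). optimal n P \<and> optimal n Q \<and> same_up_to_symmetry n P Q} `` {P}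
        \<longleftrightarrow> Q \<in> ?C (stick_lengths n P)"
      using P symmetric_iff_stick_lengths[OF n P, of Q] by (simp; metis)
  qed
  have "symmetry_classes n = ?C ` four_distinct_parts n"
  proof (rule set_eqI)
    fix X
    have "X \<in> symmetry_classes n \<longleftrightarrow> (\<exists>P. optimal n P \<and>
        X = {(P, Q). optimal n P \<and> optimal n Q \<and> same_up_to_symmetry n P Q} `` {P})"
      unfolding symmetry_classes_def quotient_def by auto
    also have "\<dots> \<longleftrightarrow> (\<exists>P. optimal n P \<and> X = ?C (stick_lengths n P))"
      using cls by (intro ex_cong1 conj_cong refl) simp
    also have "\<dots> \<longleftrightarrow> X \<in> ?C ` four_distinct_parts n"
    proof
      assume "\<exists>P. optimal n P \<and> X = ?C (stick_lengths n P)"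
      then obtain P where "optimal n P" "X = ?C (stick_lengths n P)" by (elim exE conjE)
      then show "X \<in> ?C ` four_distinct_parts n" using parts by (intro image_eqI)
    next
      assume "X \<in> ?C ` four_distinct_parts n"
      then obtain L where L: "L \<in> four_distinct_parts n" "X = ?C L" by (elim imageE)
      obtain P where "optimal n P" "stick_lengths n P = L" using ex[OF L(1)] by (elim exE conjE)
      then show "\<exists>P. optimal n P \<and> X = ?C (stick_lengths n P)" using L(2) by (intro exI[of _ P]) simp
    qed
    finally show "X \<in> symmetry_classes n \<longleftrightarrow> X \<in> ?C ` four_distinct_parts n" .
  qed
  moreover have "inj_on ?C (four_distinct_parts n)"
  proof (rule inj_onI)
    fix L M assume L: "L \<in> four_distinct_parts n" and eq: "?C L = ?C M"
    obtain P where P: "optimal n P" "stick_lengths n P = L" using ex[OF L] by (elim exE conjE)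
    then have "P \<in> ?C L" by simp
    then have "P \<in> ?C M" using eq by (simp only:)
    then show "L = M" using P(2) by simp
  qed
  ultimately show ?thesis by (simp only: card_image)
qed

theorem theorem1:
  shows "(\<forall>n::nat. n \<ge> 10 \<longrightarrow>
            T n 6 = 8 * real n ^ 2 + 2 * real n + 6 \<and>
            min_interface n 6 = real n ^ 2 + real n + 3 \<and>
            (\<forall>P. optimal n P \<longleftrightarrow> block_slab_sticks n P) \<and>
            card (symmetry_classes n) = card (four_distinct_parts n)) \<and>
         (\<forall>n::nat. 5 \<le> n \<and> n \<le> 9 \<longrightarrow>
            T n 6 = 8 * real n ^ 2 + 2 * real n + 12) \<and>
         T 3 6 = 100 \<and>
         T 4 6 = 148"
proof (intro conjI allI impI)
  fix n :: nat assume n: "n \<ge> 10"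
  show "T n 6 = 8 * real n ^ 2 + 2 * real n + 6" "min_interface n 6 = real n ^ 2 + real n + 3"
    by (rule T_large[OF n])+
  show "optimal n P \<longleftrightarrow> block_slab_sticks n P" for P
    unfolding block_slab_sticks_iff by (rule optimal_iff_sticks[OF n])
  show "card (symmetry_classes n) = card (four_distinct_parts n)"
    by (rule card_symmetry_classes[OF n])
next
  fix n :: nat assume n: "5 \<le> n \<and> n \<le> 9"
  obtain P where P: "admissible n 6 P" "total_surface P = 8 * real n ^ 2 + 2 * real n + 12"
    using example_five_to_nine n by blast
  show "T n 6 = 8 * real n ^ 2 + 2 * real n + 12"
    by (rule T_eqI[OF P]) (rule total_surface_small, use n in auto)
next
  obtain P where P: "admissible 3 6 P" "total_surface P = 100" using example_three by blast
  show "T 3 6 = 100" by (rule T_eqI[OF P total_surface_three])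
next
  obtain P where P: "admissible 4 6 P" "total_surface P = 148" using example_four by blast
  show "T 4 6 = 148" by (rule T_eqI[OF P]) (use total_surface_small[of 4] in fastforce)
qed

end
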